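(* Let $\rho=\mathrm dt\otimes\rho_t\in\mathcal M_+([0,T]\times D)$ with $\rho_t(D)$ equal to a constant for almost every $t\in[0,T]$. For any sequence of positive numbers $\delta_n\to0$ there exists a sequence of Radon measures $(\rho_n,\eta_n)_n\subset\mathcal M_+([0,T]\times D)\times\mathcal M([0,T]\times\mathbb R^3)^3$ such that $\rho_n$ converges weakly-* to $\rho$ and $S(\rho_n,\eta_n)\le 1/\delta_n$ for all $n$, and one can additionally choose one of the following assertions to hold: (a) $\mathbb W_2(\rho_n,\rho)\lesssim\delta_n^{1/6}$, i.e. there is a constant $c>0$ independent of $n$ with $\mathbb W_2(\rho_n,\rho)\le c\,\delta_n^{1/6}$. (b) Given a sequence of nonnegative numbers $\Delta T_n\to0$, there exists a subsequence along which $\mathbb W_2(\rho_{n,t_n},\rho_t)\to0$ for almost every $t\in[0,T]$ and any sequence $t_n\in[0,T]$ with $|t_n-t|\le\Delta T_n$.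
   Context: $T>0$ and $D\subset\mathbb R^3$ is the closure of a bounded, open and convex set with $0\in\operatorname{int}(D)$. $\mathcal M_+(X)$, $\mathcal M(X)^3$ denote the nonnegative and the $\mathbb R^3$-valued Radon measures on $X$. $\mathbb W_2$ is the Wasserstein-2 distance between nonnegative measures of equal mass (on $[0,T]\times D$ in (a), on $D$ in (b), with Euclidean ground distance). Continuity equation: $(\rho,\eta)$ satisfies $\partial_t\rho+\operatorname{div}\eta=0$ if $$\int_{[0,T]\times D}\partial_t\varphi\,\mathrm d\rho+\int_{[0,T]\times D}\langle\nabla_x\varphi,\mathrm d\eta\rangle=0\quad\text{for all }\varphi\in C_c^1((0,T)\times D)$$ ($\varphi$ need not vanish on $\partial D$); any such $\rho\ge0$ disintegrates as $\rho=\mathrm dt\otimes\rho_t$ with $\rho_t(D)$ a.e. constant. Benamou–Brenier functional: $$S(\rho,\eta)=\begin{cases}\displaystyle\int_0^T\int_D\left|\frac{\mathrm d\eta_t}{\mathrm d\rho_t}\right|^2\mathrm d\rho_t\,\mathrm dt&\text{if }\rho\ge0,\ \eta\ll\rho\text{ and the continuity equation holds},\\ \infty&\text{else.}\end{cases}$$ Since $S(\rho_n,\eta_n)<\infty$, $\rho_n=\mathrm dt\otimes\rho_{n,t}$ has a disintegration for which $t\mapsto\rho_{n,t}$ is weakly-* continuous on $[0,T]$; $\rho_{n,t_n}$ in (b) refers to this representative. *)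

theory Defs
  imports "HOL-Analysis.Analysis"
begin

text \<open>
  Measures on a closed set X are represented as Borel measures on the ambient Euclidean space that
  vanish off X. Radon measures have finite total mass here; a finite Borel measure on a
  Euclidean space is automatically regular. Space-time is \<^typ>\<open>real \<times> (real^3)\<close>, whose
  \<^const>\<open>dist\<close> is the Euclidean distance of \<open>\<real>\<^sup>4\<close>.
\<close>

definition radon_nonneg :: "'a::topological_space set \<Rightarrow> 'a measure set" where
  "radon_nonneg X = {\<mu>. sets \<mu> = sets borel \<and> finite_measure \<mu> \<and> emeasure \<mu> (- X) = 0}"

text \<open>Vector measures are set functions; only their values on Borel sets matter.\<close>

definition radon_vec :: "'a::topological_space set \<Rightarrow> ('a set \<Rightarrow> 'b::real_normed_vector) set" where
  "radon_vec X = {\<eta>.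
     (\<forall>A :: nat \<Rightarrow> 'a set. range A \<subseteq> sets borel \<longrightarrow> disjoint_family A
        \<longrightarrow> (\<lambda>i. \<eta> (A i)) sums \<eta> (\<Union>i. A i)) \<and>
     (\<forall>A \<in> sets borel. A \<inter> X = {} \<longrightarrow> \<eta> A = 0)}"

text \<open>
  Positive part of the Jordan decomposition of a signed measure. The empty set is among the
  competitors, and \<^const>\<open>ennreal\<close> sends negative numbers to 0.
\<close>

definition jordan_pos :: "('a::topological_space set \<Rightarrow> real) \<Rightarrow> 'a measure" where
  "jordan_pos \<nu> = measure_of UNIV (sets borel) (\<lambda>A. SUP B \<in> {B \<in> sets borel. B \<subseteq> A}. ennreal (\<nu> B))"

definition signed_integral ::
  "'a::topological_space set \<Rightarrow> ('a set \<Rightarrow> real) \<Rightarrow> ('a \<Rightarrow> real) \<Rightarrow> real" where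
  "signed_integral X \<nu> f =
     (LINT x:X|jordan_pos \<nu>. f x) - (LINT x:X|jordan_pos (\<lambda>A. - \<nu> A). f x)"

definition vec_integral ::
  "'a::topological_space set \<Rightarrow> ('a set \<Rightarrow> real^'n) \<Rightarrow> ('a \<Rightarrow> real^'n) \<Rightarrow> real" where
  "vec_integral X \<eta> g = (\<Sum>i\<in>UNIV. signed_integral X (\<lambda>A. \<eta> A $ i) (\<lambda>x. g x $ i))"

definition vec_abs_cont :: "('a::topological_space set \<Rightarrow> 'b::zero) \<Rightarrow> 'a measure \<Rightarrow> bool" where
  "vec_abs_cont \<eta> \<mu> \<longleftrightarrow> (\<forall>A \<in> sets borel. emeasure \<mu> A = 0 \<longrightarrow> \<eta> A = 0)"

text \<open>Radon--Nikodym derivative of the vector measure \<open>\<eta>\<close> with respect to \<open>\<mu>\<close>.\<close>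

definition vec_RN_deriv ::
  "'a::topological_space measure \<Rightarrow> ('a set \<Rightarrow> 'b::euclidean_space) \<Rightarrow> 'a \<Rightarrow> 'b" where
  "vec_RN_deriv \<mu> \<eta> = (SOME v. v \<in> borel_measurable borel \<and> integrable \<mu> v \<and>
     (\<forall>A \<in> sets borel. \<eta> A = (LINT x:A|\<mu>. v x)))"

text \<open>\<open>\<rho> = dt \<otimes> \<rho>\<^sub>t\<close> on \<open>[0,T] \<times> D\<close>, and \<open>\<eta> = dt \<otimes> \<eta>\<^sub>t\<close> on \<open>[0,T] \<times> \<real>\<^sup>3\<close>.\<close>

definition disintegrates ::
  "real \<Rightarrow> (real^3) set \<Rightarrow> (real \<times> (real^3)) measure \<Rightarrow> (real \<Rightarrow> (real^3) measure) \<Rightarrow> bool" where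
  "disintegrates T D \<rho> \<rho>t \<longleftrightarrow>
     (\<forall>t\<in>{0..T}. \<rho>t t \<in> radon_nonneg D) \<and>
     (\<forall>B \<in> sets borel. (\<lambda>t. emeasure (\<rho>t t) B) \<in> borel_measurable (restrict_space borel {0..T})) \<and>
     (\<forall>A \<in> sets borel. emeasure \<rho> A = (\<integral>\<^sup>+ t\<in>{0..T}. emeasure (\<rho>t t) {x. (t, x) \<in> A} \<partial>lborel))"

definition disintegrates_vec ::
  "real \<Rightarrow> ((real \<times> (real^3)) set \<Rightarrow> real^3) \<Rightarrow> (real \<Rightarrow> (real^3) set \<Rightarrow> real^3) \<Rightarrow> bool" where
  "disintegrates_vec T \<eta> \<eta>t \<longleftrightarrow>
     (\<forall>t\<in>{0..T}. \<eta>t t \<in> radon_vec UNIV) \<and>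
     (\<forall>A \<in> sets borel. set_integrable lborel {0..T} (\<lambda>t. \<eta>t t {x. (t, x) \<in> A}) \<and>
        \<eta> A = (LINT t:{0..T}|lborel. \<eta>t t {x. (t, x) \<in> A}))"

text \<open>
  \<open>\<phi> \<in> C\<^sub>c\<^sup>1((0,T) \<times> D)\<close> with time derivative \<open>p\<close> and spatial gradient \<open>g\<close>. The three functions are
  extended by 0 off the compact set K, which may touch the lateral boundary \<open>(0,T) \<times> frontier D\<close>.
  Derivatives at boundary points are relative to \<open>(0,T) \<times> D\<close>; they are unique as D is convex with
  nonempty interior.
\<close>

definition C1c_test ::
  "real \<Rightarrow> (real^3) set \<Rightarrow> (real \<times> (real^3) \<Rightarrow> real) \<Rightarrow> (real \<times> (real^3) \<Rightarrow> real)
     \<Rightarrow> (real \<times> (real^3) \<Rightarrow> real^3) \<Rightarrow> bool" where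
  "C1c_test T D \<phi> p g \<longleftrightarrow>
     (\<forall>z \<in> {0<..<T} \<times> D. (\<phi> has_derivative (\<lambda>(s, y). p z * s + g z \<bullet> y)) (at z within {0<..<T} \<times> D)) \<and>
     continuous_on ({0<..<T} \<times> D) p \<and> continuous_on ({0<..<T} \<times> D) g \<and>
     (\<exists>K. compact K \<and> K \<subseteq> {0<..<T} \<times> D \<and> (\<forall>z. z \<notin> K \<longrightarrow> \<phi> z = 0 \<and> p z = 0 \<and> g z = 0))"

definition continuity_eq ::
  "real \<Rightarrow> (real^3) set \<Rightarrow> (real \<times> (real^3)) measure \<Rightarrow> ((real \<times> (real^3)) set \<Rightarrow> real^3) \<Rightarrow> bool" where
  "continuity_eq T D \<rho> \<eta> \<longleftrightarrow>
     (\<forall>\<phi> p g. C1c_test T D \<phi> p g \<longrightarrow>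
        (LINT z:{0..T} \<times> D|\<rho>. p z) + vec_integral ({0..T} \<times> D) \<eta> g = 0)"

text \<open>
  Test functions vanish near \<open>t = 0\<close> and \<open>t = T\<close>, so the continuity equation does not see mass
  concentrated on the end slices. Such measures have no disintegration with respect to dt; they get
  the value infinity. The value does not depend on the chosen disintegrations.
\<close>

definition benamou_brenier ::
  "real \<Rightarrow> (real^3) set \<Rightarrow> (real \<times> (real^3)) measure \<Rightarrow> ((real \<times> (real^3)) set \<Rightarrow> real^3) \<Rightarrow> ennreal" where
  "benamou_brenier T D \<rho> \<eta> =
     (if \<rho> \<in> radon_nonneg ({0..T} \<times> D) \<and> vec_abs_cont \<eta> \<rho> \<and> continuity_eq T D \<rho> \<eta>
         \<and> (\<exists>\<rho>t. disintegrates T D \<rho> \<rho>t)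
      then let \<rho>t = (SOME \<rho>t. disintegrates T D \<rho> \<rho>t);
               \<eta>t = (SOME \<eta>t. disintegrates_vec T \<eta> \<eta>t)
           in \<integral>\<^sup>+ t\<in>{0..T}. (\<integral>\<^sup>+ x\<in>D. ennreal ((norm (vec_RN_deriv (\<rho>t t) (\<eta>t t) x))\<^sup>2) \<partial>\<rho>t t) \<partial>lborel
      else \<infinity>)"

definition couplings :: "'a::metric_space measure \<Rightarrow> 'a measure \<Rightarrow> ('a \<times> 'a) measure set" where
  "couplings \<mu> \<nu> = {\<pi>. sets \<pi> = sets borel \<and> distr \<pi> borel fst = \<mu> \<and> distr \<pi> borel snd = \<nu>}"

text \<open>Extended-valued: measures of different mass admit no coupling and have distance infinity.\<close>

definition wasserstein2 :: "'a::metric_space measure \<Rightarrow> 'a measure \<Rightarrow> ennreal" where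
  "wasserstein2 \<mu> \<nu> =
     (let C = (INF \<pi> \<in> couplings \<mu> \<nu>. \<integral>\<^sup>+ z. ennreal ((dist (fst z) (snd z))\<^sup>2) \<partial>\<pi>)
      in if C = \<infinity> then \<infinity> else ennreal (sqrt (enn2real C)))"

text \<open>For compact X this is weak-* convergence in the dual of C(X).\<close>

definition weak_star_conv ::
  "'a::topological_space set \<Rightarrow> (nat \<Rightarrow> 'a measure) \<Rightarrow> 'a measure \<Rightarrow> bool" where
  "weak_star_conv X \<mu> \<nu> \<longleftrightarrow>
     (\<forall>\<psi> :: 'a \<Rightarrow> real. continuous_on X \<psi> \<longrightarrow>
        (\<lambda>n. LINT x:X|\<mu> n. \<psi> x) \<longlonglongrightarrow> (LINT x:X|\<nu>. \<psi> x))"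

definition weak_star_continuous ::
  "real \<Rightarrow> (real^3) set \<Rightarrow> (real \<Rightarrow> (real^3) measure) \<Rightarrow> bool" where
  "weak_star_continuous T D \<mu> \<longleftrightarrow>
     (\<forall>\<psi> :: real^3 \<Rightarrow> real. continuous_on D \<psi> \<longrightarrow>
        continuous_on {0..T} (\<lambda>t. LINT x:D|\<mu> t. \<psi> x))"

definition approximating ::
  "real \<Rightarrow> (real^3) set \<Rightarrow> (real \<times> (real^3)) measure \<Rightarrow> (nat \<Rightarrow> real)
     \<Rightarrow> (nat \<Rightarrow> (real \<times> (real^3)) measure) \<Rightarrow> (nat \<Rightarrow> (real \<times> (real^3)) set \<Rightarrow> real^3) \<Rightarrow> bool" where
  "approximating T D \<rho> \<delta> \<rho>n \<eta>n \<longleftrightarrow>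
     (\<forall>n. \<rho>n n \<in> radon_nonneg ({0..T} \<times> D) \<and> \<eta>n n \<in> radon_vec ({0..T} \<times> UNIV)) \<and>
     weak_star_conv ({0..T} \<times> D) \<rho>n \<rho> \<and>
     (\<forall>n. benamou_brenier T D (\<rho>n n) (\<eta>n n) \<le> ennreal (1 / \<delta> n))"

end

theory Submission
  imports Defs
begin

text \<open>
  Split \<open>[0,T]\<close> into \<open>N\<close> cells of length \<open>h = T/N\<close>. On every cell, replace the measures \<open>\<rho>\<^sub>t\<close> by their
  average over the cell, and shrink this average towards the origin by a factor \<open>\<lambda>(t)\<close> that falls to 0
  at the two ends of the cell with slope at most \<open>L\<close> and, for large \<open>L\<close>, is 1 away from them. As \<open>D\<close> is convex and
  contains the origin, everything stays in \<open>D\<close>. At the end of a cell all the mass \<open>m\<close> sits at the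
  origin, so the pieces fit together to a continuous curve although the averages over neighbouring
  cells are unrelated: no transport between them has to be found.

  A particle at \<open>\<lambda>(t) x\<close> moves with velocity \<open>\<lambda>'(t) x\<close>, of norm at most \<open>L r\<close> if \<open>r\<close> is the radius of
  \<open>D\<close>. The fundamental theorem of calculus along these paths gives the continuity equation
  (\<open>momentum_continuity\<close>): a cell \<open>[a,b]\<close> contributes \<open>m (\<phi>(b,0) - \<phi>(a,0))\<close>, and these terms telescope
  to 0. The energy is at most \<open>(L r)\<^sup>2 m T\<close> (\<open>energy_le\<close>), hence at most \<open>1/\<delta>\<close> if \<open>L\<close> is a
  suitable multiple of \<open>\<delta>\<^sup>-\<^sup>1\<^sup>/\<^sup>2\<close>. The functional is defined through unspecified disintegrations, but they are
  unique almost everywhere (\<open>disintegrates_unique\<close>, \<open>disintegrates_vec_unique\<close>), so that it can be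
  computed from the explicit ones (\<open>benamou_brenier_le\<close>).

  To compare with \<open>\<rho>\<close>, move \<open>(t,x)\<close> to \<open>(s, \<lambda>(s) x)\<close> with \<open>s\<close> uniformly distributed in the cell of \<open>t\<close>.
  The squared distance is at most \<open>h\<^sup>2\<close> if \<open>\<lambda>(s) = 1\<close>, and at most \<open>h\<^sup>2 + r\<^sup>2\<close> for the remaining times \<open>s\<close>,
  which have measure of order \<open>N/L\<close> (\<open>coupling_cost_le_nodes\<close>). With \<open>h\<close> of order \<open>\<delta>\<^sup>1\<^sup>/\<^sup>6\<close> both terms are
  of order \<open>\<delta>\<^sup>1\<^sup>/\<^sup>3\<close>, which is the rate in (a). Smallness of this cost also gives weak-* convergence
  (\<open>weak_star_conv_of_coupling_cost\<close>).

  For (b), let the length of the cells tend to 0 so slowly that the times at distance at most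
  \<open>1/L + \<Delta>T\<close> from the ends of the cells have small measure. At all other times \<open>t\<close> the shifted time
  lies in the cell of \<open>t\<close> and \<open>\<lambda>\<close> is 1 there, so the measure at the shifted time is the average over the cell of \<open>t\<close>. For a fixed set
  \<open>Q\<close> the cell averages of \<open>t \<mapsto> \<rho>\<^sub>t(Q)\<close> converge in \<open>L\<^sup>1\<close>; hence, along one subsequence and for
  almost every \<open>t\<close>, they converge for all of countably many sets at once
  (\<open>averages_converge_along_subsequence\<close>). The cells of finer and finer partitions of \<open>D\<close> are enough,
  because \<open>\<W>\<^sub>2\<close> is controlled by the masses of the cells of a fine partition
  (\<open>wasserstein2_le_partition\<close>).
\<close>

section \<open>Couplings\<close>

lemma measurable_fst_borel [measurable]:
  "(fst :: 'a::{second_countable_topology} \<times> 'b::{second_countable_topology} \<Rightarrow> 'a) \<in> borel_measurable borel"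
  by (intro borel_measurable_continuous_onI continuous_intros)

lemma measurable_snd_borel [measurable]:
  "(snd :: 'a::{second_countable_topology} \<times> 'b::{second_countable_topology} \<Rightarrow> 'b) \<in> borel_measurable borel"
  by (intro borel_measurable_continuous_onI continuous_intros)

lemma AE_mem_of_null_Compl:
  assumes "sets N = sets borel" "S \<in> sets borel" "emeasure N (- S) = 0"
  shows "AE x in N. x \<in> S"
  using assms borel_comp[OF assms(2)] by (intro AE_I'[of "- S"]) (auto simp: null_sets_def)

abbreviation transport_cost :: "('a::metric_space \<times> 'a) measure \<Rightarrow> ennreal" where
  "transport_cost \<pi> \<equiv> \<integral>\<^sup>+ z. ennreal ((dist (fst z) (snd z))\<^sup>2) \<partial>\<pi>"

lemma wasserstein2_le_sqrt_cost:
  assumes "\<pi> \<in> couplings \<mu> \<nu>"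
    and "transport_cost \<pi> \<le> ennreal B" and "0 \<le> B"
  shows "wasserstein2 \<mu> \<nu> \<le> ennreal (sqrt B)"
proof -
  define C where "C = (INF \<pi> \<in> couplings \<mu> \<nu>. transport_cost \<pi>)"
  have C: "C \<le> ennreal B"
    unfolding C_def using assms(1,2) by (meson INF_lower2)
  then have fin: "C < \<infinity>"
    by (metis ennreal_less_top infinity_ennreal_def le_less_trans)
  moreover have "enn2real C \<le> B"
    using C assms(3) by (metis enn2real_ennreal enn2real_mono ennreal_less_top)
  ultimately show ?thesis
    unfolding wasserstein2_def C_def[symmetric] Let_def
    by (auto intro!: ennreal_leI)
qed

lemma coupling_of_density:
  fixes \<mu> \<nu> :: "'a::{metric_space, second_countable_topology} measure"
  assumes sets [measurable_cong]: "sets \<mu> = sets borel" "sets \<nu> = sets borel"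
    and fin: "finite_measure \<mu>" "finite_measure \<nu>"
    and f: "f \<in> borel_measurable (borel \<Otimes>\<^sub>M borel)"
    and fst: "AE x in \<mu>. (\<integral>\<^sup>+ y. f (x, y) \<partial>\<nu>) = 1"
    and snd: "AE y in \<nu>. (\<integral>\<^sup>+ x. f (x, y) \<partial>\<mu>) = 1"
  shows "density (\<mu> \<Otimes>\<^sub>M \<nu>) f \<in> couplings \<mu> \<nu>"
proof -
  interpret M: finite_measure \<mu> by fact
  interpret N: finite_measure \<nu> by fact
  interpret P: pair_sigma_finite \<mu> \<nu> ..
  have sP: "sets (\<mu> \<Otimes>\<^sub>M \<nu>) = sets (borel :: ('a \<times> 'a) measure)"
    unfolding borel_prod[symmetric] by (rule sets_pair_measure_cong) fact+
  note [measurable] = f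
  have f' [measurable]: "f \<in> borel_measurable (\<mu> \<Otimes>\<^sub>M \<nu>)" by measurable
  let ?\<pi> = "density (\<mu> \<Otimes>\<^sub>M \<nu>) f"
  have marginal: "distr ?\<pi> borel h = M"
    if h [measurable]: "h \<in> borel_measurable (borel \<Otimes>\<^sub>M borel)" and M: "sets M = sets borel"
      and int: "\<And>A. A \<in> sets borel \<Longrightarrow>
        (\<integral>\<^sup>+ z. f z * indicator A (h z) \<partial>(\<mu> \<Otimes>\<^sub>M \<nu>)) = (\<integral>\<^sup>+ x. indicator A x \<partial>M)"
    for h and M :: "'a measure"
  proof (rule measure_eqI)
    fix A assume "A \<in> sets (distr ?\<pi> borel h)"
    then have A [measurable]: "A \<in> sets borel" by simp
    have [measurable]: "h \<in> borel_measurable (\<mu> \<Otimes>\<^sub>M \<nu>)" by measurable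
    have "emeasure (distr ?\<pi> borel h) A = (\<integral>\<^sup>+ z. f z * indicator A (h z) \<partial>(\<mu> \<Otimes>\<^sub>M \<nu>))"
      by (subst emeasure_distr, simp, simp, subst emeasure_density)
        (auto intro!: nn_integral_cong simp: indicator_def space_pair_measure)
    then show "emeasure (distr ?\<pi> borel h) A = emeasure M A"
      using int[OF A] A M by simp
  qed (simp add: M)
  have "distr ?\<pi> borel fst = \<mu>"
  proof (rule marginal[OF _ sets(1)])
    fix A :: "'a set" assume A [measurable]: "A \<in> sets borel"
    have "(\<integral>\<^sup>+ z. f z * indicator A (fst z) \<partial>(\<mu> \<Otimes>\<^sub>M \<nu>)) = (\<integral>\<^sup>+ x. (\<integral>\<^sup>+ y. f (x, y) \<partial>\<nu>) * indicator A x \<partial>\<mu>)"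
      by (subst N.nn_integral_fst[symmetric]) (auto intro!: nn_integral_cong nn_integral_multc)
    also have "\<dots> = (\<integral>\<^sup>+ x. indicator A x \<partial>\<mu>)"
      using fst by (intro nn_integral_cong_AE) auto
    finally show "(\<integral>\<^sup>+ z. f z * indicator A (fst z) \<partial>(\<mu> \<Otimes>\<^sub>M \<nu>)) = (\<integral>\<^sup>+ x. indicator A x \<partial>\<mu>)" .
  qed measurable
  moreover have "distr ?\<pi> borel snd = \<nu>"
  proof (rule marginal[OF _ sets(2)])
    fix A :: "'a set" assume A [measurable]: "A \<in> sets borel"
    have "(\<integral>\<^sup>+ z. f z * indicator A (snd z) \<partial>(\<mu> \<Otimes>\<^sub>M \<nu>)) = (\<integral>\<^sup>+ y. (\<integral>\<^sup>+ x. f (x, y) \<partial>\<mu>) * indicator A y \<partial>\<nu>)"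
      by (subst P.nn_integral_snd[symmetric]) (auto intro!: nn_integral_cong nn_integral_multc)
    also have "\<dots> = (\<integral>\<^sup>+ y. indicator A y \<partial>\<nu>)"
      using snd by (intro nn_integral_cong_AE) auto
    finally show "(\<integral>\<^sup>+ z. f z * indicator A (snd z) \<partial>(\<mu> \<Otimes>\<^sub>M \<nu>)) = (\<integral>\<^sup>+ y. indicator A y \<partial>\<nu>)" .
  qed measurable
  ultimately show ?thesis
    by (simp add: couplings_def sP)
qed

text \<open>
  A continuous function on a compact set is uniformly continuous, and by Chebyshev's inequality a
  coupling of small cost moves only little mass by more than a given distance.
\<close>

lemma weak_star_conv_of_coupling_cost:
  fixes X :: "'a::{metric_space, second_countable_topology} set"
  assumes X: "compact X" and \<mu>: "\<And>n. \<mu> n \<in> radon_nonneg X" and \<nu>: "\<nu> \<in> radon_nonneg X"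
    and \<pi>: "\<And>n. \<pi> n \<in> couplings (\<mu> n) \<nu>"
    and cost: "\<And>n. transport_cost (\<pi> n) \<le> ennreal (B n)"
    and B: "\<And>n. 0 \<le> B n" "B \<longlonglongrightarrow> 0"
  shows "weak_star_conv X \<mu> \<nu>"
  unfolding weak_star_conv_def
proof (intro allI impI)
  fix \<psi> :: "'a \<Rightarrow> real" assume \<psi>: "continuous_on X \<psi>"
  have Xb [measurable]: "X \<in> sets borel"
    using X by (simp add: compact_imp_closed)
  define g where "g = (\<lambda>x. indicator X x *\<^sub>R \<psi> x)"
  have g [measurable]: "g \<in> borel_measurable borel"
    unfolding g_def by (rule borel_measurable_continuous_on_indicator[OF Xb \<psi>])
  obtain M0 where M0: "\<And>x. x \<in> X \<Longrightarrow> \<bar>\<psi> x\<bar> \<le> M0"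
    using compact_imp_bounded[OF compact_continuous_image[OF \<psi> X]]
    by (auto simp: bounded_iff)
  define M where "M = max M0 0"
  have M: "\<bar>g x\<bar> \<le> M" for x
    using M0[of x] by (cases "x \<in> X") (auto simp: g_def M_def)
  have M_nonneg: "0 \<le> M" by (simp add: M_def)
  have uc: "uniformly_continuous_on X \<psi>"
    using X \<psi> by (simp add: compact_uniformly_continuous)
  define m where "m = measure \<nu> UNIV"
  have sets\<pi> [measurable_cong]: "sets (\<pi> n) = sets borel" for n
    using \<pi> by (simp add: couplings_def)
  have space\<pi> [simp]: "space (\<pi> n) = UNIV" for n
    using sets_eq_imp_space_eq[OF sets\<pi>] by simp
  have d1: "distr (\<pi> n) borel fst = \<mu> n" and d2: "distr (\<pi> n) borel snd = \<nu>" for n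
    using \<pi> by (auto simp: couplings_def)
  have mass: "emeasure (\<pi> n) UNIV = emeasure \<nu> UNIV" for n
    unfolding d2[of n, symmetric] by (subst emeasure_distr) auto
  have fin\<pi>: "finite_measure (\<pi> n)" for n
    using mass[of n] \<nu> by (intro finite_measureI) (auto simp: radon_nonneg_def finite_measure.emeasure_finite)
  have m: "measure (\<pi> n) UNIV = m" for n
    using mass[of n] by (simp add: m_def measure_def)
  have AE1: "AE z in \<pi> n. fst z \<in> X" for n
  proof -
    have "AE x in distr (\<pi> n) borel fst. x \<in> X"
      unfolding d1 using \<mu>[of n] Xb
      by (intro AE_mem_of_null_Compl) (auto simp: radon_nonneg_def)
    then show ?thesis by (subst (asm) AE_distr_iff) auto
  qed
  have AE2: "AE z in \<pi> n. snd z \<in> X" for n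
  proof -
    have "AE x in distr (\<pi> n) borel snd. x \<in> X"
      unfolding d2 using \<nu> Xb
      by (intro AE_mem_of_null_Compl) (auto simp: radon_nonneg_def)
    then show ?thesis by (subst (asm) AE_distr_iff) auto
  qed
  have dist_int: "integrable (\<pi> n) (\<lambda>z. (dist (fst z) (snd z))\<^sup>2)" for n
    using cost[of n] by (intro integrableI_nonneg) (auto simp: le_less_trans)
  have dist_le: "(LINT z|\<pi> n. (dist (fst z) (snd z))\<^sup>2) \<le> B n" for n
  proof -
    have "ennreal (LINT z|\<pi> n. (dist (fst z) (snd z))\<^sup>2) \<le> ennreal (B n)"
      using cost[of n] dist_int[of n] by (subst nn_integral_eq_integral[symmetric]) auto
    then show ?thesis using B(1)[of n] by (simp add: ennreal_le_iff)
  qed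
  have i1: "integrable (\<pi> n) (\<lambda>z. g (fst z))" and i2: "integrable (\<pi> n) (\<lambda>z. g (snd z))" for n
    using M by (auto intro!: finite_measure.integrable_const_bound[OF fin\<pi>, of _ M])
  show "(\<lambda>n. LINT x:X|\<mu> n. \<psi> x) \<longlonglongrightarrow> (LINT x:X|\<nu>. \<psi> x)"
  proof (rule LIMSEQ_I)
    fix e :: real assume e: "0 < e"
    define e' where "e' = e / (2 * (m + 1))"
    have m0: "0 \<le> m" by (simp add: m_def)
    have e': "0 < e'" using e m0 by (simp add: e'_def)
    obtain d where d: "0 < d" "\<And>x y. x \<in> X \<Longrightarrow> y \<in> X \<Longrightarrow> dist x y < d \<Longrightarrow> \<bar>\<psi> x - \<psi> y\<bar> < e'"
      using uc e' unfolding uniformly_continuous_on_def dist_real_def by metis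
    \<comment> \<open>Close pairs are controlled by uniform continuity, distant ones by a multiple of the cost.\<close>
    have pt: "\<bar>g x - g y\<bar> \<le> e' + (2 * M / d\<^sup>2) * (dist x y)\<^sup>2" if "x \<in> X" "y \<in> X" for x y
    proof (cases "dist x y < d")
      case True
      have "\<bar>g x - g y\<bar> < e'" using d(2)[OF that True] that by (simp add: g_def)
      moreover have "0 \<le> (2 * M / d\<^sup>2) * (dist x y)\<^sup>2" using M_nonneg by simp
      ultimately show ?thesis by linarith
    next
      case False
      then have "1 \<le> (dist x y)\<^sup>2 / d\<^sup>2" using d(1)
        by (simp add: power_mono)
      then have "2 * M * 1 \<le> 2 * M * ((dist x y)\<^sup>2 / d\<^sup>2)" using M_nonneg by (intro mult_left_mono) auto
      moreover have "\<bar>g x - g y\<bar> \<le> 2 * M" using M[of x] M[of y] by linarith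
      ultimately show ?thesis using e' by simp
    qed
    have bound: "\<bar>(LINT x:X|\<mu> n. \<psi> x) - (LINT x:X|\<nu>. \<psi> x)\<bar> \<le> e' * m + (2 * M / d\<^sup>2) * B n" for n
    proof -
      have "(LINT x:X|\<mu> n. \<psi> x) = (LINT z|\<pi> n. g (fst z))"
        unfolding set_lebesgue_integral_def g_def[symmetric] d1[of n, symmetric]
        using g by (subst integral_distr) (auto simp: g_def)
      moreover have "(LINT x:X|\<nu>. \<psi> x) = (LINT z|\<pi> n. g (snd z))"
        unfolding set_lebesgue_integral_def g_def[symmetric] d2[of n, symmetric]
        using g by (subst integral_distr) (auto simp: g_def)
      ultimately have "(LINT x:X|\<mu> n. \<psi> x) - (LINT x:X|\<nu>. \<psi> x) = (LINT z|\<pi> n. g (fst z) - g (snd z))"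
        using i1 i2 by simp
      also have "\<bar>\<dots>\<bar> \<le> (LINT z|\<pi> n. \<bar>g (fst z) - g (snd z)\<bar>)" by (rule integral_abs_bound)
      also have "\<dots> \<le> (LINT z|\<pi> n. e' + (2 * M / d\<^sup>2) * (dist (fst z) (snd z))\<^sup>2)"
      proof (rule integral_mono_AE)
        show "AE z in \<pi> n. \<bar>g (fst z) - g (snd z)\<bar> \<le> e' + (2 * M / d\<^sup>2) * (dist (fst z) (snd z))\<^sup>2"
          using AE1[of n] AE2[of n] by eventually_elim (rule pt)
      qed (use i1[of n] i2[of n] dist_int[of n] finite_measure.integrable_const[OF fin\<pi>[of n]] in
          \<open>auto intro!: integrable_abs Bochner_Integration.integrable_diff
            Bochner_Integration.integrable_add integrable_mult_right\<close>)
      also have "\<dots> = e' * m + (2 * M / d\<^sup>2) * (LINT z|\<pi> n. (dist (fst z) (snd z))\<^sup>2)"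
        using dist_int[of n] finite_measure.integrable_const[OF fin\<pi>[of n]] m[of n]
        by (subst Bochner_Integration.integral_add) auto
      also have "\<dots> \<le> e' * m + (2 * M / d\<^sup>2) * B n"
        using dist_le[of n] M_nonneg by (intro add_left_mono mult_left_mono) auto
      finally show ?thesis .
    qed
    have "(\<lambda>n. e' * m + (2 * M / d\<^sup>2) * B n) \<longlonglongrightarrow> e' * m + (2 * M / d\<^sup>2) * 0"
      by (intro tendsto_intros B)
    moreover have "e' * m + (2 * M / d\<^sup>2) * 0 < e"
    proof -
      have "e' * m < e' * (2 * (m + 1))" using e' m0 by (intro mult_strict_left_mono) auto
      also have "\<dots> = e" using m0 by (simp add: e'_def)
      finally show ?thesis by simp
    qed
    ultimately have "\<forall>\<^sub>F n in sequentially. e' * m + (2 * M / d\<^sup>2) * B n < e"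
      by (rule order_tendstoD)
    then show "\<exists>no. \<forall>n\<ge>no. norm ((LINT x:X|\<mu> n. \<psi> x) - (LINT x:X|\<nu>. \<psi> x)) < e"
      unfolding eventually_sequentially using bound by (metis order_le_less_trans real_norm_def)
  qed
qed

text \<open>
  The mass that the two measures share in a cell can stay in that cell, at distance at most \<open>\<epsilon>\<close>. Only the
  excess has to be moved across the diameter \<open>r\<close>, and its total is at most \<open>M \<kappa>\<close>. Thus convergence of
  the masses of the cells of a fine partition suffices to make \<open>\<W>\<^sub>2\<close> small.
\<close>

lemma wasserstein2_le_partition:
  fixes \<mu> \<nu> :: "'a::{metric_space, second_countable_topology} measure" and Q :: "nat \<Rightarrow> 'a set"
  assumes sets [measurable_cong]: "sets \<mu> = sets borel" "sets \<nu> = sets borel"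
    and fin: "finite_measure \<mu>" "finite_measure \<nu>"
    and m: "measure \<mu> UNIV = m" "measure \<nu> UNIV = m"
    and Q: "\<And>i. i < M \<Longrightarrow> Q i \<in> sets borel" "disjoint_family_on Q {..<M}"
    and null: "emeasure \<mu> (- (\<Union>i<M. Q i)) = 0" "emeasure \<nu> (- (\<Union>i<M. Q i)) = 0"
    and small: "\<And>i x y. i < M \<Longrightarrow> x \<in> Q i \<Longrightarrow> y \<in> Q i \<Longrightarrow> dist x y \<le> \<epsilon>"
    and diam: "\<And>x y. x \<in> (\<Union>i<M. Q i) \<Longrightarrow> y \<in> (\<Union>i<M. Q i) \<Longrightarrow> dist x y \<le> r"
    and close: "\<And>i. i < M \<Longrightarrow> \<bar>measure \<mu> (Q i) - measure \<nu> (Q i)\<bar> \<le> \<kappa>"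
  shows "wasserstein2 \<mu> \<nu> \<le> ennreal (sqrt (\<epsilon>\<^sup>2 * m + r\<^sup>2 * (real M * \<kappa>)))"
proof -
  interpret M: finite_measure \<mu> by fact
  interpret N: finite_measure \<nu> by fact
  interpret P: pair_sigma_finite \<mu> \<nu> ..
  have Qs [measurable]: "i < M \<Longrightarrow> Q i \<in> sets borel" for i by fact
  have [simp]: "space \<mu> = UNIV" "space \<nu> = UNIV"
    using sets_eq_imp_space_eq[OF sets(1)] sets_eq_imp_space_eq[OF sets(2)] by auto
  define u v where "u i = measure \<mu> (Q i)" and "v i = measure \<nu> (Q i)" for i
  define p where "p i = min (u i) (v i)" for i
  define rem where "rem = m - (\<Sum>i<M. p i)"
  have uv: "0 \<le> u i" "0 \<le> v i" "0 \<le> p i" "p i \<le> u i" "p i \<le> v i" for i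
    by (auto simp: u_def v_def p_def)
  have UQ [measurable]: "(\<Union>i<M. Q i) \<in> sets borel" using Q(1) by auto
  have mass: "measure N UNIV = (\<Sum>i<M. measure N (Q i))"
    if "finite_measure N" "sets N = sets borel" "emeasure N (- (\<Union>i<M. Q i)) = 0" for N :: "'a measure"
  proof -
    interpret N': finite_measure N by fact
    have "measure N UNIV = measure N (\<Union>i<M. Q i)"
    proof (rule measure_eq_AE)
      show "AE x in N. (x \<in> UNIV) = (x \<in> (\<Union>i<M. Q i))"
        using AE_mem_of_null_Compl[OF that(2) UQ that(3)] by eventually_elim blast
      show "UNIV \<in> sets N" "(\<Union>i<M. Q i) \<in> sets N"
        unfolding that(2) by (rule space_in_borel UQ)+
    qed
    also have "\<dots> = (\<Sum>i<M. measure N (Q i))"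
    proof (rule N'.finite_measure_finite_Union)
      show "Q ` {..<M} \<subseteq> sets N"
        unfolding that(2) using Q(1) by blast
    qed (use Q(2) in simp_all)
    finally show ?thesis .
  qed
  have sum_u: "(\<Sum>i<M. u i) = m" and sum_v: "(\<Sum>i<M. v i) = m"
    using mass[of \<mu>] mass[of \<nu>] fin sets null m by (auto simp: u_def v_def)
  have rem_u: "(\<Sum>i<M. u i - p i) = rem" and rem_v: "(\<Sum>i<M. v i - p i) = rem"
    by (simp_all add: rem_def sum_subtractf sum_u sum_v)
  have rem0: "0 \<le> rem" unfolding rem_u[symmetric] using uv by (intro sum_nonneg) auto
  have rem_le: "rem \<le> real M * \<kappa>"
  proof -
    have "u i - p i \<le> \<kappa>" if "i < M" for i
      using close[OF that] abs_ge_zero[of "measure \<mu> (Q i) - measure \<nu> (Q i)"] by (auto simp: p_def u_def v_def min_def abs_if split: if_splits)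
    then show ?thesis unfolding rem_u[symmetric] using sum_bounded_above[of "{..<M}" "\<lambda>i. u i - p i" \<kappa>] by simp
  qed
  \<comment> \<open>The density, with respect to the product, of the coupling: on each diagonal cell the common
    mass \<open>p i\<close>, and the two remainders, both of mass \<open>rem\<close>, coupled independently.\<close>
  define F where "F u v x y = (\<Sum>i<M. indicator (Q i) x * indicator (Q i) y * (p i / (u i * v i)))
     + (\<Sum>i<M. indicator (Q i) x * (1 - p i / u i)) * (\<Sum>i<M. indicator (Q i) y * (1 - p i / v i)) / rem"
    for u v :: "nat \<Rightarrow> real" and x y :: 'a
  have F_swap: "F u v x y = F v u y x" for u v x y
    unfolding F_def by (simp add: mult_ac)
  have hbi_sum: "has_bochner_integral N (\<lambda>y. \<Sum>j<M. indicator (Q j) y * c j) (\<Sum>j<M. measure N (Q j) * c j)"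
    if "finite_measure N" "sets N = sets borel" for N :: "'a measure" and c :: "nat \<Rightarrow> real"
  proof (rule has_bochner_integral_sum)
    fix j assume j: "j \<in> {..<M}"
    interpret N': finite_measure N by fact
    show "has_bochner_integral N (\<lambda>y. indicator (Q j) y * c j) (measure N (Q j) * c j)"
      using j Q(1) that(2)
      by (intro has_bochner_integral_mult_left has_bochner_integral_real_indicator)
        (auto simp: N'.emeasure_eq_measure)
  qed
  have nn_hbi: "(\<integral>\<^sup>+ y. ennreal (f y) \<partial>N) = ennreal c"
    if "has_bochner_integral N f c" "\<And>y. 0 \<le> f y" for N :: "'a measure" and f c
    using that by (simp add: has_bochner_integral_iff nn_integral_eq_integral)
  have ratio: "0 \<le> p i / u i" "p i / u i \<le> 1" "0 \<le> p i / v i" "p i / v i \<le> 1" for i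
    using uv[of i] by (auto simp: divide_le_eq_1 le_less)
  have F_nonneg: "0 \<le> F u v x y" for x y
    unfolding F_def using uv ratio rem0 
    by (intro add_nonneg_nonneg sum_nonneg divide_nonneg_nonneg mult_nonneg_nonneg) auto
  have marginal: "AE x in \<mu>'. (\<integral>\<^sup>+ y. ennreal (F u' v' x y) \<partial>\<nu>') = 1"
    if \<mu>'[measurable_cong]: "finite_measure \<mu>'" "sets \<mu>' = sets borel" "emeasure \<mu>' (- (\<Union>i<M. Q i)) = 0"
      and \<nu>'[measurable_cong]: "finite_measure \<nu>'" "sets \<nu>' = sets borel"
      and u': "\<And>i. u' i = measure \<mu>' (Q i)" and v': "\<And>i. v' i = measure \<nu>' (Q i)"
      and p: "\<And>i. 0 \<le> p i" "\<And>i. p i \<le> u' i" "\<And>i. p i \<le> v' i"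
      and ru: "(\<Sum>i<M. u' i - p i) = rem" and rv: "(\<Sum>i<M. v' i - p i) = rem"
      and pos: "\<And>x y. 0 \<le> F u' v' x y"
    for \<mu>' \<nu>' :: "'a measure" and u' v'
  proof -
    interpret M': finite_measure \<mu>' by fact
    interpret N': finite_measure \<nu>' by fact
    have [simp]: "space \<mu>' = UNIV" "space \<nu>' = UNIV"
      using sets_eq_imp_space_eq[OF \<mu>'(2)] sets_eq_imp_space_eq[OF \<nu>'(2)] by auto
    have Qm: "i < M \<Longrightarrow> Q i \<in> sets \<nu>'" "i < M \<Longrightarrow> Q i \<in> sets \<mu>'" for i using Q(1) \<nu>' \<mu>' by auto
    have "AE x in \<mu>'. x \<in> (\<Union>i<M. Q i)"
      by (rule AE_mem_of_null_Compl[OF \<mu>'(2) UQ \<mu>'(3)])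
    moreover have "AE x in \<mu>'. \<forall>i\<in>{..<M}. u' i = 0 \<longrightarrow> x \<notin> Q i"
    proof (rule AE_finite_allI)
      fix i assume "i \<in> {..<M}"
      then show "AE x in \<mu>'. u' i = 0 \<longrightarrow> x \<notin> Q i"
        using Qm u' by (cases "u' i = 0") (auto intro!: AE_I'[of "Q i"] simp: null_sets_def M'.emeasure_eq_measure)
    qed simp
    ultimately show ?thesis
    proof eventually_elim
      case (elim x)
      then obtain i where i: "i < M" "x \<in> Q i" "u' i \<noteq> 0" by auto
      have ind: "indicator (Q j) x = (if j = i then 1 else 0 :: real)" if "j < M" for j
        using Q(2) i that by (auto simp: disjoint_family_on_def indicator_def)
      have F_eq: "F u' v' x y = indicator (Q i) y * (p i / (u' i * v' i))
          + (1 - p i / u' i) * (\<Sum>j<M. indicator (Q j) y * (1 - p j / v' j)) / rem" for y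
      proof -
        have pick: "(\<Sum>j<M. indicator (Q j) x * c j) = c i" for c :: "nat \<Rightarrow> real"
        proof -
          have "(\<Sum>j<M. indicator (Q j) x * c j) = (\<Sum>j<M. if j = i then c j else 0)"
            by (rule sum.cong) (auto simp: ind)
          then show ?thesis using i(1) by simp
        qed
        show ?thesis
          unfolding F_def mult.assoc pick by simp
      qed
      have "has_bochner_integral \<nu>' (\<lambda>y. F u' v' x y) (v' i * (p i / (u' i * v' i))
          + (1 - p i / u' i) * (\<Sum>j<M. v' j * (1 - p j / v' j)) / rem)"
        unfolding F_eq v'
      proof (intro has_bochner_integral_add has_bochner_integral_divide_zero
          has_bochner_integral_mult_right has_bochner_integral_mult_left)
        show "has_bochner_integral \<nu>' (indicator (Q i)) (measure \<nu>' (Q i))"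
          using Qm(1)[OF i(1)] by (intro has_bochner_integral_real_indicator) (auto simp: N'.emeasure_eq_measure)
      qed (rule hbi_sum[OF \<nu>'])
      then have "(\<integral>\<^sup>+ y. ennreal (F u' v' x y) \<partial>\<nu>') = ennreal (v' i * (p i / (u' i * v' i))
          + (1 - p i / u' i) * (\<Sum>j<M. v' j * (1 - p j / v' j)) / rem)"
        by (rule nn_hbi) (rule pos)
      also have "(\<Sum>j<M. v' j * (1 - p j / v' j)) = (\<Sum>j<M. v' j - p j)"
      proof (rule sum.cong)
        fix j show "v' j * (1 - p j / v' j) = v' j - p j"
          using p(1)[of j] p(3)[of j] by (cases "v' j = 0") (auto simp: field_simps)
      qed simp
      also have "\<dots> = rem" by fact
      also have "v' i * (p i / (u' i * v' i)) = p i / u' i"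
        using p(1)[of i] p(3)[of i] by (cases "v' i = 0") (auto simp: field_simps)
      also have "p i / u' i + (1 - p i / u' i) * rem / rem = 1"
      proof (cases "rem = 0")
        case True
        then have "\<forall>i\<in>{..<M}. u' i - p i = 0"
          using ru p(2) by (intro iffD1[OF sum_nonneg_eq_0_iff]) auto
        then have "u' i - p i = 0" using i(1) by blast
        then show ?thesis using i True by simp
      qed simp
      finally show ?case by simp
    qed
  qed
  have Fr [measurable]: "(\<lambda>z. F u v (fst z) (snd z)) \<in> borel_measurable (borel \<Otimes>\<^sub>M borel)"
    unfolding F_def by measurable
  then have Fm: "(\<lambda>z. ennreal (F u v (fst z) (snd z))) \<in> borel_measurable (borel \<Otimes>\<^sub>M borel)"
    by measurable
  define \<pi> where "\<pi> = density (\<mu> \<Otimes>\<^sub>M \<nu>) (\<lambda>z. ennreal (F u v (fst z) (snd z)))"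
  have F_int: "AE x in \<mu>. (\<integral>\<^sup>+ y. ennreal (F u v x y) \<partial>\<nu>) = 1"
    using marginal[of \<mu> \<nu> u v] fin sets null uv rem_u rem_v F_nonneg by (simp add: u_def v_def)
  have "\<pi> \<in> couplings \<mu> \<nu>"
    unfolding \<pi>_def
  proof (rule coupling_of_density[OF sets fin Fm])
    show "AE x in \<mu>. (\<integral>\<^sup>+ y. ennreal (F u v (fst (x, y)) (snd (x, y))) \<partial>\<nu>) = 1"
      using F_int by simp
    show "AE y in \<nu>. (\<integral>\<^sup>+ x. ennreal (F u v (fst (x, y)) (snd (x, y))) \<partial>\<mu>) = 1"
      using marginal[of \<nu> \<mu> v u] fin sets null uv rem_u rem_v F_nonneg F_swap[of v u] by (simp add: u_def v_def)
  qed
  moreover have "transport_cost \<pi> \<le> ennreal (\<epsilon>\<^sup>2 * m + r\<^sup>2 * (real M * \<kappa>))"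
  proof -
    define b where "b x = (\<Sum>i<M. indicator (Q i) x * (1 - p i / u i))" for x
    define c where "c y = (\<Sum>i<M. indicator (Q i) y * (1 - p i / v i))" for y
    have b0: "0 \<le> b x" and c0: "0 \<le> c x" for x
      unfolding b_def c_def using ratio by (intro sum_nonneg mult_nonneg_nonneg; simp)+
    have FG: "F u v x y * (dist x y)\<^sup>2 \<le> \<epsilon>\<^sup>2 * F u v x y + (r\<^sup>2 / rem * b x) * c y"
      if "x \<in> (\<Union>i<M. Q i)" "y \<in> (\<Union>i<M. Q i)" for x y
    proof -
      have dr: "(dist x y)\<^sup>2 \<le> r\<^sup>2" using diam[OF that] by (intro power_mono) auto
      have t: "indicator (Q i) x * indicator (Q i) y * (p i / (u i * v i)) * (dist x y)\<^sup>2
          \<le> \<epsilon>\<^sup>2 * (indicator (Q i) x * indicator (Q i) y * (p i / (u i * v i)))" if "i < M" for i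
      proof (cases "x \<in> Q i \<and> y \<in> Q i")
        case True
        then have "(dist x y)\<^sup>2 \<le> \<epsilon>\<^sup>2" using small[OF that] by (intro power_mono) auto
        then have "(dist x y)\<^sup>2 * (p i / (u i * v i)) \<le> \<epsilon>\<^sup>2 * (p i / (u i * v i))"
          using uv[of i] by (intro mult_right_mono divide_nonneg_nonneg mult_nonneg_nonneg)
        then show ?thesis using True by (simp add: mult_ac)
      qed auto
      define a where "a = (\<Sum>i<M. indicator (Q i) x * indicator (Q i) y * (p i / (u i * v i)))"
      have "a * (dist x y)\<^sup>2 \<le> \<epsilon>\<^sup>2 * a"
        unfolding a_def sum_distrib_left sum_distrib_right by (rule sum_mono) (simp only: t lessThan_iff)
      moreover have bc: "0 \<le> b x * c y / rem" using b0 c0 rem0 by simp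
      then have "b x * c y / rem * (dist x y)\<^sup>2 \<le> \<epsilon>\<^sup>2 * (b x * c y / rem) + b x * c y / rem * r\<^sup>2"
        using mult_left_mono[OF dr bc] mult_nonneg_nonneg[OF zero_le_power2 bc, of \<epsilon>] by linarith
      moreover have "F u v x y = a + b x * c y / rem"
        by (simp only: F_def a_def b_def c_def)
      ultimately show ?thesis by (simp add: distrib_left distrib_right mult_ac)
    qed
    have AE\<mu>: "AE x in \<mu>. x \<in> (\<Union>i<M. Q i)" and AE\<nu>: "AE x in \<nu>. x \<in> (\<Union>i<M. Q i)"
      using null sets UQ by (simp_all only: AE_mem_of_null_Compl)
    have [measurable]: "c \<in> borel_measurable borel" "b \<in> borel_measurable borel"
      unfolding c_def[abs_def] b_def[abs_def] by measurable
    have Fs [measurable]: "F u v x \<in> borel_measurable borel" for x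
      using measurable_compose_Pair1[OF _ Fr, of x] by simp
    have "transport_cost \<pi>
        = (\<integral>\<^sup>+ z. ennreal (F u v (fst z) (snd z) * (dist (fst z) (snd z))\<^sup>2) \<partial>(\<mu> \<Otimes>\<^sub>M \<nu>))"
      unfolding \<pi>_def using F_nonneg by (subst nn_integral_density) (simp_all add: ennreal_mult, measurable)
    also have "\<dots> = (\<integral>\<^sup>+ x. \<integral>\<^sup>+ y. ennreal (F u v x y * (dist x y)\<^sup>2) \<partial>\<nu> \<partial>\<mu>)"
      by (subst N.nn_integral_fst[symmetric]) (simp_all, measurable)
    also have "\<dots> \<le> (\<integral>\<^sup>+ x. ennreal (\<epsilon>\<^sup>2) + ennreal (r\<^sup>2 * b x) \<partial>\<mu>)"
    proof (rule nn_integral_mono_AE)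
      have c_int: "(\<integral>\<^sup>+ y. ennreal (c y) \<partial>\<nu>) = ennreal rem"
      proof -
        have "(\<Sum>i<M. measure \<nu> (Q i) * (1 - p i / v i)) = rem"
          unfolding rem_v[symmetric] v_def[symmetric]
        proof (rule sum.cong)
          fix i show "v i * (1 - p i / v i) = v i - p i"
            using uv[of i] by (cases "v i = 0") (auto simp: field_simps)
        qed simp
        then show ?thesis
          using nn_hbi[OF hbi_sum[OF fin(2) sets(2)], of "\<lambda>i. 1 - p i / v i"] c0 by (simp add: c_def)
      qed
      show "AE x in \<mu>. (\<integral>\<^sup>+ y. ennreal (F u v x y * (dist x y)\<^sup>2) \<partial>\<nu>) \<le> ennreal (\<epsilon>\<^sup>2) + ennreal (r\<^sup>2 * b x)"
        using AE\<mu> F_int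
      proof eventually_elim
        case (elim x)
        have k0: "0 \<le> r\<^sup>2 / rem * b x" using rem0 b0 by simp
        have "(\<integral>\<^sup>+ y. ennreal (F u v x y * (dist x y)\<^sup>2) \<partial>\<nu>)
            \<le> (\<integral>\<^sup>+ y. ennreal (\<epsilon>\<^sup>2) * ennreal (F u v x y) + ennreal (r\<^sup>2 / rem * b x) * ennreal (c y) \<partial>\<nu>)"
        proof (rule nn_integral_mono_AE)
          show "AE y in \<nu>. ennreal (F u v x y * (dist x y)\<^sup>2)
            \<le> ennreal (\<epsilon>\<^sup>2) * ennreal (F u v x y) + ennreal (r\<^sup>2 / rem * b x) * ennreal (c y)"
            using AE\<nu>
          proof eventually_elim
            case (elim y)
            have "ennreal (F u v x y * (dist x y)\<^sup>2) \<le> ennreal (\<epsilon>\<^sup>2 * F u v x y + (r\<^sup>2 / rem * b x) * c y)"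
              by (intro ennreal_leI FG elim \<open>x \<in> (\<Union>i<M. Q i)\<close>)
            also have "\<dots> = ennreal (\<epsilon>\<^sup>2) * ennreal (F u v x y) + ennreal (r\<^sup>2 / rem * b x) * ennreal (c y)"
              using F_nonneg[of x y] k0 c0[of y]
              by (simp only: ennreal_plus ennreal_mult mult_nonneg_nonneg zero_le_power2)
            finally show ?case .
          qed
        qed
        also have "\<dots> = ennreal (\<epsilon>\<^sup>2) * 1 + ennreal (r\<^sup>2 / rem * b x) * ennreal rem"
          using elim(2) c_int by (simp add: nn_integral_add nn_integral_cmult)
        also have "ennreal (r\<^sup>2 / rem * b x) * ennreal rem \<le> ennreal (r\<^sup>2 * b x)"
          using k0 rem0 b0[of x] by (cases "rem = 0") (simp_all add: ennreal_mult[symmetric])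
        finally show ?case by simp
      qed
    qed
    also have "\<dots> = ennreal (\<epsilon>\<^sup>2) * ennreal m + ennreal (r\<^sup>2) * ennreal rem"
    proof -
      have "(\<Sum>i<M. measure \<mu> (Q i) * (1 - p i / u i)) = rem"
        unfolding rem_u[symmetric] u_def[symmetric]
      proof (rule sum.cong)
        fix i show "u i * (1 - p i / u i) = u i - p i"
          using uv[of i] by (cases "u i = 0") (auto simp: field_simps)
      qed simp
      then have "(\<integral>\<^sup>+ x. ennreal (b x) \<partial>\<mu>) = ennreal rem"
        using nn_hbi[OF hbi_sum[OF fin(1) sets(1)], of "\<lambda>i. 1 - p i / u i"] b0 by (simp add: b_def)
      then show ?thesis
        using m(1) b0 by (simp add: ennreal_mult nn_integral_add nn_integral_cmult M.emeasure_eq_measure)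
    qed
    also have "\<dots> = ennreal (\<epsilon>\<^sup>2 * m + r\<^sup>2 * rem)"
    proof -
      have "0 \<le> m" using m(1) measure_nonneg by blast
      then show ?thesis using rem0 by (simp add: ennreal_mult ennreal_plus)
    qed
    also have "\<dots> \<le> ennreal (\<epsilon>\<^sup>2 * m + r\<^sup>2 * (real M * \<kappa>))"
      using rem_le by (intro ennreal_leI add_left_mono mult_left_mono) auto
    finally show ?thesis .
  qed
  moreover have "0 \<le> \<epsilon>\<^sup>2 * m + r\<^sup>2 * (real M * \<kappa>)"
  proof -
    have "0 \<le> m" "0 \<le> real M * \<kappa>" using m rem0 rem_le by auto
    then show ?thesis by (intro add_nonneg_nonneg mult_nonneg_nonneg[of "_\<^sup>2"]) auto
  qed
  ultimately show ?thesis by (rule wasserstein2_le_sqrt_cost)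
qed

section \<open>Vector measures with a density\<close>

text \<open>
  The supremum over the Borel subsets of \<open>A\<close> is attained at the part of \<open>A\<close> where \<open>f\<close> is positive.
\<close>

lemma jordan_pos_eq_density:
  fixes \<nu> :: "'a::topological_space set \<Rightarrow> real"
  assumes sets [measurable_cong]: "sets M = sets borel" and f: "integrable M f"
    and \<nu>: "\<And>A. A \<in> sets borel \<Longrightarrow> \<nu> A = (LINT x:A|M. f x)"
  shows "jordan_pos \<nu> = density M (\<lambda>x. ennreal (f x))"
proof -
  have [measurable]: "f \<in> borel_measurable M" using f by auto
  have [simp]: "space M = UNIV" using sets_eq_imp_space_eq[OF sets] by simp
  have "(SUP B \<in> {B \<in> sets borel. B \<subseteq> A}. ennreal (\<nu> B)) = emeasure (density M (\<lambda>x. ennreal (f x))) A"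
    if A: "A \<in> sets borel" for A
  proof (rule antisym)
    have eq: "emeasure (density M (\<lambda>x. ennreal (f x))) A = (\<integral>\<^sup>+ x. ennreal (f x) * indicator A x \<partial>M)"
      using A sets by (subst emeasure_density) auto
    show "(SUP B \<in> {B \<in> sets borel. B \<subseteq> A}. ennreal (\<nu> B)) \<le> emeasure (density M (\<lambda>x. ennreal (f x))) A"
    proof (rule SUP_least)
      fix B assume B: "B \<in> {B \<in> sets borel. B \<subseteq> A}"
      then have [measurable]: "B \<in> sets M" using sets by simp
      have int: "integrable M (\<lambda>x. indicator B x * max 0 (f x))"
        using integrable_mult_indicator[OF \<open>B \<in> sets M\<close> integrable_max[OF integrable_zero f]] by simp
      have "\<nu> B \<le> (LINT x|M. indicator B x * max 0 (f x))"
        unfolding \<nu>[of B, simplified] using B \<nu>[of B] int integrable_mult_indicator[OF \<open>B \<in> sets M\<close> f]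
        by (auto simp: set_lebesgue_integral_def intro!: integral_mono mult_left_mono)
      then have "ennreal (\<nu> B) \<le> ennreal (LINT x|M. indicator B x * max 0 (f x))"
        by (rule ennreal_leI)
      also have "\<dots> = (\<integral>\<^sup>+ x. ennreal (indicator B x * max 0 (f x)) \<partial>M)"
        using int by (intro nn_integral_eq_integral[symmetric]) auto
      also have "\<dots> \<le> (\<integral>\<^sup>+ x. ennreal (f x) * indicator A x \<partial>M)"
        using B by (intro nn_integral_mono) (auto simp: indicator_def max_def ennreal_neg)
      finally show "ennreal (\<nu> B) \<le> emeasure (density M (\<lambda>x. ennreal (f x))) A" using eq by simp
    qed
    define B where "B = A \<inter> {x. 0 < f x}"
    have "{x \<in> space M. 0 < f x} \<in> sets M" by measurable
    then have B: "B \<in> sets borel" "B \<subseteq> A" using A sets by (auto simp: B_def)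
    then have "B \<in> sets M" using sets by simp
    have "(\<integral>\<^sup>+ x. ennreal (f x) * indicator A x \<partial>M) = (\<integral>\<^sup>+ x. ennreal (indicator B x * f x) \<partial>M)"
      by (intro nn_integral_cong) (auto simp: B_def indicator_def ennreal_neg)
    also have "\<dots> = ennreal (\<nu> B)"
      unfolding \<nu>[OF B(1)] set_lebesgue_integral_def
      using integrable_mult_indicator[OF \<open>B \<in> sets M\<close> f]
      by (subst nn_integral_eq_integral) (auto simp: B_def indicator_def)
    also have "\<dots> \<le> (SUP B \<in> {B \<in> sets borel. B \<subseteq> A}. ennreal (\<nu> B))"
      using B by (intro SUP_upper) auto
    finally show "emeasure (density M (\<lambda>x. ennreal (f x))) A \<le> (SUP B \<in> {B \<in> sets borel. B \<subseteq> A}. ennreal (\<nu> B))"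
      using eq by simp
  qed
  then have "jordan_pos \<nu> = measure_of UNIV (sets borel) (emeasure (density M (\<lambda>x. ennreal (f x))))"
    unfolding jordan_pos_def using sets.sigma_sets_eq[of borel] by (intro measure_of_eq) auto
  also have "\<dots> = density M (\<lambda>x. ennreal (f x))"
    using measure_of_of_measure[of "density M (\<lambda>x. ennreal (f x))"] sets by simp
  finally show ?thesis .
qed

lemma signed_integral_eq_LINT:
  fixes \<nu> :: "'a::topological_space set \<Rightarrow> real"
  assumes sets [measurable_cong]: "sets M = sets borel" and f: "integrable M f"
    and \<nu>: "\<And>A. A \<in> sets borel \<Longrightarrow> \<nu> A = (LINT x:A|M. f x)"
    and g [measurable]: "g \<in> borel_measurable borel" and X [measurable]: "X \<in> sets borel"
    and bd: "\<And>x. \<bar>g x\<bar> \<le> C"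
  shows "signed_integral X \<nu> g = (LINT x:X|M. g x * f x)"
proof -
  have [measurable]: "f \<in> borel_measurable M" using f by auto
  have part: "(LINT x:X|jordan_pos \<nu>'. g x) = (LINT x|M. max 0 (f' x) * (indicator X x * g x))
      \<and> integrable M (\<lambda>x. max 0 (f' x) * (indicator X x * g x))"
    if f': "integrable M f'" and \<nu>': "\<And>A. A \<in> sets borel \<Longrightarrow> \<nu>' A = (LINT x:A|M. f' x)" for f' \<nu>'
  proof
    have [measurable]: "f' \<in> borel_measurable M" using f' by auto
    have j: "jordan_pos \<nu>' = density M (\<lambda>x. ennreal (max 0 (f' x)))"
      using jordan_pos_eq_density[OF sets f' \<nu>'] by (simp add: ennreal_max_0)
    show "(LINT x:X|jordan_pos \<nu>'. g x) = (LINT x|M. max 0 (f' x) * (indicator X x * g x))"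
      unfolding j set_lebesgue_integral_def by (subst integral_density) auto
    have C: "0 \<le> C" using abs_ge_zero order_trans bd by blast
    have "\<bar>indicator X x * g x\<bar> \<le> C" for x
      using bd[of x] C by (auto simp: indicator_def)
    then have bd': "\<bar>max 0 (f' x) * (indicator X x * g x)\<bar> \<le> C * \<bar>f' x\<bar>" for x
      using mult_mono[of "\<bar>max 0 (f' x)\<bar>" "\<bar>f' x\<bar>" "\<bar>indicator X x * g x\<bar>" C]
      by (simp add: abs_mult mult.commute)
    show "integrable M (\<lambda>x. max 0 (f' x) * (indicator X x * g x))"
    proof (rule Bochner_Integration.integrable_bound[of M "\<lambda>x. C * \<bar>f' x\<bar>"])
      show "AE x in M. norm (max 0 (f' x) * (indicator X x * g x)) \<le> norm (C * \<bar>f' x\<bar>)"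
        using bd' C by (intro AE_I2) (simp add: abs_mult)
    qed (use f' in auto)
  qed
  have neg: "- \<nu> A = (LINT x:A|M. - f x)" if "A \<in> sets borel" for A
    using \<nu>[OF that] by (simp add: set_lebesgue_integral_def)
  have "signed_integral X \<nu> g = (LINT x|M. max 0 (f x) * (indicator X x * g x)) - (LINT x|M. max 0 (- f x) * (indicator X x * g x))"
    unfolding signed_integral_def using part[OF f \<nu>] part[OF integrable_minus[OF f] neg] by auto
  also have "\<dots> = (LINT x|M. max 0 (f x) * (indicator X x * g x) - max 0 (- f x) * (indicator X x * g x))"
    using part[OF f \<nu>] part[OF integrable_minus[OF f] neg] by simp
  also have "\<dots> = (LINT x:X|M. g x * f x)"
    unfolding set_lebesgue_integral_def
    by (intro Bochner_Integration.integral_cong) (auto simp: max_def indicator_def)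
  finally show ?thesis .
qed

lemma vec_integral_eq_LINT:
  fixes \<eta> :: "'a::topological_space set \<Rightarrow> real^'n"
  assumes sets [measurable_cong]: "sets M = sets borel" and v: "integrable M v"
    and \<eta>: "\<And>A. A \<in> sets borel \<Longrightarrow> \<eta> A = (LINT x:A|M. v x)"
    and g [measurable]: "g \<in> borel_measurable borel" and X [measurable]: "X \<in> sets borel"
    and bd: "\<And>x. norm (g x) \<le> C"
  shows "vec_integral X \<eta> g = (LINT x:X|M. g x \<bullet> v x)"
proof -
  have [measurable]: "v \<in> borel_measurable M" using v by auto
  have nth [measurable]: "(\<lambda>y::real^'n. y $ i) \<in> borel_measurable borel" for i
    by (intro borel_measurable_continuous_onI continuous_intros)
  have vi: "integrable M (\<lambda>x. v x $ i)" for i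
    using integrable_bounded_linear[OF bounded_linear_vec_nth v] .
  have "vec_integral X \<eta> g = (\<Sum>i\<in>UNIV. LINT x:X|M. g x $ i * v x $ i)"
    unfolding vec_integral_def
  proof (intro sum.cong signed_integral_eq_LINT[OF sets vi _ _ X])
    fix i A assume A: "A \<in> sets (borel :: 'a measure)"
    have "integrable M (\<lambda>x. indicator A x *\<^sub>R v x)"
      using A sets v by (intro integrable_mult_indicator) auto
    then show "\<eta> A $ i = (LINT x:A|M. v x $ i)"
      unfolding \<eta>[OF A] set_lebesgue_integral_def
      by (subst integral_bounded_linear[OF bounded_linear_vec_nth, symmetric]) auto
  next
    fix i x show "\<bar>g x $ i\<bar> \<le> C" using bd[of x] component_le_norm_cart[of "g x" i] by simp
  qed measurable
  also have "\<dots> = (LINT x:X|M. g x \<bullet> v x)"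
  proof -
    have "integrable M (\<lambda>x. indicator X x *\<^sub>R (g x $ i * v x $ i))" for i
    proof (rule Bochner_Integration.integrable_bound[of M "\<lambda>x. C * norm (v x)"])
      show "AE x in M. norm (indicator X x *\<^sub>R (g x $ i * v x $ i)) \<le> norm (C * norm (v x))"
      proof (rule AE_I2)
        fix x
        have "\<bar>g x $ i\<bar> * \<bar>v x $ i\<bar> \<le> C * norm (v x)"
          using component_le_norm_cart[of "g x" i] component_le_norm_cart[of "v x" i] bd[of x]
          by (intro mult_mono) (auto intro: order_trans[OF norm_ge_zero])
        moreover have "0 \<le> C" using bd[of x] norm_ge_zero order_trans by blast
        ultimately show "norm (indicator X x *\<^sub>R (g x $ i * v x $ i)) \<le> norm (C * norm (v x))"
          by (simp add: indicator_def abs_mult)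
      qed
    qed (use v in auto)
    then show ?thesis
      unfolding set_lebesgue_integral_def inner_vec_def
      by (subst Bochner_Integration.integral_sum[symmetric]) (auto simp: sum_distrib_left)
  qed
  finally show ?thesis .
qed

section \<open>Disintegrations\<close>

lemma countable_Int_stable_borel_generator:
  obtains G :: "'a::second_countable_topology set set"
  where "countable G" "Int_stable G" "UNIV \<in> G" "sets borel = sigma_sets UNIV G"
proof -
  obtain B :: "'a set set" where B: "countable B" "topological_basis B"
    using ex_countable_basis by auto
  define G where "G = Inter ` {F. finite F \<and> F \<subseteq> B}"
  have "countable G"
    unfolding G_def using B(1) by (intro countable_image countable_Collect_finite_subset)
  moreover have "Int_stable G"
  proof (rule Int_stableI_image[of _ id, simplified], unfold G_def)
    fix a b assume "a \<in> Inter ` {F. finite F \<and> F \<subseteq> B}" "b \<in> Inter ` {F. finite F \<and> F \<subseteq> B}"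
    then obtain E F where "a = \<Inter> E" "finite E" "E \<subseteq> B" "b = \<Inter> F" "finite F" "F \<subseteq> B" by auto
    then show "a \<inter> b \<in> Inter ` {F. finite F \<and> F \<subseteq> B}"
      by (auto intro!: image_eqI[of _ _ "E \<union> F"])
  qed
  moreover have "UNIV \<in> G"
    unfolding G_def by (auto intro!: image_eqI[of _ _ "{}"])
  moreover have "sets borel = sigma_sets UNIV G"
  proof
    have "sets (borel :: 'a measure) = sigma_sets UNIV B"
      unfolding borel_eq_countable_basis[OF B] by (rule sets_measure_of) simp
    also have "\<dots> \<subseteq> sigma_sets UNIV G"
    proof (rule sigma_sets_mono')
      show "B \<subseteq> G" unfolding G_def by (auto intro!: image_eqI[of _ _ "{_}"])
    qed
    finally show "sets borel \<subseteq> sigma_sets UNIV G" .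
    have "G \<subseteq> {S. open S}"
      unfolding G_def using B(2) by (auto intro!: open_Inter dest: topological_basis_open)
    then have "G \<subseteq> sets borel" by auto
    then show "sigma_sets UNIV G \<subseteq> sets borel"
      using sets.sigma_sets_subset[of G borel] by simp
  qed
  ultimately show thesis by (rule that)
qed

lemma radon_vec_empty: "\<eta> \<in> radon_vec X \<Longrightarrow> \<eta> {} = 0"
  by (auto simp: radon_vec_def)

lemma radon_vec_sums:
  assumes "\<eta> \<in> radon_vec X" "range A \<subseteq> sets borel" "disjoint_family A"
  shows "(\<lambda>i. \<eta> (A i)) sums \<eta> (\<Union>i::nat. A i)"
proof -
  have "\<forall>A :: nat \<Rightarrow> _. range A \<subseteq> sets borel \<longrightarrow> disjoint_family A \<longrightarrow> (\<lambda>i. \<eta> (A i)) sums \<eta> (\<Union>i. A i)"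
    using assms(1) by (simp add: radon_vec_def)
  then show ?thesis using assms(2,3) by blast
qed

lemma radon_vec_Compl:
  assumes \<eta>: "\<eta> \<in> radon_vec X" and A: "A \<in> sets borel"
  shows "\<eta> (UNIV - A) = \<eta> UNIV - \<eta> A"
proof -
  define f where "f = (\<lambda>i::nat. if i = 0 then A else if i = 1 then UNIV - A else {})"
  have f: "range f \<subseteq> sets borel" "disjoint_family f"
    using A unfolding f_def by (auto simp: disjoint_family_on_def split: if_splits)
  have "f 0 \<union> f 1 = UNIV" by (simp add: f_def)
  then have "(\<Union>i. f i) = UNIV" by blast
  then have "(\<lambda>i. \<eta> (f i)) sums \<eta> UNIV"
    using radon_vec_sums[OF \<eta> f] by simp
  moreover have "(\<lambda>i. \<eta> (f i)) sums (\<Sum>i\<in>{0,1}. \<eta> (f i))"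
    using radon_vec_empty[OF \<eta>] by (intro sums_finite) (auto simp: f_def)
  ultimately have "\<eta> UNIV = \<eta> A + \<eta> (UNIV - A)"
    using sums_unique2 by (fastforce simp: f_def)
  then show ?thesis by simp
qed

text \<open>
  Integrating over all sets of times shows that the two families agree on a given \<open>B\<close> for almost every
  \<open>t\<close>. A countable generator keeps the exceptional set of times null, and for the other times Dynkin's
  lemma extends the agreement to all Borel sets. This is applied both to nonnegative measures, through
  \<^const>\<open>measure\<close>, and to vector measures.
\<close>

lemma kernel_unique_AE:
  fixes E E' :: "real \<Rightarrow> 'a::second_countable_topology set \<Rightarrow> 'b::{banach, second_countable_topology}"
  assumes E: "\<And>t. t \<in> {0..T} \<Longrightarrow> E t \<in> radon_vec X"
    and E': "\<And>t. t \<in> {0..T} \<Longrightarrow> E' t \<in> radon_vec X'"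
    and int: "\<And>B. B \<in> sets borel \<Longrightarrow> set_integrable lborel {0..T} (\<lambda>t. E t B)"
      "\<And>B. B \<in> sets borel \<Longrightarrow> set_integrable lborel {0..T} (\<lambda>t. E' t B)"
    and eq: "\<And>B C. B \<in> sets borel \<Longrightarrow> C \<in> sets borel \<Longrightarrow>
      (LINT t:{0..T} \<inter> C|lborel. E t B) = (LINT t:{0..T} \<inter> C|lborel. E' t B)"
  shows "AE t in lborel. t \<in> {0..T} \<longrightarrow> (\<forall>B \<in> sets borel. E t B = E' t B)"
proof -
  obtain G :: "'a set set" where G: "countable G" "Int_stable G" "UNIV \<in> G" "sets borel = sigma_sets UNIV G"
    by (rule countable_Int_stable_borel_generator)
  have "AE t in lborel. \<forall>B\<in>G. t \<in> {0..T} \<longrightarrow> E t B = E' t B"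
    unfolding AE_ball_countable[OF G(1)]
  proof
    fix B assume "B \<in> G"
    then have B: "B \<in> sets borel" using G(4) by (auto intro: sigma_sets.Basic)
    have "AE t in lborel. indicator {0..T} t *\<^sub>R E t B = indicator {0..T} t *\<^sub>R E' t B"
    proof (rule sigma_finite_measure.density_unique_banach[OF sigma_finite_lborel])
      fix C :: "real set" assume "C \<in> sets lborel"
      then show "(LINT t:C|lborel. indicator {0..T} t *\<^sub>R E t B) = (LINT t:C|lborel. indicator {0..T} t *\<^sub>R E' t B)"
        using eq[OF B, of C] by (simp add: set_lebesgue_integral_def indicator_inter_arith mult.commute)
    qed (use int[OF B] in \<open>auto simp: set_integrable_def\<close>)
    then show "AE t in lborel. t \<in> {0..T} \<longrightarrow> E t B = E' t B"
      by eventually_elim auto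
  qed
  then show ?thesis
  proof eventually_elim
    case (elim t)
    show ?case
    proof (intro impI ballI)
      fix B :: "'a set" assume t: "t \<in> {0..T}" and B: "B \<in> sets borel"
      have subset_Pow_UNIV: "G \<subseteq> Pow UNIV" by simp
      have *: "E t B = E' t B" if "B \<in> sigma_sets UNIV G" for B
        using G(2) subset_Pow_UNIV that
      proof (induction B rule: sigma_sets_induct_disjoint)
        case (basic A)
        then show ?case using elim t by blast
      next
        case empty
        show ?case using radon_vec_empty[OF E[OF t]] radon_vec_empty[OF E'[OF t]] by simp
      next
        case (compl A)
        have "E t UNIV = E' t UNIV" using elim t G(3) by blast
        then show ?case
          using compl radon_vec_Compl[OF E[OF t], of A] radon_vec_Compl[OF E'[OF t], of A] G(4) by simp
      next
        case (union A)
        have "range A \<subseteq> sets borel" using union(2) G(4) by simp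
        then have "(\<lambda>i. E t (A i)) sums E t (\<Union>i. A i)" "(\<lambda>i. E' t (A i)) sums E' t (\<Union>i. A i)"
          using radon_vec_sums[OF E[OF t]] radon_vec_sums[OF E'[OF t]] union(1) by blast+
        then show ?case using union(3) sums_unique2 by fastforce
      qed
      show "E t B = E' t B" using * B G(4) by simp
    qed
  qed
qed

lemma measure_in_radon_vec:
  assumes "\<mu> \<in> radon_nonneg X"
  shows "measure \<mu> \<in> radon_vec UNIV"
proof -
  interpret finite_measure \<mu> using assms by (simp add: radon_nonneg_def)
  have "sets \<mu> = sets borel" using assms by (simp add: radon_nonneg_def)
  then show ?thesis
    unfolding radon_vec_def using finite_measure_UNION by auto
qed

lemma disintegrates_LINT:
  assumes dis: "disintegrates T D \<rho> R" and fin: "finite_measure \<rho>"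
    and B: "B \<in> sets borel" and C: "C \<in> sets borel"
  shows "set_integrable lborel ({0..T} \<inter> C) (\<lambda>t. measure (R t) B)"
    and "(LINT t:{0..T} \<inter> C|lborel. measure (R t) B) = measure \<rho> (C \<times> B)"
proof -
  let ?f = "\<lambda>t. indicator ({0..T} \<inter> C) t *\<^sub>R measure (R t) B"
  interpret finite_measure \<rho> by fact
  have R: "t \<in> {0..T} \<Longrightarrow> finite_measure (R t)" for t
    using dis by (auto simp: disintegrates_def radon_nonneg_def)
  have "(\<lambda>t. emeasure (R t) B) \<in> borel_measurable (restrict_space borel {0..T})"
    using dis B by (auto simp: disintegrates_def)
  then have "(\<lambda>t. measure (R t) B) \<in> borel_measurable (restrict_space borel {0..T})"
    unfolding measure_def by measurable
  then have "(\<lambda>t. indicator {0..T} t *\<^sub>R measure (R t) B) \<in> borel_measurable borel"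
    by (subst (asm) borel_measurable_restrict_space_iff) auto
  then have "(\<lambda>t. indicator C t * (indicator {0..T} t *\<^sub>R measure (R t) B)) \<in> borel_measurable borel"
    using C by (intro borel_measurable_times borel_measurable_indicator) auto
  also have "(\<lambda>t. indicator C t * (indicator {0..T} t *\<^sub>R measure (R t) B)) = ?f"
    by (auto simp: indicator_def)
  finally have m: "?f \<in> borel_measurable lborel" by simp
  have CB: "C \<times> B \<in> sets borel"
    using C B by (rule borel_Times)
  have "(\<integral>\<^sup>+ t. ennreal (?f t) \<partial>lborel)
      = (\<integral>\<^sup>+ t\<in>{0..T}. emeasure (R t) {x. (t, x) \<in> C \<times> B} \<partial>lborel)"
    using R by (intro nn_integral_cong) (auto simp: indicator_def finite_measure.emeasure_eq_measure)
  also have "\<dots> = emeasure \<rho> (C \<times> B)"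
    using dis CB by (simp add: disintegrates_def)
  finally have *: "(\<integral>\<^sup>+ t. ennreal (?f t) \<partial>lborel) = ennreal (measure \<rho> (C \<times> B))"
    by (simp add: emeasure_eq_measure)
  show "set_integrable lborel ({0..T} \<inter> C) (\<lambda>t. measure (R t) B)"
    unfolding set_integrable_def using m * by (intro integrableI_nonneg) auto
  show "(LINT t:{0..T} \<inter> C|lborel. measure (R t) B) = measure \<rho> (C \<times> B)"
    unfolding set_lebesgue_integral_def using m * by (intro integral_eq_nn_integral[THEN trans]) auto
qed

lemma disintegrates_unique:
  assumes dis: "disintegrates T D \<rho> R" "disintegrates T D \<rho> R'" and fin: "finite_measure \<rho>"
  shows "AE t in lborel. t \<in> {0..T} \<longrightarrow> R t = R' t"
proof -
  have rn: "t \<in> {0..T} \<Longrightarrow> R t \<in> radon_nonneg D" "t \<in> {0..T} \<Longrightarrow> R' t \<in> radon_nonneg D" for t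
    using dis by (auto simp: disintegrates_def)
  have "AE t in lborel. t \<in> {0..T} \<longrightarrow> (\<forall>B \<in> sets borel. measure (R t) B = measure (R' t) B)"
  proof (rule kernel_unique_AE[of T _ UNIV _ UNIV])
    fix B C :: "_ set" assume "B \<in> sets (borel :: (real^3) measure)" "C \<in> sets (borel :: real measure)"
    then show "(LINT t:{0..T} \<inter> C|lborel. measure (R t) B) = (LINT t:{0..T} \<inter> C|lborel. measure (R' t) B)"
      using disintegrates_LINT(2)[OF dis(1) fin] disintegrates_LINT(2)[OF dis(2) fin] by simp
  qed (use rn measure_in_radon_vec disintegrates_LINT(1)[OF dis(1) fin, of _ UNIV]
       disintegrates_LINT(1)[OF dis(2) fin, of _ UNIV] in auto)
  then show ?thesis
  proof eventually_elim
    case (elim t)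
    show ?case
    proof
      assume t: "t \<in> {0..T}"
      note r = rn(1)[OF t] rn(2)[OF t]
      show "R t = R' t"
        using elim t r by (intro measure_eqI) (auto simp: radon_nonneg_def finite_measure.emeasure_eq_measure)
    qed
  qed
qed

lemma disintegrates_vec_unique:
  assumes dis: "disintegrates_vec T \<eta> E" "disintegrates_vec T \<eta> E'"
  shows "AE t in lborel. t \<in> {0..T} \<longrightarrow> (\<forall>B \<in> sets borel. E t B = E' t B)"
proof -
  have rv: "t \<in> {0..T} \<Longrightarrow> E t \<in> radon_vec UNIV" "t \<in> {0..T} \<Longrightarrow> E' t \<in> radon_vec UNIV" for t
    using dis by (auto simp: disintegrates_vec_def)
  have *: "set_integrable lborel {0..T} (\<lambda>t. E t B)"
      "C \<in> sets borel \<Longrightarrow> (LINT t:{0..T} \<inter> C|lborel. E t B) = \<eta> (C \<times> B)"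
    if d: "disintegrates_vec T \<eta> E" and B: "B \<in> sets borel" for E B C
  proof -
    have UB: "UNIV \<times> B \<in> sets (borel :: (real \<times> (real^3)) measure)"
      using B by (intro borel_Times) auto
    show "set_integrable lborel {0..T} (\<lambda>t. E t B)"
      using d UB unfolding disintegrates_vec_def by fastforce
    assume C: "C \<in> sets borel"
    have CB: "C \<times> B \<in> sets borel"
      using C B by (rule borel_Times)
    have e: "t \<in> {0..T} \<Longrightarrow> E t {} = 0" for t
      using d radon_vec_empty unfolding disintegrates_vec_def by blast
    have "\<eta> (C \<times> B) = (LINT t:{0..T}|lborel. E t {x. (t, x) \<in> C \<times> B})"
      using d CB unfolding disintegrates_vec_def by blast
    also have "\<dots> = (LINT t:{0..T} \<inter> C|lborel. E t B)"
      unfolding set_lebesgue_integral_def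
      using e by (intro Bochner_Integration.integral_cong) (auto simp: indicator_def)
    finally show "(LINT t:{0..T} \<inter> C|lborel. E t B) = \<eta> (C \<times> B)" by simp
  qed
  show ?thesis
    by (rule kernel_unique_AE[of T _ UNIV _ UNIV]) (use rv *[OF dis(1)] *[OF dis(2)] in auto)
qed

section \<open>The energy of a measure moved by a bounded velocity\<close>

text \<open>
  The support is compact in \<open>(0,T) \<times> D\<close>, so extension by 0 keeps the derivatives bounded and measurable,
  and \<open>\<phi>\<close> stays continuous up to the end slices. The latter makes the fundamental theorem of calculus
  available on closed time intervals.
\<close>

lemma C1c_test_regularity:
  assumes test: "C1c_test T D \<phi> p g" and D: "closed D"
  shows "continuous_on ({0..T} \<times> D) \<phi>"
    and "\<phi> (0, x) = 0" "\<phi> (T, x) = 0"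
    and "p \<in> borel_measurable borel" "g \<in> borel_measurable borel"
    and "\<exists>C. \<forall>z. \<bar>p z\<bar> \<le> C \<and> norm (g z) \<le> C"
proof -
  let ?S = "{0<..<T} \<times> D"
  obtain K where K: "compact K" "K \<subseteq> ?S" "\<And>z. z \<notin> K \<Longrightarrow> \<phi> z = 0 \<and> p z = 0 \<and> g z = 0"
    using test unfolding C1c_test_def by auto
  have cp: "continuous_on ?S p" and cg: "continuous_on ?S g"
    and der: "\<And>z. z \<in> ?S \<Longrightarrow> (\<phi> has_derivative (\<lambda>(s, y). p z * s + g z \<bullet> y)) (at z within ?S)"
    using test unfolding C1c_test_def by auto
  have "{0<..<T} \<in> sets borel" "D \<in> sets borel" using D by auto
  then have S: "?S \<in> sets borel" by (rule borel_Times)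
  have off: "p z = 0" "g z = 0" "\<phi> z = 0" if "z \<notin> ?S" for z
    using K(2) K(3)[of z] that by blast+
  then have "p = (\<lambda>z. if z \<in> ?S then p z else 0)" "g = (\<lambda>z. if z \<in> ?S then g z else 0)"
    by (rule_tac ext, simp)+
  moreover have "(\<lambda>z. if z \<in> ?S then p z else 0) \<in> borel_measurable borel"
    "(\<lambda>z. if z \<in> ?S then g z else 0) \<in> borel_measurable borel"
    by (rule borel_measurable_continuous_on_if[OF S], fact, simp)+
  ultimately show "p \<in> borel_measurable borel" "g \<in> borel_measurable borel" by simp_all
  have "bounded (p ` K)" "bounded (g ` K)"
    using K cp cg by (auto intro!: compact_imp_bounded compact_continuous_image intro: continuous_on_subset)
  then obtain a b where "\<And>z. z \<in> K \<Longrightarrow> \<bar>p z\<bar> \<le> a" "\<And>z. z \<in> K \<Longrightarrow> norm (g z) \<le> b"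
    unfolding bounded_iff by auto
  then have "\<bar>p z\<bar> \<le> max 0 (max a b) \<and> norm (g z) \<le> max 0 (max a b)" for z
    using K(3)[of z] by (cases "z \<in> K") (auto simp: le_max_iff_disj)
  then show "\<exists>C. \<forall>z. \<bar>p z\<bar> \<le> C \<and> norm (g z) \<le> C" by blast
  show "\<phi> (0, x) = 0" "\<phi> (T, x) = 0" by (rule off, simp)+
  show "continuous_on ({0..T} \<times> D) \<phi>"
    unfolding continuous_on_eq_continuous_within
  proof
    fix z assume z: "z \<in> {0..T} \<times> D"
    show "continuous (at z within {0..T} \<times> D) \<phi>"
    proof (cases "z \<in> K")
      case False
      have "open (- K)" using K(1) by (simp add: compact_imp_closed open_Compl)
      then have "continuous_on (- K) \<phi>"
        using K(3) by (subst continuous_on_cong[of _ _ _ "\<lambda>_. 0"]) auto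
      then have "continuous (at z) \<phi>"
        using \<open>open (- K)\<close> False by (simp add: continuous_on_eq_continuous_at)
      then show ?thesis by (rule continuous_at_imp_continuous_at_within)
    next
      case True
      then have z: "z \<in> ?S" using K(2) by blast
      have "continuous (at z within ?S) \<phi>"
        using der[OF z] by (rule has_derivative_continuous)
      moreover have "at z within ?S = at z within {0..T} \<times> D"
      proof (rule at_within_nhd)
        show "z \<in> {0<..<T} \<times> UNIV" "open ({0<..<T} \<times> (UNIV :: (real^3) set))"
          using z by (auto intro: open_Times)
      qed auto
      ultimately show ?thesis by simp
    qed
  qed
qed

lemma vec_RN_deriv_AE:
  assumes fin: "finite_measure M" and sets: "sets M = sets borel"
    and v: "v \<in> borel_measurable borel" "integrable M v"
    and \<eta>: "\<And>A. A \<in> sets borel \<Longrightarrow> \<eta> A = (LINT x:A|M. v x)"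
  shows "AE x in M. vec_RN_deriv M \<eta> x = v x"
proof -
  have "\<exists>v. v \<in> borel_measurable borel \<and> integrable M v \<and> (\<forall>A \<in> sets borel. \<eta> A = (LINT x:A|M. v x))"
    using v \<eta> by blast
  from someI_ex[OF this] have w: "integrable M (vec_RN_deriv M \<eta>)"
    "\<And>A. A \<in> sets borel \<Longrightarrow> \<eta> A = (LINT x:A|M. vec_RN_deriv M \<eta> x)"
    unfolding vec_RN_deriv_def by auto
  interpret finite_measure M by fact
  show ?thesis
    by (rule density_unique_banach) (use w v \<eta> sets in auto)
qed

text \<open>
  The functional picks its disintegrations by Hilbert choice. By uniqueness almost everywhere they can be
  replaced by the given \<open>R\<close> and \<open>E\<close>, for which the Radon--Nikodym derivative at time \<open>t\<close> is \<open>v (t, \<cdot>)\<close>.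
\<close>

lemma benamou_brenier_le:
  assumes \<rho>: "\<rho> \<in> radon_nonneg ({0..T} \<times> D)" and D: "closed D"
    and dis: "disintegrates T D \<rho> R" and disv: "disintegrates_vec T \<eta> E"
    and v: "v \<in> borel_measurable borel" "\<And>z. norm (v z) \<le> L"
    and \<eta>: "\<And>A. A \<in> sets borel \<Longrightarrow> \<eta> A = (LINT z:A|\<rho>. v z)"
    and E: "\<And>t A. t \<in> {0..T} \<Longrightarrow> A \<in> sets borel \<Longrightarrow> E t A = (LINT x:A|R t. v (t, x))"
    and ce: "\<And>\<phi> p g. C1c_test T D \<phi> p g \<Longrightarrow> (LINT z|\<rho>. p z + g z \<bullet> v z) = 0"
  shows "benamou_brenier T D \<rho> \<eta> \<le> ennreal (L\<^sup>2 * measure \<rho> UNIV)"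
proof -
  let ?X = "{0..T} \<times> D"
  have sets [measurable_cong]: "sets \<rho> = sets borel" and fin: "finite_measure \<rho>" and null: "emeasure \<rho> (- ?X) = 0"
    using \<rho> by (auto simp: radon_nonneg_def)
  interpret finite_measure \<rho> by fact
  have [measurable]: "v \<in> borel_measurable borel" by fact
  have "{0..T} \<in> sets borel" "D \<in> sets borel" using D by auto
  then have X: "?X \<in> sets borel" by (rule borel_Times)
  have AEX: "AE z in \<rho>. z \<in> ?X" using sets X null by (rule AE_mem_of_null_Compl)
  have vint: "integrable \<rho> v"
    using v by (intro integrable_const_bound[of _ L]) auto
  have L: "0 \<le> L" using v(2) norm_ge_zero order_trans by blast
  have "continuity_eq T D \<rho> \<eta>"
    unfolding continuity_eq_def
  proof (intro allI impI)
    fix \<phi> p g assume test: "C1c_test T D \<phi> p g"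
    note reg = C1c_test_regularity[OF test D]
    note [measurable] = reg(4,5)
    obtain C where C: "\<And>z. \<bar>p z\<bar> \<le> C" "\<And>z. norm (g z) \<le> C" using reg(6) by blast
    have C0: "0 \<le> C" using C(2) norm_ge_zero order_trans by blast
    have pint: "integrable \<rho> p" using C by (intro integrable_const_bound[of _ C]) auto
    have gint: "integrable \<rho> (\<lambda>z. g z \<bullet> v z)"
    proof (rule integrable_const_bound[of _ "C * L"])
      show "AE z in \<rho>. norm (g z \<bullet> v z) \<le> C * L"
        unfolding real_norm_def
        by (intro AE_I2 order_trans[OF Cauchy_Schwarz_ineq2] mult_mono C v C0 norm_ge_zero)
    qed measurable
    have LX: "(LINT z:?X|\<rho>. f z) = (LINT z|\<rho>. f z)" if "f \<in> borel_measurable borel" for f :: "_ \<Rightarrow> real"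
      unfolding set_lebesgue_integral_def using that X AEX sets
      by (intro integral_cong_AE) (auto intro!: borel_measurable_scaleR)
    have "vec_integral ?X \<eta> g = (LINT z:?X|\<rho>. g z \<bullet> v z)"
      by (rule vec_integral_eq_LINT[OF sets vint \<eta> _ X C(2)]) auto
    then have "(LINT z:?X|\<rho>. p z) + vec_integral ?X \<eta> g = (LINT z|\<rho>. p z) + (LINT z|\<rho>. g z \<bullet> v z)"
      using LX[of p] LX[of "\<lambda>z. g z \<bullet> v z"] by simp
    also have "\<dots> = 0"
      using ce[OF test] pint gint by simp
    finally show "(LINT z:?X|\<rho>. p z) + vec_integral ?X \<eta> g = 0" .
  qed
  moreover have "vec_abs_cont \<eta> \<rho>"
    unfolding vec_abs_cont_def
  proof (intro ballI impI)
    fix A :: "(real \<times> (real^3)) set" assume A: "A \<in> sets borel" "emeasure \<rho> A = 0"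
    then have "AE z in \<rho>. z \<notin> A" using sets by (intro AE_not_in) (auto simp: null_sets_def)
    then show "\<eta> A = 0"
      unfolding \<eta>[OF A(1)] set_lebesgue_integral_def
      by (intro integral_eq_zero_AE) (auto elim!: eventually_mono)
  qed
  moreover define R' where "R' = (SOME \<rho>t. disintegrates T D \<rho> \<rho>t)"
  moreover define E' where "E' = (SOME \<eta>t. disintegrates_vec T \<eta> \<eta>t)"
  ultimately have BB: "benamou_brenier T D \<rho> \<eta>
      = (\<integral>\<^sup>+ t\<in>{0..T}. (\<integral>\<^sup>+ x\<in>D. ennreal ((norm (vec_RN_deriv (R' t) (E' t) x))\<^sup>2) \<partial>R' t) \<partial>lborel)"
    unfolding benamou_brenier_def Let_def using \<rho> dis by auto
  have dis': "disintegrates T D \<rho> R'" unfolding R'_def using dis by (rule someI[of "disintegrates T D \<rho>"])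
  have disv': "disintegrates_vec T \<eta> E'" unfolding E'_def using disv by (rule someI[of "disintegrates_vec T \<eta>"])
  have "AE t in lborel. t \<in> {0..T} \<longrightarrow>
    (\<integral>\<^sup>+ x\<in>D. ennreal ((norm (vec_RN_deriv (R' t) (E' t) x))\<^sup>2) \<partial>R' t) \<le> ennreal (L\<^sup>2) * emeasure (R t) UNIV"
    using disintegrates_unique[OF dis dis' fin] disintegrates_vec_unique[OF disv disv']
  proof eventually_elim
    case (elim t)
    show ?case
    proof
      assume t: "t \<in> {0..T}"
      then have R': "R' t = R t" using elim by simp
      have R: "finite_measure (R t)" "sets (R t) = sets borel"
        using dis t by (auto simp: disintegrates_def radon_nonneg_def)
      note [measurable_cong] = R(2)
      have vt: "(\<lambda>x. v (t, x)) \<in> borel_measurable borel" by measurable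
      have "AE x in R t. vec_RN_deriv (R t) (E' t) x = v (t, x)"
      proof (rule vec_RN_deriv_AE[OF R vt])
        show "integrable (R t) (\<lambda>x. v (t, x))"
          using v by (intro finite_measure.integrable_const_bound[OF R(1), of _ L]) auto
        show "\<And>A. A \<in> sets borel \<Longrightarrow> E' t A = (LINT x:A|R t. v (t, x))"
          using elim(2) E t by auto
      qed
      then have "(\<integral>\<^sup>+ x\<in>D. ennreal ((norm (vec_RN_deriv (R t) (E' t) x))\<^sup>2) \<partial>R t) \<le> (\<integral>\<^sup>+ x. ennreal (L\<^sup>2) \<partial>R t)"
        by (intro nn_integral_mono_AE, eventually_elim)
          (auto simp: indicator_def intro!: ennreal_leI power_mono v)
      also have "\<dots> = ennreal (L\<^sup>2) * emeasure (R t) UNIV"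
        using sets_eq_imp_space_eq[OF R(2)] by simp
      finally show "(\<integral>\<^sup>+ x\<in>D. ennreal ((norm (vec_RN_deriv (R' t) (E' t) x))\<^sup>2) \<partial>R' t) \<le> ennreal (L\<^sup>2) * emeasure (R t) UNIV"
        using R' by simp
    qed
  qed
  then have "benamou_brenier T D \<rho> \<eta> \<le> (\<integral>\<^sup>+ t. ennreal (L\<^sup>2) * (emeasure (R t) UNIV * indicator {0..T} t) \<partial>lborel)"
    unfolding BB by (intro nn_integral_mono_AE, eventually_elim) (auto simp: indicator_def)
  also have "\<dots> = ennreal (L\<^sup>2) * (\<integral>\<^sup>+ t\<in>{0..T}. emeasure (R t) UNIV \<partial>lborel)"
  proof (rule nn_integral_cmult)
    have "(\<lambda>t. emeasure (R t) UNIV) \<in> borel_measurable (restrict_space borel {0..T})"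
      using dis by (auto simp: disintegrates_def)
    then show "(\<lambda>t. emeasure (R t) UNIV * indicator {0..T} t) \<in> borel_measurable lborel"
      by (subst (asm) borel_measurable_restrict_space_iff_ennreal) auto
  qed
  also have "(\<integral>\<^sup>+ t\<in>{0..T}. emeasure (R t) UNIV \<partial>lborel) = emeasure \<rho> UNIV"
  proof -
    have "UNIV \<in> sets (borel :: (real \<times> (real^3)) measure)" by simp
    then have "emeasure \<rho> UNIV = (\<integral>\<^sup>+ t\<in>{0..T}. emeasure (R t) {x. (t, x) \<in> UNIV} \<partial>lborel)"
      using dis unfolding disintegrates_def by blast
    then show ?thesis by simp
  qed
  also have "ennreal (L\<^sup>2) * emeasure \<rho> UNIV = ennreal (L\<^sup>2 * measure \<rho> UNIV)"
    by (simp add: emeasure_eq_measure ennreal_mult)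
  finally show ?thesis .
qed

section \<open>Time cells and the contraction profile\<close>

definition node :: "real \<Rightarrow> nat \<Rightarrow> nat \<Rightarrow> real" where
  "node T N k = T * real k / real N"

text \<open>
  The minimum puts the final time \<open>T\<close> into the last cell.
\<close>

definition cell_index :: "real \<Rightarrow> nat \<Rightarrow> real \<Rightarrow> nat" where
  "cell_index T N s = min (nat \<lfloor>s * real N / T\<rfloor>) (N - 1)"

lemma measurable_cell_index [measurable]: "cell_index T N \<in> measurable borel (count_space UNIV)"
proof -
  have "(\<lambda>s::real. \<lfloor>s * real N / T\<rfloor>) \<in> measurable borel (count_space UNIV)" by measurable
  from measurable_compose[OF this measurable_count_space, of "\<lambda>i. min (nat i) (N - 1)"]
  show ?thesis unfolding cell_index_def[abs_def] .
qed

lemma cell_index_bounds: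
  assumes T: "0 < T" and N: "0 < N" and s: "s \<in> {0..T}"
  shows "cell_index T N s < N"
    and "node T N (cell_index T N s) \<le> s" and "s \<le> node T N (Suc (cell_index T N s))"
proof -
  define u where "u = s * real N / T"
  have u: "0 \<le> u" "u \<le> real N" using s T N by (auto simp: u_def field_simps)
  have su: "s = T * u / real N" using T N by (simp add: u_def)
  define k where "k = cell_index T N s"
  have k: "k = min (nat \<lfloor>u\<rfloor>) (N - 1)" by (simp add: k_def cell_index_def u_def)
  show "cell_index T N s < N" using N by (simp add: cell_index_def)
  have "real k \<le> u"
  proof -
    have "real k \<le> real (nat \<lfloor>u\<rfloor>)" unfolding k by simp
    also have "\<dots> \<le> u" using u by simp
    finally show ?thesis .
  qed
  then show "node T N (cell_index T N s) \<le> s"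
    unfolding k_def[symmetric] node_def using T N su by (simp add: divide_right_mono)
  have "u \<le> real (Suc k)"
  proof (cases "nat \<lfloor>u\<rfloor> \<le> N - 1")
    case True
    then have "k = nat \<lfloor>u\<rfloor>" unfolding k by simp
    then show ?thesis using u(1) by linarith
  next
    case False
    then have "Suc k = N" unfolding k using N by simp
    then show ?thesis using u by simp
  qed
  then show "s \<le> node T N (Suc (cell_index T N s))"
    unfolding k_def[symmetric] node_def using T N su by (simp add: divide_right_mono del: of_nat_Suc)
qed

lemma cell_index_eqI:
  assumes T: "0 < T" and N: "0 < N" and k: "k < N" and s: "node T N k < s" "s < node T N (Suc k)"
  shows "cell_index T N s = k"
proof -
  have "real k < s * real N / T" "s * real N / T < real (Suc k)"
    using s T N by (auto simp: node_def field_simps)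
  then have "\<lfloor>s * real N / T\<rfloor> = int k" by linarith
  then show ?thesis using k by (simp add: cell_index_def)
qed

lemma node_bounds:
  assumes "0 < T" "0 < N" "k < N"
  shows "0 \<le> node T N k" "node T N k < node T N (Suc k)" "node T N (Suc k) \<le> T"
    and "node T N (Suc k) - node T N k = T / real N"
proof -
  have "T * real (Suc k) \<le> T * real N" using assms by (intro mult_left_mono) auto
  then show "node T N (Suc k) \<le> T" using assms by (simp add: node_def divide_le_eq del: of_nat_Suc)
qed (use assms in \<open>auto simp: node_def field_simps\<close>)

lemma AE_indicator_cell:
  assumes T: "0 < T" and N: "0 < N" and k: "k < N"
  shows "AE s in lborel. indicator {s \<in> {0..T}. cell_index T N s = k} s
    = (indicator {node T N k..node T N (Suc k)} s :: real)"
proof -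
  have "AE s in lborel. s \<noteq> node T N k" "AE s in lborel. s \<noteq> node T N (Suc k)"
    by (rule AE_lborel_singleton)+
  then show ?thesis
  proof eventually_elim
    case (elim s)
    show ?case
    proof (cases "node T N k < s \<and> s < node T N (Suc k)")
      case True
      then show ?thesis using cell_index_eqI[OF T N k] node_bounds[OF T N k] by (auto simp: indicator_def)
    next
      case False
      then have "s \<notin> {node T N k..node T N (Suc k)}" using elim by auto
      moreover have "s \<notin> {s \<in> {0..T}. cell_index T N s = k}"
        using calculation cell_index_bounds(2,3)[OF T N, of s] by auto
      ultimately show ?thesis by (metis indicator_simps(2))
    qed
  qed
qed

lemma emeasure_cell:
  assumes T: "0 < T" and N: "0 < N" and k: "k < N"
  shows "emeasure lborel {s \<in> {0..T}. cell_index T N s = k} = ennreal (T / real N)"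
proof -
  have "emeasure lborel {s \<in> {0..T}. cell_index T N s = k} = emeasure lborel {node T N k..node T N (Suc k)}"
  proof (rule emeasure_eq_AE)
    show "AE s in lborel. (s \<in> {s \<in> {0..T}. cell_index T N s = k}) = (s \<in> {node T N k..node T N (Suc k)})"
      using AE_indicator_cell[OF assms] by eventually_elim (simp add: indicator_def of_bool_eq_iff)
  qed measurable
  also have "\<dots> = ennreal (T / real N)"
    using node_bounds[OF assms] by simp
  finally show ?thesis .
qed

text \<open>
  A symmetric averaging kernel, with both marginals equal to Lebesgue measure on \<open>[0,T]\<close>.
\<close>

definition cell_kernel :: "real \<Rightarrow> nat \<Rightarrow> real \<Rightarrow> real \<Rightarrow> real" where
  "cell_kernel T N s t =
     (if s \<in> {0..T} \<and> t \<in> {0..T} \<and> cell_index T N s = cell_index T N t then real N / T else 0)"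

lemma measurable_cell_kernel:
  "(\<lambda>q. cell_kernel T N (fst q) (snd q)) \<in> borel_measurable (borel \<Otimes>\<^sub>M borel)"
proof -
  have [measurable]: "(\<lambda>s. real (cell_index T N s)) \<in> borel_measurable borel"
    by (rule measurable_compose[OF measurable_cell_index]) simp
  have "(\<lambda>q. cell_kernel T N (fst q) (snd q)) = (\<lambda>q. if fst q \<in> {0..T} \<and> snd q \<in> {0..T} \<and>
    real (cell_index T N (fst q)) = real (cell_index T N (snd q)) then real N / T else 0)"
    by (simp add: cell_kernel_def fun_eq_iff)
  also have "\<dots> \<in> borel_measurable (borel \<Otimes>\<^sub>M borel)" by measurable
  finally show ?thesis .
qed

lemma cell_kernel_sym: "cell_kernel T N s t = cell_kernel T N t s"
  by (auto simp: cell_kernel_def)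

lemma nn_integral_cell_kernel:
  assumes T: "0 < T" and N: "0 < N"
  shows "(\<integral>\<^sup>+ t. ennreal (cell_kernel T N s t) \<partial>lborel) = indicator {0..T} s"
proof (cases "s \<in> {0..T}")
  case True
  define C where "C = {t \<in> {0..T}. cell_index T N t = cell_index T N s}"
  have C: "C \<in> sets borel" unfolding C_def by measurable
  have "(\<integral>\<^sup>+ t. ennreal (cell_kernel T N s t) \<partial>lborel) = (\<integral>\<^sup>+ t. ennreal (real N / T) * indicator C t \<partial>lborel)"
    using True by (intro nn_integral_cong) (auto simp: cell_kernel_def C_def indicator_def)
  also have "\<dots> = ennreal (real N / T) * ennreal (T / real N)"
    using C emeasure_cell[OF T N cell_index_bounds(1)[OF T N True]]
    by (subst nn_integral_cmult_indicator) (auto simp: C_def)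
  also have "\<dots> = 1"
    using T N by (simp add: ennreal_mult[symmetric])
  finally show ?thesis using True by simp
next
  case False
  then have "cell_kernel T N s t = 0" for t by (auto simp: cell_kernel_def)
  then show ?thesis using False by simp
qed

definition plateau :: "real \<Rightarrow> real \<Rightarrow> real \<Rightarrow> real \<Rightarrow> real" where
  "plateau L a b s = min 1 (L * min (s - a) (b - s))"

text \<open>
  The value is 0 not only on the plateau but also where the profile vanishes. The quotient of the
  derivative and the profile, which is the velocity of the contraction, is then 0 at these points too.
\<close>

definition plateau_deriv :: "real \<Rightarrow> real \<Rightarrow> real \<Rightarrow> real \<Rightarrow> real" where
  "plateau_deriv L a b s =
     (if 0 < plateau L a b s \<and> plateau L a b s < 1 then if s - a < b - s then L else - L else 0)"

lemma plateau_bounds: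
  assumes "0 \<le> L" "a \<le> s" "s \<le> b"
  shows "0 \<le> plateau L a b s" "plateau L a b s \<le> 1"
  using assms by (auto simp: plateau_def)

lemma plateau_ends: "a \<le> b \<Longrightarrow> plateau L a b a = 0" "a \<le> b \<Longrightarrow> plateau L a b b = 0"
  by (auto simp: plateau_def)

lemma continuous_on_plateau: "continuous_on A (plateau L a b)"
  unfolding plateau_def[abs_def] by (intro continuous_intros)

lemma plateau_has_derivative:
  assumes L: "0 \<le> L" and s: "a < s" "s < b" and ex: "s \<notin> {a + 1 / L, b - 1 / L, (a + b) / 2}"
  shows "(plateau L a b has_real_derivative plateau_deriv L a b s) (at s)"
proof (cases "L = 0")
  case True
  then show ?thesis by (simp add: plateau_def[abs_def] plateau_deriv_def)
next
  case False
  then have L: "0 < L" using L by simp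
  have ne: "s - a \<noteq> b - s" "L * (s - a) \<noteq> 1" "L * (b - s) \<noteq> 1"
    using ex L by (auto simp: field_simps)
  \<comment> \<open>It suffices to find the branch \<open>f\<close> that is active in a neighbourhood \<open>U\<close> of \<open>s\<close>.\<close>
  have branch: "(plateau L a b has_real_derivative plateau_deriv L a b s) (at s)"
    if "plateau_deriv L a b s = d" "(f has_real_derivative d) (at s)" "open U" "s \<in> U"
      "\<And>t. t \<in> U \<Longrightarrow> f t = plateau L a b t" for f d U
    unfolding that(1) using that(2-) by (rule has_field_derivative_transform_within_open)
  note [simp] = plateau_deriv_def plateau_def
  note [intro!] = derivative_eq_intros open_Collect_conj open_Collect_less continuous_intros
  consider "s - a < b - s" "L * (s - a) < 1" | "s - a < b - s" "1 < L * (s - a)"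
    | "b - s < s - a" "L * (b - s) < 1" | "b - s < s - a" "1 < L * (b - s)"
    using ne by linarith
  then show ?thesis
  proof cases
    case 1
    then show ?thesis
      using L s by (intro branch[of L "\<lambda>t. L * (t - a)" "{t. t - a < b - t \<and> L * (t - a) < 1}"]) auto
  next
    case 2
    then show ?thesis
      using L s by (intro branch[of 0 "\<lambda>t. 1" "{t. t - a < b - t \<and> 1 < L * (t - a)}"]) auto
  next
    case 3
    then show ?thesis
      using L s by (intro branch[of "- L" "\<lambda>t. L * (b - t)" "{t. b - t < t - a \<and> L * (b - t) < 1}"]) auto
  next
    case 4
    then show ?thesis
      using L s by (intro branch[of 0 "\<lambda>t. 1" "{t. b - t < t - a \<and> 1 < L * (b - t)}"]) auto
  qed
qed

text \<open>
  The path \<open>s \<mapsto> (s, c s x)\<close> stays in \<open>D\<close> since \<open>D\<close> is star-shaped about the origin, so \<open>\<phi>\<close> can be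
  differentiated along it even if \<open>x\<close> lies on the boundary of \<open>D\<close>. The finite exceptional set \<open>S\<close> allows for
  the kinks of the contraction profile.
\<close>

lemma has_integral_C1c_test_along_ray:
  assumes test: "C1c_test T D \<phi> p g" and D: "closed D" "convex D" "0 \<in> D" and x: "x \<in> D"
    and ab: "0 \<le> a" "a \<le> b" "b \<le> T"
    and c: "continuous_on {a..b} c" "\<And>s. s \<in> {a..b} \<Longrightarrow> 0 \<le> c s \<and> c s \<le> 1"
    and S: "finite S" "\<And>s. s \<in> {a<..<b} - S \<Longrightarrow> (c has_real_derivative c' s) (at s)"
  shows "((\<lambda>s. p (s, c s *\<^sub>R x) + g (s, c s *\<^sub>R x) \<bullet> (c' s *\<^sub>R x)) has_integral
    \<phi> (b, c b *\<^sub>R x) - \<phi> (a, c a *\<^sub>R x)) {a..b}"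
proof -
  have inD: "c s *\<^sub>R x \<in> D" if "s \<in> {a..b}" for s
  proof -
    have "c s *\<^sub>R x + (1 - c s) *\<^sub>R 0 \<in> D"
      using D x c(2)[OF that] by (intro convexD) auto
    then show ?thesis by simp
  qed
  let ?F = "\<lambda>s. \<phi> (s, c s *\<^sub>R x)"
  let ?F' = "\<lambda>s. p (s, c s *\<^sub>R x) + g (s, c s *\<^sub>R x) \<bullet> (c' s *\<^sub>R x)"
  have "(?F' has_integral ?F b - ?F a) {a..b}"
  proof (rule fundamental_theorem_of_calculus_interior_strong[OF S(1) ab(2), of ?F ?F'])
    show "continuous_on {a..b} (\<lambda>s. \<phi> (s, c s *\<^sub>R x))"
    proof (rule continuous_on_compose2[OF C1c_test_regularity(1)[OF test D(1)]])
      show "continuous_on {a..b} (\<lambda>s. (s, c s *\<^sub>R x))"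
        by (intro continuous_intros c)
    qed (use inD ab in auto)
  next
    fix s assume s: "s \<in> {a<..<b} - S"
    let ?f = "\<lambda>s. (s, c s *\<^sub>R x)"
    have "(*) (c' s) = (\<lambda>h. h * c' s)" by (simp add: fun_eq_iff)
    then have dc: "(c has_derivative (\<lambda>h. h * c' s)) (at s)"
      using S(2)[OF s] by (simp add: has_field_derivative_def)
    have f: "(?f has_derivative (\<lambda>h. (h, (h * c' s) *\<^sub>R x))) (at s within {a<..<b})"
      by (intro has_derivative_Pair has_derivative_ident has_derivative_scaleR_left has_derivative_at_withinI[OF dc])
    have "?f s \<in> {0<..<T} \<times> D" using s ab inD[of s] by auto
    then have "(\<phi> has_derivative (\<lambda>(h, y). p (?f s) * h + g (?f s) \<bullet> y)) (at (?f s) within {0<..<T} \<times> D)"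
      using test unfolding C1c_test_def by blast
    then have "(\<phi> has_derivative (\<lambda>(h, y). p (?f s) * h + g (?f s) \<bullet> y)) (at (?f s) within ?f ` {a<..<b})"
    proof (rule has_derivative_subset, intro image_subsetI)
      fix u assume "u \<in> {a<..<b}"
      then show "?f u \<in> {0<..<T} \<times> D" using inD[of u] ab by auto
    qed
    from diff_chain_within[OF f this]
    have "((\<lambda>s. \<phi> (?f s)) has_derivative (\<lambda>h. p (?f s) * h + g (?f s) \<bullet> ((h * c' s) *\<^sub>R x))) (at s within {a<..<b})"
      by (simp add: o_def)
    moreover have "at s within {a<..<b} = at s" using s by (intro at_within_open) auto
    ultimately have d: "((\<lambda>s. \<phi> (?f s)) has_derivative (\<lambda>h. p (?f s) * h + g (?f s) \<bullet> ((h * c' s) *\<^sub>R x))) (at s)"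
      by (simp only:)
    have "(\<lambda>h. p (?f s) * h + g (?f s) \<bullet> ((h * c' s) *\<^sub>R x))
        = (\<lambda>h. h *\<^sub>R (p (?f s) + g (?f s) \<bullet> (c' s *\<^sub>R x)))"
      by (simp add: fun_eq_iff distrib_left mult.commute)
    with d show "((\<lambda>s. \<phi> (?f s)) has_vector_derivative p (?f s) + g (?f s) \<bullet> (c' s *\<^sub>R x)) (at s)"
      by (simp only: has_vector_derivative_def)
  qed
  then show ?thesis .
qed

section \<open>Shrunk cell averages\<close>

text \<open>
  The last assumption expresses that almost every \<open>\<rho>\<^sub>t\<close> has mass \<open>m\<close>.
\<close>

locale cell_average =
  fixes T L m r :: real and N :: nat and D :: "(real^3) set" and \<rho> :: "(real \<times> (real^3)) measure"
  assumes T: "0 < T" and N: "0 < N" and L: "0 \<le> L" and m: "0 \<le> m"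
    and D: "compact D" "convex D" "0 \<in> D" and r: "\<And>x. x \<in> D \<Longrightarrow> norm x \<le> r"
    and \<rho>: "\<rho> \<in> radon_nonneg ({0..T} \<times> D)"
    and time_marginal: "\<And>C. C \<in> sets borel \<Longrightarrow> emeasure \<rho> (C \<times> UNIV) = ennreal m * emeasure lborel ({0..T} \<inter> C)"
begin

abbreviation k :: "real \<Rightarrow> nat" where "k \<equiv> cell_index T N"

text \<open>
  For fixed \<open>s\<close>, this is, on \<open>[0,T]\<close>, the density of the uniform distribution on the cell of \<open>s\<close>.
\<close>

definition w :: "real \<Rightarrow> real \<Rightarrow> real" where
  "w s t = (if k s = k t then real N / T else 0)"

definition lam :: "real \<Rightarrow> real" where
  "lam s = plateau L (node T N (k s)) (node T N (Suc (k s))) s"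

definition dlam :: "real \<Rightarrow> real" where
  "dlam s = plateau_deriv L (node T N (k s)) (node T N (Suc (k s))) s"

definition place :: "real \<times> (real \<times> (real^3)) \<Rightarrow> real \<times> (real^3)" where
  "place q = (fst q, lam (fst q) *\<^sub>R snd (snd q))"

definition W :: "real \<times> (real \<times> (real^3)) \<Rightarrow> real" where
  "W q = indicator {0..T} (fst q) * w (fst q) (fst (snd q))"

text \<open>
  Up to normalisation, \<open>Q\<close> is the law of \<open>(s, (t, x))\<close> where \<open>(t, x)\<close> has law \<open>\<rho>\<close> and \<open>s\<close> is uniformly
  distributed in the cell of \<open>t\<close>. The approximation and its coupling with \<open>\<rho>\<close> are images
  of \<open>Q\<close>, and the disintegration of the former consists of the images of the sections of \<open>Q\<close> at fixed \<open>s\<close>.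
  As \<open>s\<close> and \<open>t\<close> enter the kernel symmetrically, integrating out
  \<open>(t, x)\<close> leaves \<open>m\<close> times Lebesgue measure on \<open>[0,T]\<close>, and integrating out \<open>s\<close> leaves \<open>\<rho>\<close>.
\<close>

definition Q :: "(real \<times> (real \<times> (real^3))) measure" where
  "Q = density (lborel \<Otimes>\<^sub>M \<rho>) (\<lambda>q. ennreal (W q))"

text \<open>
  The average of \<open>\<rho>\<^sub>t\<close> over the cell of \<open>s\<close>, contracted by the factor \<open>lam s\<close>.
\<close>

definition R :: "real \<Rightarrow> (real^3) measure" where
  "R s = distr (density \<rho> (\<lambda>z. ennreal (w s (fst z)))) borel (\<lambda>z. lam s *\<^sub>R snd z)"

definition mu :: "(real \<times> (real^3)) measure" where
  "mu = distr Q borel place"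

lemma sets_rho [measurable_cong]: "sets \<rho> = sets borel"
  and finite_rho: "finite_measure \<rho>"
  and null_rho: "emeasure \<rho> (- ({0..T} \<times> D)) = 0"
  using \<rho> by (auto simp: radon_nonneg_def)

lemma space_rho [simp]: "space \<rho> = UNIV"
  using sets_eq_imp_space_eq[OF sets_rho] by simp

sublocale rho: finite_measure \<rho> by (rule finite_rho)
sublocale P: pair_sigma_finite lborel \<rho> ..

lemma closed_D: "closed D" using D by (simp add: compact_imp_closed)

lemma D_borel [measurable]: "D \<in> sets borel" using closed_D by simp

lemma cylinder_borel: "{0..T} \<times> D \<in> sets borel"
  by (intro borel_Times D_borel) simp

lemma AE_rho: "AE z in \<rho>. fst z \<in> {0..T} \<and> snd z \<in> D"
  using AE_mem_of_null_Compl[OF sets_rho cylinder_borel null_rho] by eventually_elim auto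

lemma measurable_node_k [measurable]:
  "(\<lambda>s. node T N (k s)) \<in> borel_measurable borel" "(\<lambda>s. node T N (Suc (k s))) \<in> borel_measurable borel"
  "(\<lambda>s. real (k s)) \<in> borel_measurable borel"
  by (rule measurable_compose[OF measurable_cell_index], simp)+

lemma measurable_lam [measurable]: "lam \<in> borel_measurable borel" "dlam \<in> borel_measurable borel"
  unfolding lam_def[abs_def] dlam_def[abs_def] plateau_deriv_def plateau_def by measurable

lemma measurable_w [measurable]: "w s \<in> borel_measurable borel"
proof -
  have "w s = (\<lambda>t. if real (k s) = real (k t) then real N / T else 0)" by (auto simp: w_def)
  also have "\<dots> \<in> borel_measurable borel" by measurable
  finally show ?thesis .
qed

lemma measurable_W [measurable]: "W \<in> borel_measurable borel"
proof -
  have "W = (\<lambda>q. indicator {0..T} (fst q) * (if real (k (fst q)) = real (k (fst (snd q))) then real N / T else 0))"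
    by (auto simp: W_def w_def fun_eq_iff)
  also have "\<dots> \<in> borel_measurable borel" by measurable
  finally show ?thesis .
qed

lemma measurable_place [measurable]: "place \<in> borel_measurable borel"
  unfolding place_def[abs_def] by measurable

lemma w_nonneg: "0 \<le> w s t"
  using T N by (auto simp: w_def)

lemma W_nonneg: "0 \<le> W q"
  using w_nonneg by (simp add: W_def)

lemma W_pair: "W (s, z) = indicator {0..T} s * w s (fst z)"
  by (simp add: W_def)

lemma sets_prod: "sets (lborel \<Otimes>\<^sub>M \<rho>) = sets borel"
proof -
  have "sets (lborel \<Otimes>\<^sub>M \<rho>) = sets (borel \<Otimes>\<^sub>M borel)"
    by (rule sets_pair_measure_cong[OF sets_lborel sets_rho])
  then show ?thesis by (simp only: borel_prod)
qed

lemma sets_Q [measurable_cong]: "sets Q = sets borel"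
  unfolding Q_def sets_density by (rule sets_prod)

lemma space_Q [simp]: "space Q = UNIV"
  using sets_eq_imp_space_eq[OF sets_Q] by simp

lemma borel_prod_iff: "f \<in> borel_measurable borel \<Longrightarrow> f \<in> borel_measurable (lborel \<Otimes>\<^sub>M \<rho>)"
  by (simp add: measurable_cong_sets[OF sets_prod refl])

lemma nn_integral_Q:
  assumes [measurable]: "f \<in> borel_measurable borel"
  shows "(\<integral>\<^sup>+ q. f q \<partial>Q) = (\<integral>\<^sup>+ s. \<integral>\<^sup>+ z. ennreal (W (s, z)) * f (s, z) \<partial>\<rho> \<partial>lborel)"
    and "(\<integral>\<^sup>+ q. f q \<partial>Q) = (\<integral>\<^sup>+ z. \<integral>\<^sup>+ s. ennreal (W (s, z)) * f (s, z) \<partial>lborel \<partial>\<rho>)"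
proof -
  have m: "(\<lambda>q. ennreal (W q) * f q) \<in> borel_measurable (lborel \<Otimes>\<^sub>M \<rho>)"
    by (rule borel_prod_iff) measurable
  have "(\<integral>\<^sup>+ q. f q \<partial>Q) = (\<integral>\<^sup>+ q. ennreal (W q) * f q \<partial>(lborel \<Otimes>\<^sub>M \<rho>))"
    unfolding Q_def by (rule nn_integral_density) (auto intro!: borel_prod_iff)
  then show "(\<integral>\<^sup>+ q. f q \<partial>Q) = (\<integral>\<^sup>+ s. \<integral>\<^sup>+ z. ennreal (W (s, z)) * f (s, z) \<partial>\<rho> \<partial>lborel)"
    and "(\<integral>\<^sup>+ q. f q \<partial>Q) = (\<integral>\<^sup>+ z. \<integral>\<^sup>+ s. ennreal (W (s, z)) * f (s, z) \<partial>lborel \<partial>\<rho>)"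
    using rho.nn_integral_fst[OF m] P.nn_integral_snd[OF m] by simp_all
qed

lemma nn_integral_w_rho:
  assumes s: "s \<in> {0..T}"
  shows "(\<integral>\<^sup>+ z. ennreal (w s (fst z)) \<partial>\<rho>) = ennreal m"
proof -
  define C where "C = {t \<in> {0..T}. k t = k s}"
  have C: "C \<in> sets borel" unfolding C_def by measurable
  have "(\<integral>\<^sup>+ z. ennreal (w s (fst z)) \<partial>\<rho>) = (\<integral>\<^sup>+ z. ennreal (real N / T) * indicator (C \<times> UNIV) z \<partial>\<rho>)"
    using AE_rho by (intro nn_integral_cong_AE, eventually_elim) (auto simp: w_def C_def indicator_def)
  also have "\<dots> = ennreal (real N / T) * emeasure \<rho> (C \<times> UNIV)"
    using borel_Times[OF C, of UNIV] sets_rho by (intro nn_integral_cmult_indicator) auto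
  also have "emeasure \<rho> (C \<times> UNIV) = ennreal m * ennreal (T / real N)"
  proof -
    have "{0..T} \<inter> C = {t \<in> {0..T}. k t = k s}" by (auto simp: C_def)
    then show ?thesis
      using time_marginal[OF C] emeasure_cell[OF T N cell_index_bounds(1)[OF T N s]] by simp
  qed
  also have "ennreal (real N / T) * (ennreal m * ennreal (T / real N)) = ennreal m"
    using T N m by (simp add: ennreal_mult[symmetric])
  finally show ?thesis .
qed

lemma nn_integral_W_time:
  assumes t: "fst z \<in> {0..T}"
  shows "(\<integral>\<^sup>+ s. ennreal (W (s, z)) \<partial>lborel) = 1"
proof -
  have "W (s, z) = cell_kernel T N (fst z) s" for s
    using t by (auto simp: W_def w_def cell_kernel_def indicator_def)
  then show ?thesis using t nn_integral_cell_kernel[OF T N, of "fst z"] by simp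
qed

lemma nn_integral_Q_time:
  assumes [measurable]: "f \<in> borel_measurable borel"
  shows "(\<integral>\<^sup>+ q. f (fst q) \<partial>Q) = ennreal m * (\<integral>\<^sup>+ s\<in>{0..T}. f s \<partial>lborel)"
proof -
  have "(\<integral>\<^sup>+ q. f (fst q) \<partial>Q) = (\<integral>\<^sup>+ s. \<integral>\<^sup>+ z. ennreal (W (s, z)) * f s \<partial>\<rho> \<partial>lborel)"
    by (subst nn_integral_Q(1)) auto
  also have "\<dots> = (\<integral>\<^sup>+ s. ennreal m * (f s * indicator {0..T} s) \<partial>lborel)"
  proof (rule nn_integral_cong)
    fix s
    show "(\<integral>\<^sup>+ z. ennreal (W (s, z)) * f s \<partial>\<rho>) = ennreal m * (f s * indicator {0..T} s)"
    proof (cases "s \<in> {0..T}")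
      case True
      then have "(\<integral>\<^sup>+ z. ennreal (W (s, z)) * f s \<partial>\<rho>) = (\<integral>\<^sup>+ z. ennreal (w s (fst z)) \<partial>\<rho>) * f s"
        by (simp add: W_pair nn_integral_multc)
      then show ?thesis using True nn_integral_w_rho[OF True] by simp
    qed (simp add: W_pair)
  qed
  also have "\<dots> = ennreal m * (\<integral>\<^sup>+ s\<in>{0..T}. f s \<partial>lborel)"
    by (intro nn_integral_cmult) measurable
  finally show ?thesis .
qed

lemma emeasure_Q_UNIV: "emeasure Q UNIV = ennreal (m * T)"
proof -
  have "emeasure Q UNIV = (\<integral>\<^sup>+ q. 1 \<partial>Q)" by simp
  also have "\<dots> = ennreal m * (\<integral>\<^sup>+ s\<in>{0..T}. 1 \<partial>lborel)"
    using nn_integral_Q_time[of "\<lambda>_. 1"] by simp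
  also have "\<dots> = ennreal (m * T)" using T m by (simp add: ennreal_mult)
  finally show ?thesis .
qed

sublocale Q: finite_measure Q
  by (rule finite_measureI) (simp add: emeasure_Q_UNIV)

lemma distr_Q_snd: "distr Q borel snd = \<rho>"
proof (rule measure_eqI)
  fix A assume "A \<in> sets (distr Q borel snd)"
  then have A [measurable]: "A \<in> sets borel" by simp
  have "emeasure (distr Q borel snd) A = (\<integral>\<^sup>+ q. indicator A (snd q) \<partial>Q)"
    by (subst nn_integral_indicator[symmetric], simp, subst nn_integral_distr) auto
  also have "\<dots> = (\<integral>\<^sup>+ z. \<integral>\<^sup>+ s. ennreal (W (s, z)) * indicator A z \<partial>lborel \<partial>\<rho>)"
    by (subst nn_integral_Q(2)) auto
  also have "\<dots> = (\<integral>\<^sup>+ z. indicator A z \<partial>\<rho>)"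
    using AE_rho
    by (intro nn_integral_cong_AE, eventually_elim) (simp add: nn_integral_multc nn_integral_W_time)
  also have "\<dots> = emeasure \<rho> A"
    using A sets_rho by simp
  finally show "emeasure (distr Q borel snd) A = emeasure \<rho> A" .
qed (simp add: sets_rho)

lemma AE_Q: "AE q in Q. fst q \<in> {0..T} \<and> fst (snd q) \<in> {0..T} \<and> k (fst q) = k (fst (snd q)) \<and> snd (snd q) \<in> D"
proof -
  have "AE z in distr Q borel snd. fst z \<in> {0..T} \<and> snd z \<in> D"
    unfolding distr_Q_snd by (rule AE_rho)
  then have "AE q in Q. fst (snd q) \<in> {0..T} \<and> snd (snd q) \<in> D"
    by (subst (asm) AE_distr_iff) auto
  moreover have "AE q in Q. 0 < W q"
    unfolding Q_def using borel_prod_iff[OF measurable_W] by (subst AE_density) auto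
  ultimately show ?thesis
    by eventually_elim (auto simp: W_def w_def split: split_indicator_asm if_splits)
qed

lemma lam_bounds:
  assumes "s \<in> {0..T}"
  shows "0 \<le> lam s" "lam s \<le> 1"
  unfolding lam_def using cell_index_bounds[OF T N assms] L by (auto intro: plateau_bounds)

lemma scale_in_D: "x \<in> D \<Longrightarrow> 0 \<le> c \<Longrightarrow> c \<le> 1 \<Longrightarrow> c *\<^sub>R x \<in> D"
  using convexD[OF D(2) _ D(3), of x c "1 - c"] by simp

lemma nn_integral_R:
  assumes [measurable]: "f \<in> borel_measurable borel"
  shows "(\<integral>\<^sup>+ x. f x \<partial>R s) = (\<integral>\<^sup>+ z. ennreal (w s (fst z)) * f (lam s *\<^sub>R snd z) \<partial>\<rho>)"
  unfolding R_def by (subst nn_integral_distr, simp, simp, subst nn_integral_density) auto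

lemma LINT_R:
  fixes f :: "real^3 \<Rightarrow> 'b::{banach, second_countable_topology}"
  assumes [measurable]: "f \<in> borel_measurable borel"
  shows "(LINT x|R s. f x) = (LINT z|\<rho>. w s (fst z) *\<^sub>R f (lam s *\<^sub>R snd z))"
  unfolding R_def by (subst integral_distr, simp, simp, subst integral_density) (auto simp: w_nonneg)

lemma sets_R [measurable_cong]: "sets (R s) = sets borel"
  by (simp add: R_def)

lemma space_R [simp]: "space (R s) = UNIV"
  by (simp add: R_def)

lemma emeasure_R:
  assumes "B \<in> sets borel"
  shows "emeasure (R s) B = (\<integral>\<^sup>+ z. ennreal (w s (fst z)) * indicator B (lam s *\<^sub>R snd z) \<partial>\<rho>)"
  using nn_integral_R[of "indicator B" s] assms by simp

lemma emeasure_R_UNIV: "s \<in> {0..T} \<Longrightarrow> emeasure (R s) UNIV = ennreal m"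
  using nn_integral_w_rho by (simp add: emeasure_R)

lemma finite_R: "s \<in> {0..T} \<Longrightarrow> finite_measure (R s)"
  by (rule finite_measureI) (simp add: emeasure_R_UNIV)

lemma R_radon: 
  assumes s: "s \<in> {0..T}"
  shows "R s \<in> radon_nonneg D"
proof -
  have "emeasure (R s) (- D) = (\<integral>\<^sup>+ z. 0 \<partial>\<rho>)"
    unfolding emeasure_R[OF borel_comp[OF D_borel]]
  proof (rule nn_integral_cong_AE)
    show "AE z in \<rho>. ennreal (w s (fst z)) * indicator (- D) (lam s *\<^sub>R snd z) = 0"
      using AE_rho by eventually_elim (simp add: scale_in_D lam_bounds[OF s])
  qed
  then show ?thesis
    using finite_R[OF s] sets_R by (simp add: radon_nonneg_def)
qed

lemma sets_mu [measurable_cong]: "sets mu = sets borel"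
  by (simp add: mu_def)

lemma emeasure_mu_UNIV: "emeasure mu UNIV = ennreal (m * T)"
  unfolding mu_def by (subst emeasure_distr) (auto simp: emeasure_Q_UNIV)

sublocale mu: finite_measure mu
  using sets_eq_imp_space_eq[OF sets_mu] by (intro finite_measureI) (simp add: emeasure_mu_UNIV)

lemma measure_mu_UNIV: "measure mu UNIV = m * T"
  using emeasure_mu_UNIV m T by (simp add: measure_def)

lemma AE_mu: "AE z in mu. z \<in> {0..T} \<times> D"
proof -
  have "AE q in Q. place q \<in> {0..T} \<times> D"
    using AE_Q by eventually_elim (auto simp: place_def intro!: scale_in_D lam_bounds)
  then show ?thesis
    unfolding mu_def using cylinder_borel by (subst AE_distr_iff) auto
qed

lemma mu_radon: "mu \<in> radon_nonneg ({0..T} \<times> D)"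
proof -
  have "emeasure mu (- ({0..T} \<times> D)) = 0"
  proof -
    have "emeasure mu {z \<in> space mu. z \<notin> {0..T} \<times> D} = 0"
      by (rule emeasure_eq_0_AE) (use AE_mu in simp)
    moreover have "{z \<in> space mu. z \<notin> {0..T} \<times> D} = - ({0..T} \<times> D)"
      using sets_eq_imp_space_eq[OF sets_mu] by auto
    ultimately show ?thesis by simp
  qed
  then show ?thesis using sets_mu mu.finite_measure_axioms by (simp add: radon_nonneg_def)
qed

text \<open>
  This is Fubini's theorem for \<open>Q\<close>, which also supplies the measurability in time.
\<close>

lemma mu_disintegrates: "disintegrates T D mu R"
  unfolding disintegrates_def
proof (intro conjI ballI)
  fix B :: "(real^3) set" assume B [measurable]: "B \<in> sets borel"
  have "(\<lambda>q. ennreal (w (fst q) (fst (snd q))) * indicator B (lam (fst q) *\<^sub>R snd (snd q))) \<in> borel_measurable borel"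
  proof -
    have "(\<lambda>q. ennreal (w (fst q) (fst (snd q))) * indicator B (lam (fst q) *\<^sub>R snd (snd q)))
      = (\<lambda>q. ennreal (if real (k (fst q)) = real (k (fst (snd q))) then real N / T else 0) * indicator B (lam (fst q) *\<^sub>R snd (snd q)))"
      by (auto simp: w_def)
    also have "\<dots> \<in> borel_measurable borel" by measurable
    finally show ?thesis .
  qed
  from rho.borel_measurable_nn_integral_fst[OF borel_prod_iff[OF this]]
  have "(\<lambda>t. emeasure (R t) B) \<in> borel_measurable borel"
    by (simp add: emeasure_R)
  then show "(\<lambda>t. emeasure (R t) B) \<in> borel_measurable (restrict_space borel {0..T})"
    by (rule measurable_restrict_space1)
next
  fix A :: "(real \<times> (real^3)) set" assume A [measurable]: "A \<in> sets borel"
  have "emeasure mu A = (\<integral>\<^sup>+ q. indicator A (place q) \<partial>Q)"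
    unfolding mu_def by (subst nn_integral_indicator[symmetric], simp, subst nn_integral_distr) auto
  also have "\<dots> = (\<integral>\<^sup>+ s. \<integral>\<^sup>+ z. ennreal (W (s, z)) * indicator A (place (s, z)) \<partial>\<rho> \<partial>lborel)"
    by (rule nn_integral_Q(1)) measurable
  also have "\<dots> = (\<integral>\<^sup>+ t\<in>{0..T}. emeasure (R t) {x. (t, x) \<in> A} \<partial>lborel)"
  proof (rule nn_integral_cong)
    fix t
    have "{x. (t, x) \<in> A} \<in> sets borel"
      using measurable_sets[of "\<lambda>x. (t, x)" borel borel A] by (auto simp: vimage_def)
    then show "(\<integral>\<^sup>+ z. ennreal (W (t, z)) * indicator A (place (t, z)) \<partial>\<rho>)
        = emeasure (R t) {x. (t, x) \<in> A} * indicator {0..T} t"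
      by (cases "t \<in> {0..T}") (auto simp: emeasure_R W_pair place_def indicator_def intro!: nn_integral_cong)
  qed
  finally show "emeasure mu A = (\<integral>\<^sup>+ t\<in>{0..T}. emeasure (R t) {x. (t, x) \<in> A} \<partial>lborel)" .
qed (rule R_radon)

end

subsection \<open>Velocity and energy\<close>

lemma LINT_in_radon_vec:
  fixes v :: "'a::topological_space \<Rightarrow> 'b::{banach, second_countable_topology}"
  assumes sets: "sets M = sets borel" and v: "integrable M v"
    and X: "X \<in> sets borel" "AE x in M. x \<in> X"
  shows "(\<lambda>A. LINT x:A|M. v x) \<in> radon_vec X"
  unfolding radon_vec_def
proof (intro CollectI conjI allI impI ballI)
  fix A :: "nat \<Rightarrow> 'a set" assume A: "range A \<subseteq> sets borel" "disjoint_family A"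
  have Am: "A i \<in> sets M" for i using A(1) sets by auto
  have si: "set_integrable M B v" if "B \<in> sets M" for B
    unfolding set_integrable_def using that v by (rule integrable_mult_indicator)
  have "(\<lambda>n. LINT x:(\<Union>i<n. A i)|M. v x) \<longlonglongrightarrow> (LINT x:(\<Union>n. \<Union>i<n. A i)|M. v x)"
  proof (rule set_integral_cont_up)
    show "incseq (\<lambda>n. \<Union>i<n. A i)" by (rule incseq_SucI) (force intro: less_SucI)
  qed (use Am in \<open>auto intro!: si\<close>)
  moreover have "(\<Union>n. \<Union>i<n. A i) = (\<Union>i. A i)" by auto
  moreover have "(LINT x:(\<Union>i<n. A i)|M. v x) = (\<Sum>i<n. LINT x:A i|M. v x)" for n
    using A(2) Am si by (intro set_integral_finite_Union) (auto simp: disjoint_family_on_def)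
  ultimately show "(\<lambda>i. LINT x:A i|M. v x) sums (LINT x:(\<Union>i. A i)|M. v x)"
    by (simp add: sums_def)
next
  fix A :: "'a set" assume "A \<in> sets borel" "A \<inter> X = {}"
  then show "(LINT x:A|M. v x) = 0"
    unfolding set_lebesgue_integral_def using X(2)
    by (intro integral_eq_zero_AE) (auto elim!: eventually_mono simp: indicator_def)
qed

context cell_average
begin

lemma r_nonneg: "0 \<le> r" using r[OF D(3)] by simp

lemma integrable_Q:
  fixes f :: "real \<times> (real \<times> (real^3)) \<Rightarrow> 'b::{banach, second_countable_topology}"
  assumes f [measurable]: "f \<in> borel_measurable borel" and bd: "\<And>q. norm (f q) \<le> C"
  shows "integrable (lborel \<Otimes>\<^sub>M \<rho>) (\<lambda>q. W q *\<^sub>R f q)"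
proof -
  have "integrable Q f"
    using bd by (intro Q.integrable_const_bound[of _ C]) auto
  then show ?thesis
    unfolding Q_def
    by (subst (asm) integrable_density) (auto intro!: borel_prod_iff simp: W_nonneg)
qed

lemma LINT_Q:
  fixes f :: "real \<times> (real \<times> (real^3)) \<Rightarrow> 'b::{banach, second_countable_topology}"
  assumes f [measurable]: "f \<in> borel_measurable borel" and bd: "\<And>q. norm (f q) \<le> C"
  shows "(LINT q|Q. f q) = (LINT s|lborel. LINT z|\<rho>. W (s, z) *\<^sub>R f (s, z))"
    and "(LINT q|Q. f q) = (LINT z|\<rho>. LINT s|lborel. W (s, z) *\<^sub>R f (s, z))"
    and "set_integrable lborel {0..T} (\<lambda>s. LINT z|\<rho>. w s (fst z) *\<^sub>R f (s, z))"
    and "(LINT q|Q. f q) = (LINT s:{0..T}|lborel. LINT z|\<rho>. w s (fst z) *\<^sub>R f (s, z))"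
proof -
  have int: "integrable (lborel \<Otimes>\<^sub>M \<rho>) (\<lambda>(s, z). W (s, z) *\<^sub>R f (s, z))"
    using integrable_Q[OF f bd] by (simp add: case_prod_unfold)
  have eq: "(LINT q|Q. f q) = (LINT q|(lborel \<Otimes>\<^sub>M \<rho>). (case q of (s, z) \<Rightarrow> W (s, z) *\<^sub>R f (s, z)))"
    unfolding Q_def
    by (subst integral_density) (auto intro!: borel_prod_iff simp: W_nonneg case_prod_unfold)
  show *: "(LINT q|Q. f q) = (LINT s|lborel. LINT z|\<rho>. W (s, z) *\<^sub>R f (s, z))"
    unfolding eq P.integral_fst[OF int] ..
  show "(LINT q|Q. f q) = (LINT z|\<rho>. LINT s|lborel. W (s, z) *\<^sub>R f (s, z))"
    unfolding eq P.integral_snd[OF int] ..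
  have W: "(LINT z|\<rho>. W (s, z) *\<^sub>R f (s, z)) = indicator {0..T} s *\<^sub>R (LINT z|\<rho>. w s (fst z) *\<^sub>R f (s, z))" for s
    by (cases "s \<in> {0..T}") (simp_all add: W_pair)
  show "set_integrable lborel {0..T} (\<lambda>s. LINT z|\<rho>. w s (fst z) *\<^sub>R f (s, z))"
    using P.integrable_fst[OF int] unfolding W set_integrable_def .
  show "(LINT q|Q. f q) = (LINT s:{0..T}|lborel. LINT z|\<rho>. w s (fst z) *\<^sub>R f (s, z))"
    unfolding * W set_lebesgue_integral_def ..
qed

lemma LINT_w_rho: "s \<in> {0..T} \<Longrightarrow> (LINT z|\<rho>. w s (fst z)) = m"
  using nn_integral_w_rho[of s] m w_nonneg
  by (subst integral_eq_nn_integral) auto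

lemma LINT_mu:
  fixes f :: "real \<times> (real^3) \<Rightarrow> 'b::{banach, second_countable_topology}"
  assumes [measurable]: "f \<in> borel_measurable borel"
  shows "(LINT z|mu. f z) = (LINT q|Q. f (place q))"
  unfolding mu_def by (subst integral_distr) auto

text \<open>
  The Eulerian velocity: at time \<open>t\<close>, the point \<open>y\<close> is occupied by the particle of \<open>D\<close> labelled
  \<open>x = y / lam t\<close>, which moves with velocity \<open>dlam t\<close> times \<open>x\<close>. Off the occupied points this quotient is
  unbounded; the cut-off at \<open>L r\<close>, the maximal speed of the particles, makes the field bounded everywhere.
\<close>

definition vel :: "real \<times> (real^3) \<Rightarrow> real^3" where
  "vel z = (let u = (dlam (fst z) / lam (fst z)) *\<^sub>R snd z in if norm u \<le> L * r then u else 0)"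

definition momentum :: "(real \<times> (real^3)) set \<Rightarrow> real^3" where
  "momentum A = (LINT z:A|mu. vel z)"

definition momentum_at :: "real \<Rightarrow> (real^3) set \<Rightarrow> real^3" where
  "momentum_at t A = (LINT x:A|R t. vel (t, x))"

lemma measurable_vel [measurable]: "vel \<in> borel_measurable borel"
  unfolding vel_def[abs_def] Let_def by measurable

lemma norm_vel: "norm (vel z) \<le> L * r"
  using L r_nonneg by (auto simp: vel_def Let_def)

lemma vel_place:
  assumes x: "snd (snd q) \<in> D"
  shows "vel (place q) = dlam (fst q) *\<^sub>R snd (snd q)"
proof -
  have d: "lam s = 0 \<Longrightarrow> dlam s = 0" for s
    unfolding lam_def dlam_def plateau_deriv_def by simp
  have "\<bar>dlam s\<bar> \<le> L" for s
    unfolding dlam_def plateau_deriv_def using L by auto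
  then have "norm (dlam (fst q) *\<^sub>R snd (snd q)) \<le> L * r"
    using r[OF x] L by (simp add: mult_mono)
  moreover have "(dlam (fst q) / lam (fst q)) *\<^sub>R lam (fst q) *\<^sub>R snd (snd q) = dlam (fst q) *\<^sub>R snd (snd q)"
    using d[of "fst q"] by (cases "lam (fst q) = 0") auto
  ultimately show ?thesis
    by (simp only: vel_def place_def Let_def fst_conv snd_conv if_True)
qed

lemma integrable_vel: "integrable mu vel"
  using norm_vel by (intro mu.integrable_const_bound[of _ "L * r"]) auto

lemma momentum_radon_vec: "momentum \<in> radon_vec ({0..T} \<times> UNIV)"
  unfolding momentum_def[abs_def]
  using AE_mu by (intro LINT_in_radon_vec[OF sets_mu integrable_vel]) (auto intro!: borel_Times elim!: eventually_mono)

lemma momentum_at_radon_vec: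
  assumes t: "t \<in> {0..T}"
  shows "momentum_at t \<in> radon_vec UNIV"
  unfolding momentum_at_def[abs_def]
proof (rule LINT_in_radon_vec[OF sets_R])
  show "integrable (R t) (\<lambda>x. vel (t, x))"
    using norm_vel by (intro finite_measure.integrable_const_bound[OF finite_R[OF t], of _ "L * r"]) auto
qed auto

lemma momentum_disintegrates: "disintegrates_vec T momentum momentum_at"
  unfolding disintegrates_vec_def
proof (intro conjI ballI)
  fix A :: "(real \<times> (real^3)) set" assume A [measurable]: "A \<in> sets borel"
  define F where "F = (\<lambda>q. indicator A (place q) *\<^sub>R vel (place q))"
  have F [measurable]: "F \<in> borel_measurable borel" unfolding F_def by measurable
  have bd: "norm (F q) \<le> L * r" for q
    using norm_vel[of "place q"] L r_nonneg by (auto simp: F_def indicator_def)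
  have At: "momentum_at t {x. (t, x) \<in> A} = (LINT z|\<rho>. w t (fst z) *\<^sub>R F (t, z))" for t
  proof -
    have "momentum_at t {x. (t, x) \<in> A} = (LINT x|R t. indicator A (t, x) *\<^sub>R vel (t, x))"
      unfolding momentum_at_def set_lebesgue_integral_def
      by (intro Bochner_Integration.integral_cong) (auto simp: indicator_def)
    also have "\<dots> = (LINT z|\<rho>. w t (fst z) *\<^sub>R F (t, z))"
      by (subst LINT_R) (auto simp: F_def place_def)
    finally show ?thesis .
  qed
  show "set_integrable lborel {0..T} (\<lambda>t. momentum_at t {x. (t, x) \<in> A})"
    unfolding At by (rule LINT_Q(3)[OF F bd])
  have "momentum A = (LINT q|Q. F q)"
    unfolding momentum_def set_lebesgue_integral_def F_def by (rule LINT_mu) measurable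
  also have "\<dots> = (LINT t:{0..T}|lborel. momentum_at t {x. (t, x) \<in> A})"
    unfolding At by (rule LINT_Q(4)[OF F bd])
  finally show "momentum A = (LINT t:{0..T}|lborel. momentum_at t {x. (t, x) \<in> A})" .
qed (rule momentum_at_radon_vec)

text \<open>
  Against \<open>W\<close>, the times in the cell of \<open>fst z\<close> carry the weight \<open>N / T\<close> and all other times carry none.
  The functions \<open>f\<close> and \<open>F\<close> are compared on the open cell since \<^const>\<open>cell_index\<close> jumps at its ends.
\<close>

lemma LINT_cell:
  fixes f :: "real \<Rightarrow> real"
  assumes z: "fst z \<in> {0..T}" and f [measurable]: "f \<in> borel_measurable borel" and bd: "\<And>s. \<bar>f s\<bar> \<le> C"
    and F: "(F has_integral I) {node T N (k (fst z))..node T N (Suc (k (fst z)))}"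
    and fF: "\<And>s. s \<in> {node T N (k (fst z))<..<node T N (Suc (k (fst z)))} \<Longrightarrow> f s = F s"
  shows "(LINT s|lborel. W (s, z) *\<^sub>R f s) = real N / T * I"
proof -
  let ?a = "node T N (k (fst z))" and ?b = "node T N (Suc (k (fst z)))"
  note kN = cell_index_bounds(1)[OF T N z]
  have fI: "(f has_integral I) {?a..?b}"
    by (rule has_integral_spike_finite[OF _ _ F, of "{?a, ?b}"]) (use fF in auto)
  have si: "set_integrable lborel {?a..?b} f"
  proof -
    have "set_integrable lborel {?a..?b} (\<lambda>_. C)"
      by (rule borel_integrable_atLeastAtMost') (rule continuous_on_const)
    then show ?thesis
      by (rule set_integrable_bound)
        (use bd in \<open>auto simp: set_borel_measurable_def intro!: AE_I2 order_trans[OF _ abs_ge_self]\<close>)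
  qed
  have "(LINT s|lborel. W (s, z) *\<^sub>R f s) = (LINT s|lborel. (real N / T) * (indicator {?a..?b} s * f s))"
  proof (rule integral_cong_AE)
    show "AE s in lborel. W (s, z) *\<^sub>R f s = (real N / T) * (indicator {?a..?b} s * f s)"
      using AE_indicator_cell[OF T N kN]
    proof eventually_elim
      case (elim s)
      have "W (s, z) = (real N / T) * indicator {s \<in> {0..T}. k s = k (fst z)} s"
        by (auto simp: W_def w_def indicator_def)
      then show ?case using elim by simp
    qed
  qed measurable
  also have "\<dots> = (real N / T) * (LINT s:{?a..?b}|lborel. f s)"
    by (simp add: set_lebesgue_integral_def)
  also have "(LINT s:{?a..?b}|lborel. f s) = I"
    using set_borel_integral_eq_integral(2)[OF si] integral_unique[OF fI] by simp
  finally show ?thesis .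
qed

text \<open>
  For fixed \<open>(t, x)\<close>, the integral over \<open>s\<close> in the cell \<open>[a,b]\<close> of \<open>t\<close> is \<open>N / T\<close> times the increment of \<open>\<phi>\<close> along the path
  \<open>s \<mapsto> (s, lam s x)\<close>. Both ends of this path are on the axis \<open>x = 0\<close>, so the increment equals
  that of the path \<open>s \<mapsto> (s, 0)\<close>. Replacing one by the other for all \<open>(t, x)\<close> turns the whole integral into
  \<open>m (\<phi> (T, 0) - \<phi> (0, 0)) = 0\<close>; this does the telescoping without a sum over the cells.
\<close>

lemma momentum_continuity:
  assumes test: "C1c_test T D \<phi> p g"
  shows "(LINT z|mu. p z + g z \<bullet> vel z) = 0"
proof -
  note reg = C1c_test_regularity[OF test closed_D]
  note [measurable] = reg(4,5)
  obtain C where C: "\<And>z. \<bar>p z\<bar> \<le> C" "\<And>z. norm (g z) \<le> C" using reg(6) by blast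
  have C0: "0 \<le> C" using C(2) norm_ge_zero order_trans by blast
  have bd: "\<bar>p z + g z \<bullet> vel z\<bar> \<le> C + C * (L * r)" for z
  proof -
    have "\<bar>g z \<bullet> vel z\<bar> \<le> C * (L * r)"
      by (intro order_trans[OF Cauchy_Schwarz_ineq2] mult_mono C norm_vel C0 norm_ge_zero)
    then show ?thesis using C(1)[of z] by linarith
  qed
  let ?h = "\<lambda>q. p (place q) + g (place q) \<bullet> vel (place q)"
  have "(LINT z|mu. p z + g z \<bullet> vel z) = (LINT q|Q. ?h q)"
    by (rule LINT_mu) measurable
  also have "\<dots> = (LINT z|\<rho>. LINT s|lborel. W (s, z) *\<^sub>R ?h (s, z))"
    by (rule LINT_Q(2)[where C = "C + C * (L * r)"]) (use bd in simp_all)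
  also have "\<dots> = (LINT z|\<rho>. LINT s|lborel. W (s, z) *\<^sub>R p (s, 0))"
  proof (rule integral_cong_AE)
    show "AE z in \<rho>. (LINT s|lborel. W (s, z) *\<^sub>R ?h (s, z)) = (LINT s|lborel. W (s, z) *\<^sub>R p (s, 0))"
      using AE_rho
    proof eventually_elim
      case (elim z)
      let ?j = "k (fst z)"
      let ?a = "node T N ?j" and ?b = "node T N (Suc ?j)"
      have j: "?j < N" using elim by (intro cell_index_bounds T N) auto
      note ab = node_bounds[OF T N j]
      have cell: "k s = ?j" if "s \<in> {?a<..<?b}" for s
        using cell_index_eqI[OF T N j] that by simp
      have I1: "((\<lambda>s. p (s, plateau L ?a ?b s *\<^sub>R snd z) + g (s, plateau L ?a ?b s *\<^sub>R snd z) \<bullet> (plateau_deriv L ?a ?b s *\<^sub>R snd z))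
        has_integral \<phi> (?b, plateau L ?a ?b ?b *\<^sub>R snd z) - \<phi> (?a, plateau L ?a ?b ?a *\<^sub>R snd z)) {?a..?b}"
        by (rule has_integral_C1c_test_along_ray[OF test closed_D D(2,3), where S = "{?a + 1 / L, ?b - 1 / L, (?a + ?b) / 2}"])
          (use elim ab L in \<open>auto intro!: continuous_on_plateau plateau_has_derivative plateau_bounds\<close>)
      have I2: "((\<lambda>s. p (s, 0 *\<^sub>R snd z) + g (s, 0 *\<^sub>R snd z) \<bullet> (0 *\<^sub>R snd z))
        has_integral \<phi> (?b, 0 *\<^sub>R snd z) - \<phi> (?a, 0 *\<^sub>R snd z)) {?a..?b}"
        by (rule has_integral_C1c_test_along_ray[OF test closed_D D(2,3), where S = "{}"]) (use elim ab in auto)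
      have ends: "plateau L ?a ?b ?a = 0" "plateau L ?a ?b ?b = 0" using ab by (auto intro: plateau_ends)
      have "(LINT s|lborel. W (s, z) *\<^sub>R ?h (s, z)) = real N / T * (\<phi> (?b, 0) - \<phi> (?a, 0))"
      proof (rule LINT_cell[where C = "C + C * (L * r)", OF _ _ _ I1[unfolded ends, simplified]])
        fix s assume s: "s \<in> {?a<..<?b}"
        have "place (s, z) = (s, plateau L ?a ?b s *\<^sub>R snd z)" "dlam s = plateau_deriv L ?a ?b s"
          using cell[OF s] by (simp_all add: place_def lam_def dlam_def)
        then show "?h (s, z) = p (s, plateau L ?a ?b s *\<^sub>R snd z) + plateau_deriv L ?a ?b s * (g (s, plateau L ?a ?b s *\<^sub>R snd z) \<bullet> snd z)"
          using vel_place[of "(s, z)"] elim by simp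
      qed (use elim bd in auto)
      also have "\<dots> = (LINT s|lborel. W (s, z) *\<^sub>R p (s, 0))"
        by (rule LINT_cell[where C = C, OF _ _ _ I2[simplified], symmetric]) (use elim C(1) in auto)
      finally show ?case .
    qed
    have 1: "(\<lambda>z. LINT s|lborel. W (s, z) *\<^sub>R ?h (s, z)) \<in> borel_measurable \<rho>"
      using P.integrable_snd[of "\<lambda>s z. W (s, z) *\<^sub>R ?h (s, z)"] integrable_Q[of ?h "C + C * (L * r)"] bd by (auto simp: case_prod_unfold)
    have 2: "(\<lambda>z. LINT s|lborel. W (s, z) *\<^sub>R p (s, 0)) \<in> borel_measurable \<rho>"
      using P.integrable_snd[of "\<lambda>s z. W (s, z) *\<^sub>R p (s, 0)"] integrable_Q[of "\<lambda>q. p (fst q, 0)" C] C by (auto simp: case_prod_unfold)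
    show "(\<lambda>z. LINT s|lborel. W (s, z) *\<^sub>R ?h (s, z)) \<in> borel_measurable \<rho>"
      "(\<lambda>z. LINT s|lborel. W (s, z) *\<^sub>R p (s, 0)) \<in> borel_measurable \<rho>" by fact+
  qed
  also have "\<dots> = (LINT q|Q. p (fst q, 0))"
    by (subst LINT_Q(2)[where C = C]) (use C in auto)
  also have "\<dots> = (LINT s:{0..T}|lborel. LINT z|\<rho>. w s (fst z) *\<^sub>R p (s, 0))"
    by (subst LINT_Q(4)[where C = C]) (use C in auto)
  also have "\<dots> = (LINT s:{0..T}|lborel. m * p (s, 0))"
    unfolding set_lebesgue_integral_def
    by (intro Bochner_Integration.integral_cong) (auto simp: LINT_w_rho indicator_def)
  also have "\<dots> = m * (LINT s:{0..T}|lborel. p (s, 0))" by simp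
  also have "(LINT s:{0..T}|lborel. p (s, 0)) = 0"
  proof -
    have "((\<lambda>s. p (s, 0 *\<^sub>R 0) + g (s, 0 *\<^sub>R 0) \<bullet> (0 *\<^sub>R 0)) has_integral \<phi> (T, 0 *\<^sub>R 0) - \<phi> (0, 0 *\<^sub>R 0)) {0..T}"
      by (rule has_integral_C1c_test_along_ray[OF test closed_D D(2,3), where S = "{}"]) (use T D in auto)
    then have I: "((\<lambda>s. p (s, 0)) has_integral 0) {0..T}"
      using reg(2,3) by simp
    have "set_integrable lborel {0..T} (\<lambda>_. C)"
      by (rule borel_integrable_atLeastAtMost') (rule continuous_on_const)
    then have "set_integrable lborel {0..T} (\<lambda>s. p (s, 0))"
      by (rule set_integrable_bound)
        (use C in \<open>auto simp: set_borel_measurable_def intro!: AE_I2 order_trans[OF _ abs_ge_self]\<close>)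
    from set_borel_integral_eq_integral(2)[OF this] integral_unique[OF I] show ?thesis by simp
  qed
  finally show ?thesis by simp
qed

lemma energy_le: "benamou_brenier T D mu momentum \<le> ennreal ((L * r)\<^sup>2 * (m * T))"
  using benamou_brenier_le[OF mu_radon closed_D mu_disintegrates momentum_disintegrates measurable_vel norm_vel
      momentum_def momentum_at_def momentum_continuity]
  unfolding measure_mu_UNIV .

end

subsection \<open>Distance to the original measure\<close>

definition cell_mean ::
  "real \<Rightarrow> nat \<Rightarrow> (real \<times> (real^3)) measure \<Rightarrow> (real^3) set \<Rightarrow> real \<Rightarrow> real" where
  "cell_mean T N \<rho> B s = real N / T * measure \<rho> ({t \<in> {0..T}. cell_index T N t = cell_index T N s} \<times> B)"

definition near_nodes :: "real \<Rightarrow> nat \<Rightarrow> real \<Rightarrow> real set" where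
  "near_nodes T N \<epsilon> = {s \<in> {0..T}. \<exists>j\<le>N. \<bar>s - node T N j\<bar> \<le> \<epsilon>}"

lemma near_nodes_eq: "near_nodes T N \<epsilon> = {0..T} \<inter> (\<Union>j\<le>N. {node T N j - \<epsilon>..node T N j + \<epsilon>})"
  by (auto simp: near_nodes_def abs_le_iff)

lemma near_nodes_borel [measurable]: "near_nodes T N \<epsilon> \<in> sets borel"
  unfolding near_nodes_eq by auto

lemma not_near_nodesD: "t \<in> {0..T} \<Longrightarrow> t \<notin> near_nodes T N \<epsilon> \<Longrightarrow> j \<le> N \<Longrightarrow> \<epsilon> < \<bar>t - node T N j\<bar>"
  by (rule ccontr) (auto simp: near_nodes_def not_less)

lemma emeasure_near_nodes_le:
  assumes "0 \<le> \<epsilon>"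
  shows "emeasure lborel (near_nodes T N \<epsilon>) \<le> ennreal (2 * (real N + 1) * \<epsilon>)"
proof -
  have "emeasure lborel (near_nodes T N \<epsilon>) \<le> emeasure lborel (\<Union>j\<le>N. {node T N j - \<epsilon>..node T N j + \<epsilon>})"
    unfolding near_nodes_eq by (intro emeasure_mono) auto
  also have "\<dots> \<le> (\<Sum>j\<le>N. emeasure lborel {node T N j - \<epsilon>..node T N j + \<epsilon>})"
    by (intro emeasure_subadditive_finite) auto
  also have "\<dots> = (\<Sum>j\<le>N. ennreal (2 * \<epsilon>))"
    using assms by (intro sum.cong) auto
  also have "\<dots> = ennreal (2 * (real N + 1) * \<epsilon>)"
    using assms by (simp add: ennreal_of_nat_eq_real_of_nat ennreal_mult[symmetric] algebra_simps del: ennreal_numeral flip: ennreal_1 ennreal_plus)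
  finally show ?thesis .
qed

lemma cell_index_stable:
  assumes T: "0 < T" and N: "0 < N" and t: "t \<in> {0..T}" "t \<notin> near_nodes T N \<epsilon>" and st: "\<bar>s - t\<bar> \<le> \<epsilon>"
  shows "cell_index T N s = cell_index T N t"
proof (rule cell_index_eqI[OF T N])
  note b = cell_index_bounds[OF T N t(1)]
  show "cell_index T N t < N" by (rule b(1))
  have "\<epsilon> < \<bar>t - node T N (cell_index T N t)\<bar>" "\<epsilon> < \<bar>t - node T N (Suc (cell_index T N t))\<bar>"
    using b(1) by (auto intro!: not_near_nodesD t)
  then show "node T N (cell_index T N t) < s" "s < node T N (Suc (cell_index T N t))"
    using b(2,3) st by linarith+
qed

context cell_average
begin

lemma lam_eq_1:
  assumes "0 < L" and s: "s \<in> {0..T}" "s \<notin> near_nodes T N (1 / L)"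
  shows "lam s = 1"
proof -
  note b = cell_index_bounds[OF T N s(1)]
  have "1 / L < \<bar>s - node T N (k s)\<bar>" "1 / L < \<bar>s - node T N (Suc (k s))\<bar>"
    using b(1) by (auto intro!: not_near_nodesD s)
  then have "1 / L < min (s - node T N (k s)) (node T N (Suc (k s)) - s)"
    using b(2,3) by auto
  then have "L * (1 / L) \<le> L * min (s - node T N (k s)) (node T N (Suc (k s)) - s)"
    using assms(1) by (intro mult_left_mono) auto
  then have "1 \<le> L * min (s - node T N (k s)) (node T N (Suc (k s)) - s)"
    using assms(1) by simp
  then show ?thesis unfolding lam_def plateau_def by simp
qed

lemma measure_R_eq_cell_mean:
  assumes s: "lam s = 1" and B: "B \<in> sets borel"
  shows "measure (R s) B = cell_mean T N \<rho> B s"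
proof -
  define C where "C = {t \<in> {0..T}. k t = k s}"
  have C: "C \<in> sets borel" unfolding C_def by measurable
  have CB: "C \<times> B \<in> sets borel" by (rule borel_Times[OF C B])
  have "emeasure (R s) B = (\<integral>\<^sup>+ z. ennreal (real N / T) * indicator (C \<times> B) z \<partial>\<rho>)"
    unfolding emeasure_R[OF B]
    using AE_rho by (intro nn_integral_cong_AE, eventually_elim) (auto simp: s w_def C_def indicator_def)
  also have "\<dots> = ennreal (real N / T) * emeasure \<rho> (C \<times> B)"
    using CB sets_rho by (intro nn_integral_cmult_indicator) auto
  also have "\<dots> = ennreal (real N / T * measure \<rho> (C \<times> B))"
    unfolding rho.emeasure_eq_measure using T by (intro ennreal_mult[symmetric]) auto
  finally show ?thesis
    unfolding cell_mean_def C_def[symmetric] measure_def[of "R s"] using T by simp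
qed

text \<open>
  The contraction factor of one cell, extended by 0, is continuous on \<open>[0,T]\<close>. A cell deviates from the
  value \<open>m \<psi>(0)\<close> of a point mass at the origin by a continuous function of its factor that vanishes at
  factor 0, so the sum of these deviations over all cells is continuous in time.
\<close>

lemma R_weak_star_continuous: "weak_star_continuous T D R"
  unfolding weak_star_continuous_def
proof (intro allI impI)
  fix \<psi> :: "real^3 \<Rightarrow> real" assume \<psi>: "continuous_on D \<psi>"
  define G where "G = (\<lambda>x. indicator D x *\<^sub>R \<psi> x)"
  have G [measurable]: "G \<in> borel_measurable borel"
    unfolding G_def by (rule borel_measurable_continuous_on_indicator[OF D_borel \<psi>])
  obtain M0 where M0: "\<And>x. x \<in> D \<Longrightarrow> \<bar>\<psi> x\<bar> \<le> M0"
    using compact_imp_bounded[OF compact_continuous_image[OF \<psi> D(1)]]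
    by (auto simp: bounded_iff)
  define M where "M = max M0 0"
  have M: "\<bar>G x\<bar> \<le> M" for x
    using M0[of x] by (cases "x \<in> D") (auto simp: G_def M_def)
  have M_nonneg: "0 \<le> M" by (simp add: M_def)
  define wj where "wj j t = (if real (k t) = real j then real N / T else 0)" for j t
  have wj [measurable]: "wj j \<in> borel_measurable borel" for j
    unfolding wj_def by measurable
  have wj_le: "\<bar>wj j t\<bar> \<le> real N / T" for j t using T by (simp add: wj_def)
  define H where "H j c = (LINT z|\<rho>. wj j (fst z) * G (c *\<^sub>R snd z))" for j c
  have w_wj: "w s = wj (k s)" for s by (auto simp: w_def wj_def)
  have H_cont: "continuous_on {0..1} (H j)" for j
  proof (rule continuous_on_sequentiallyI)
    fix u a assume u: "\<forall>n. u n \<in> {0..1}" and a: "a \<in> {0..1::real}" and lim: "u \<longlonglongrightarrow> a"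
    show "(\<lambda>n. H j (u n)) \<longlonglongrightarrow> H j a"
      unfolding H_def
    proof (rule integral_dominated_convergence[where w = "\<lambda>_. real N / T * M"])
      show "AE z in \<rho>. (\<lambda>n. wj j (fst z) * G (u n *\<^sub>R snd z)) \<longlonglongrightarrow> wj j (fst z) * G (a *\<^sub>R snd z)"
        using AE_rho
      proof eventually_elim
        case (elim z)
        have "u n *\<^sub>R snd z \<in> D" for n using u elim by (intro scale_in_D) auto
        moreover have "a *\<^sub>R snd z \<in> D" using a elim by (intro scale_in_D) auto
        moreover have "(\<lambda>n. u n *\<^sub>R snd z) \<longlonglongrightarrow> a *\<^sub>R snd z" by (intro tendsto_intros lim)
        ultimately have "(\<lambda>n. \<psi> (u n *\<^sub>R snd z)) \<longlonglongrightarrow> \<psi> (a *\<^sub>R snd z)"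
          using \<psi> by (intro continuous_on_tendsto_compose[OF \<psi>]) auto
        then show ?case
          using \<open>\<And>n. u n *\<^sub>R snd z \<in> D\<close> \<open>a *\<^sub>R snd z \<in> D\<close> by (auto simp: G_def intro!: tendsto_intros)
      qed
      show "AE z in \<rho>. norm (wj j (fst z) * G (u n *\<^sub>R snd z)) \<le> real N / T * M" for n
        unfolding real_norm_def abs_mult using T by (intro AE_I2 mult_mono wj_le M) auto
    qed auto
  qed
  have LR: "(LINT x:D|R t. \<psi> x) = H (k t) (lam t)" for t
    unfolding set_lebesgue_integral_def G_def[symmetric]
    using LINT_R[OF G, of t] by (simp add: H_def w_wj G_def)
  have H0: "H j 0 = m * G 0" if "j < N" for j
  proof -
    define s where "s = (node T N j + node T N (Suc j)) / 2"
    note nb = node_bounds[OF T N that]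
    have "k s = j" using nb by (intro cell_index_eqI[OF T N that]) (auto simp: s_def)
    moreover have "s \<in> {0..T}" using nb by (auto simp: s_def)
    ultimately show ?thesis
      using LINT_w_rho[of s] by (simp add: H_def w_wj)
  qed
  define q where "q j t = max 0 (plateau L (node T N j) (node T N (Suc j)) t)" for j t
  have q01: "q j t \<in> {0..1}" for j t by (simp add: q_def plateau_def)
  have q_cont: "continuous_on {0..T} (q j)" for j
    unfolding q_def[abs_def] by (intro continuous_intros continuous_on_plateau)
  have eq: "(LINT x:D|R t. \<psi> x) = m * G 0 + (\<Sum>j<N. H j (q j t) - m * G 0)" if t: "t \<in> {0..T}" for t
  proof -
    note b = cell_index_bounds[OF T N t]
    have zero: "H j (q j t) - m * G 0 = 0" if "j < N" "j \<noteq> k t" for j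
    proof -
      have "\<not> (node T N j < t \<and> t < node T N (Suc j))"
        using cell_index_eqI[OF T N that(1)] that(2) by auto
      then have "min (t - node T N j) (node T N (Suc j) - t) \<le> 0" by auto
      then have "L * min (t - node T N j) (node T N (Suc j) - t) \<le> 0"
        using L by (rule mult_nonneg_nonpos[rotated])
      then have "q j t = 0" unfolding q_def plateau_def by simp
      then show ?thesis using H0[OF that(1)] by simp
    qed
    have "q (k t) t = lam t" using lam_bounds[OF t] by (simp add: q_def lam_def)
    moreover have "(\<Sum>j<N. H j (q j t) - m * G 0) = (\<Sum>j\<in>{k t}. H j (q j t) - m * G 0)"
      using zero b(1) by (intro sum.mono_neutral_right) auto
    ultimately show ?thesis unfolding LR by simp
  qed
  have "continuous_on {0..T} (\<lambda>t. m * G 0 + (\<Sum>j<N. H j (q j t) - m * G 0))"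
    by (intro continuous_intros continuous_on_compose2[OF H_cont q_cont]) (use q01 in blast)
  then show "continuous_on {0..T} (\<lambda>t. LINT x:D|R t. \<psi> x)"
    by (subst continuous_on_cong[OF refl eq]) auto
qed

text \<open>
  Every point \<open>(t, x)\<close> is moved within its cell in time and contracted in space.
\<close>

definition coupling :: "((real \<times> (real^3)) \<times> (real \<times> (real^3))) measure" where
  "coupling = distr Q borel (\<lambda>q. (place q, snd q))"

lemma coupling_in_couplings: "coupling \<in> couplings mu \<rho>"
  unfolding couplings_def coupling_def
  by (auto simp: distr_distr o_def mu_def distr_Q_snd)

lemma coupling_cost_le:
  assumes \<beta>: "0 \<le> \<beta>" "emeasure lborel {s \<in> {0..T}. lam s \<noteq> 1} \<le> ennreal \<beta>"
  shows "transport_cost coupling \<le> ennreal ((T / real N)\<^sup>2 * (m * T) + r\<^sup>2 * (m * \<beta>))"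
proof -
  have "transport_cost coupling = (\<integral>\<^sup>+ q. ennreal ((dist (place q) (snd q))\<^sup>2) \<partial>Q)"
    unfolding coupling_def by (subst nn_integral_distr) auto
  also have "\<dots> \<le> (\<integral>\<^sup>+ q. ennreal ((T / real N)\<^sup>2) + ennreal (r\<^sup>2) * indicator {s. lam s \<noteq> 1} (fst q) \<partial>Q)"
  proof (rule nn_integral_mono_AE)
    show "AE q in Q. ennreal ((dist (place q) (snd q))\<^sup>2)
        \<le> ennreal ((T / real N)\<^sup>2) + ennreal (r\<^sup>2) * indicator {s. lam s \<noteq> 1} (fst q)"
      using AE_Q
    proof eventually_elim
      case (elim q)
      obtain s t x where q: "q = (s, t, x)" by (cases q)
      have s: "s \<in> {0..T}" and t: "t \<in> {0..T}" and kk: "k s = k t" and x: "x \<in> D" using elim q by auto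
      have "\<bar>s - t\<bar> \<le> T / real N"
        using cell_index_bounds[OF T N s] cell_index_bounds[OF T N t] node_bounds(4)[OF T N cell_index_bounds(1)[OF T N t]] kk
        by auto
      then have 1: "\<bar>s - t\<bar>\<^sup>2 \<le> (T / real N)\<^sup>2" by (intro power_mono) auto
      have "norm (lam s *\<^sub>R x - x) \<le> r"
      proof -
        have "lam s *\<^sub>R x - x = (lam s - 1) *\<^sub>R x" by (simp add: algebra_simps)
        then have "norm (lam s *\<^sub>R x - x) = (1 - lam s) * norm x"
          using lam_bounds[OF s] by simp
        also have "\<dots> \<le> 1 * r"
          using lam_bounds[OF s] r[OF x] by (intro mult_mono) auto
        finally show ?thesis by simp
      qed
      then have 2: "(norm (lam s *\<^sub>R x - x))\<^sup>2 \<le> r\<^sup>2 * indicator {s. lam s \<noteq> 1} s"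
        by (auto simp: indicator_def intro!: power_mono)
      have "(dist (place q) (snd q))\<^sup>2 = \<bar>s - t\<bar>\<^sup>2 + (norm (lam s *\<^sub>R x - x))\<^sup>2"
      proof -
        have "(dist (place q) (snd q))\<^sup>2 = (dist s t)\<^sup>2 + (dist (lam s *\<^sub>R x) x)\<^sup>2"
          unfolding q place_def fst_conv snd_conv dist_Pair_Pair by (rule real_sqrt_pow2) simp
        then show ?thesis by (simp only: dist_norm real_norm_def)
      qed
      then have "ennreal ((dist (place q) (snd q))\<^sup>2) \<le> ennreal ((T / real N)\<^sup>2 + r\<^sup>2 * indicator {s. lam s \<noteq> 1} s)"
        using 1 2 by (intro ennreal_leI) linarith
      also have "\<dots> = ennreal ((T / real N)\<^sup>2) + ennreal (r\<^sup>2) * indicator {s. lam s \<noteq> 1} (fst q)"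
        by (cases "lam s = 1") (simp_all add: q)
      finally show ?case .
    qed
  qed
  also have "\<dots> = ennreal ((T / real N)\<^sup>2) * emeasure Q UNIV + ennreal (r\<^sup>2) * (\<integral>\<^sup>+ q. indicator {s. lam s \<noteq> 1} (fst q) \<partial>Q)"
    by (subst nn_integral_add) (auto simp: nn_integral_cmult)
  also have "(\<integral>\<^sup>+ q. indicator {s. lam s \<noteq> 1} (fst q) \<partial>Q) = ennreal m * emeasure lborel {s \<in> {0..T}. lam s \<noteq> 1}"
  proof -
    have "(\<integral>\<^sup>+ q. indicator {s. lam s \<noteq> 1} (fst q) \<partial>Q) = ennreal m * (\<integral>\<^sup>+ s\<in>{0..T}. indicator {s. lam s \<noteq> 1} s \<partial>lborel)"
      by (rule nn_integral_Q_time) measurable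
    also have "(\<integral>\<^sup>+ s\<in>{0..T}. indicator {s. lam s \<noteq> 1} s \<partial>lborel) = (\<integral>\<^sup>+ s. indicator {s \<in> {0..T}. lam s \<noteq> 1} s \<partial>lborel)"
      by (intro nn_integral_cong) (auto simp: indicator_def)
    also have "\<dots> = emeasure lborel {s \<in> {0..T}. lam s \<noteq> 1}" by (intro nn_integral_indicator) measurable
    finally show ?thesis .
  qed
  also have "ennreal ((T / real N)\<^sup>2) * emeasure Q UNIV + ennreal (r\<^sup>2) * (ennreal m * emeasure lborel {s \<in> {0..T}. lam s \<noteq> 1})
      \<le> ennreal ((T / real N)\<^sup>2) * ennreal (m * T) + ennreal (r\<^sup>2) * (ennreal m * ennreal \<beta>)"
    unfolding emeasure_Q_UNIV using \<beta> by (intro add_mono mult_left_mono) auto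
  also have "\<dots> = ennreal ((T / real N)\<^sup>2 * (m * T) + r\<^sup>2 * (m * \<beta>))"
    using m T \<beta> by (simp add: ennreal_mult ennreal_plus)
  finally show ?thesis .
qed

lemma coupling_cost_le_nodes:
  assumes "0 < L"
  shows "transport_cost coupling
    \<le> ennreal ((T / real N)\<^sup>2 * (m * T) + r\<^sup>2 * (m * (2 * (real N + 1) / L)))"
proof (rule coupling_cost_le)
  have "emeasure lborel {s \<in> {0..T}. lam s \<noteq> 1} \<le> emeasure lborel (near_nodes T N (1 / L))"
    using lam_eq_1[OF assms] by (intro emeasure_mono) auto
  also have "\<dots> \<le> ennreal (2 * (real N + 1) * (1 / L))"
    using assms by (intro emeasure_near_nodes_le) auto
  finally show "emeasure lborel {s \<in> {0..T}. lam s \<noteq> 1} \<le> ennreal (2 * (real N + 1) / L)" by simp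
qed (use assms in simp)

end

section \<open>Convergence of cell averages along a subsequence\<close>

text \<open>
  A measurable function is almost everywhere a limit of continuous functions. After truncation at \<open>C\<close>,
  dominated convergence applies.
\<close>

lemma continuous_approximation_L1:
  fixes F :: "real \<Rightarrow> real"
  assumes F [measurable]: "F \<in> borel_measurable borel" and bd: "\<And>t. \<bar>F t\<bar> \<le> C" and e: "0 < e"
  obtains G where "continuous_on UNIV G" "(\<integral>\<^sup>+ t\<in>{a..b}. ennreal \<bar>F t - G t\<bar> \<partial>lborel) \<le> ennreal e"
proof -
  have "F \<in> borel_measurable (lebesgue_on UNIV)"
    using F by (intro measurable_restrict_space1 measurable_completion) simp
  then have "F measurable_on UNIV"
    by (subst measurable_on_iff_borel_measurable) auto
  then obtain Z g where Z: "negligible Z" and g: "\<And>n. continuous_on UNIV (g n)"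
    and lim': "\<And>t. t \<notin> Z \<Longrightarrow> (\<lambda>n. g n t) \<longlonglongrightarrow> (if t \<in> UNIV then F t else 0)"
    unfolding measurable_on_def by metis
  have lim: "(\<lambda>n. g n t) \<longlonglongrightarrow> F t" if "t \<notin> Z" for t
    using lim'[OF that] by simp
  have AEZ: "AE t in lborel. t \<notin> Z"
  proof -
    have "AE t in lebesgue. t \<notin> Z"
      using Z by (intro AE_not_in) (simp add: negligible_iff_null_sets)
    then show ?thesis by (simp only: AE_completion_iff)
  qed
  define G where "G n t = max (- C) (min C (g n t))" for n t
  have G_cont: "continuous_on UNIV (G n)" for n
    unfolding G_def[abs_def] by (intro continuous_intros g)
  have [measurable]: "G n \<in> borel_measurable borel" for n
    using G_cont by (rule borel_measurable_continuous_onI)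
  have C: "0 \<le> C" using bd abs_ge_zero order_trans by blast
  have G_le: "\<bar>G n t\<bar> \<le> C" for n t using C by (simp add: G_def)
  have "(\<lambda>n. \<integral>\<^sup>+ t. norm (indicator {a..b} t * F t - indicator {a..b} t * G n t) \<partial>lborel) \<longlonglongrightarrow> 0"
  proof (rule nn_integral_dominated_convergence_norm[where w = "\<lambda>t. indicator {a..b} t * C"])
    show "AE t in lborel. (\<lambda>n. indicator {a..b} t * G n t) \<longlonglongrightarrow> indicator {a..b} t * F t"
      using AEZ
    proof eventually_elim
      case (elim t)
      have "(\<lambda>n. G n t) \<longlonglongrightarrow> max (- C) (min C (F t))"
        unfolding G_def by (intro tendsto_intros lim elim)
      moreover have "max (- C) (min C (F t)) = F t" using bd[of t] by (simp add: max_def min_def abs_le_iff)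
      ultimately show ?case by (intro tendsto_intros) simp
    qed
    show "AE t in lborel. norm (indicator {a..b} t * G n t) \<le> indicator {a..b} t * C" for n
      using G_le by (intro AE_I2) (simp add: indicator_def)
    have "(\<integral>\<^sup>+ t. ennreal (indicator {a..b} t * C) \<partial>lborel) = ennreal C * emeasure lborel {a..b}"
      using C by (subst nn_integral_cmult_indicator[symmetric]) (auto intro!: nn_integral_cong simp: indicator_def)
    also have "\<dots> < \<infinity>" by (simp add: ennreal_mult_less_top emeasure_lborel_Icc_eq)
    finally show "(\<integral>\<^sup>+ t. ennreal (indicator {a..b} t * C) \<partial>lborel) < \<infinity>" .
  qed measurable
  then have "\<forall>\<^sub>F n in sequentially. (\<integral>\<^sup>+ t. norm (indicator {a..b} t * F t - indicator {a..b} t * G n t) \<partial>lborel) < ennreal e"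
    using e by (intro order_tendstoD(2)) auto
  then obtain n where "(\<integral>\<^sup>+ t. norm (indicator {a..b} t * F t - indicator {a..b} t * G n t) \<partial>lborel) < ennreal e"
    by (auto simp: eventually_sequentially)
  moreover have "(\<integral>\<^sup>+ t\<in>{a..b}. ennreal \<bar>F t - G n t\<bar> \<partial>lborel)
      = (\<integral>\<^sup>+ t. norm (indicator {a..b} t * F t - indicator {a..b} t * G n t) \<partial>lborel)"
    by (intro nn_integral_cong) (auto simp: indicator_def)
  ultimately show thesis using that[OF G_cont[of n]] by simp
qed

lemma ennreal_tendsto_0I:
  fixes f :: "nat \<Rightarrow> ennreal"
  assumes "\<And>e::real. 0 < e \<Longrightarrow> \<forall>\<^sub>F n in sequentially. f n \<le> ennreal e"
  shows "f \<longlonglongrightarrow> 0"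
proof (rule order_tendstoI)
  fix a :: ennreal assume a: "0 < a"
  obtain e :: real where e: "0 < e" "ennreal e < a"
  proof (cases a rule: ennreal_cases)
    case (real x)
    then show thesis using a that[of "x / 2"] by (simp add: ennreal_less_iff)
  next
    case top
    then show thesis using that[of 1] by simp
  qed
  show "\<forall>\<^sub>F n in sequentially. f n < a"
    using assms[OF e(1)] by eventually_elim (rule le_less_trans[OF _ e(2)])
qed simp

text \<open>
  This is uniform continuity for continuous functions. For general \<open>F\<close>, compare with a continuous \<open>G\<close>
  that is close in \<open>L\<^sup>1\<close>: since both marginals of the kernel are Lebesgue measure, replacing \<open>F\<close> by \<open>G\<close> in each of the
  two variables costs only the \<open>L\<^sup>1\<close> distance.
\<close>

lemma cell_oscillation_tendsto_0:
  fixes F :: "real \<Rightarrow> real" and N :: "nat \<Rightarrow> nat"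
  assumes T: "0 < T" and N: "\<And>n. 0 < N n" "filterlim N at_top sequentially"
    and F [measurable]: "F \<in> borel_measurable borel" and bd: "\<And>t. \<bar>F t\<bar> \<le> C"
  shows "(\<lambda>n. \<integral>\<^sup>+ s. \<integral>\<^sup>+ t. ennreal (cell_kernel T (N n) s t) * ennreal \<bar>F t - F s\<bar> \<partial>lborel \<partial>lborel) \<longlonglongrightarrow> 0"
proof (rule ennreal_tendsto_0I)
  fix e :: real assume e: "0 < e"
  define e' where "e' = e / (T + 2)"
  have e': "0 < e'" using e T by (simp add: e'_def)
  obtain G where G: "continuous_on UNIV G"
    and FG: "(\<integral>\<^sup>+ t\<in>{0..T}. ennreal \<bar>F t - G t\<bar> \<partial>lborel) \<le> ennreal e'"
    using continuous_approximation_L1[OF F bd e'] by blast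
  have [measurable]: "G \<in> borel_measurable borel"
    using G by (rule borel_measurable_continuous_onI)
  have "uniformly_continuous_on {0..T} G"
    using continuous_on_subset[OF G] by (intro compact_uniformly_continuous) auto
  then obtain d where d: "0 < d" "\<And>s t. s \<in> {0..T} \<Longrightarrow> t \<in> {0..T} \<Longrightarrow> \<bar>s - t\<bar> < d \<Longrightarrow> \<bar>G s - G t\<bar> < e'"
    using e' unfolding uniformly_continuous_on_def dist_real_def by metis
  have "\<forall>\<^sub>F n in sequentially. T / d < real (N n)"
    using filterlim_compose[OF filterlim_real_sequentially N(2)] by (simp add: filterlim_at_top_dense)
  then show "\<forall>\<^sub>F n in sequentially. (\<integral>\<^sup>+ s. \<integral>\<^sup>+ t. ennreal (cell_kernel T (N n) s t) * ennreal \<bar>F t - F s\<bar> \<partial>lborel \<partial>lborel) \<le> ennreal e"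
  proof eventually_elim
    case (elim n)
    define K where "K s t = ennreal (cell_kernel T (N n) s t)" for s t
    have Km [measurable]: "(\<lambda>q. K (fst q) (snd q)) \<in> borel_measurable (borel \<Otimes>\<^sub>M borel)"
      unfolding K_def using measurable_cell_kernel by measurable
    have K_sym: "K s t = K t s" for s t by (simp add: K_def cell_kernel_sym)
    have K1: "(\<integral>\<^sup>+ t. K s t \<partial>lborel) = indicator {0..T} s" for s
      unfolding K_def by (rule nn_integral_cell_kernel[OF T N(1)])
    have Kms [measurable]: "K s \<in> borel_measurable borel" for s
      using measurable_compose_Pair1[OF _ Km, of s] by simp
    have TN: "T / real (N n) < d" using elim d(1) N(1)[of n] by (simp add: field_simps)
    have pt: "K s t * ennreal \<bar>F t - F s\<bar> \<le> K s t * ennreal \<bar>F t - G t\<bar> + K s t * ennreal e' + K s t * ennreal \<bar>F s - G s\<bar>" for s t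
    proof (cases "s \<in> {0..T} \<and> t \<in> {0..T} \<and> cell_index T (N n) s = cell_index T (N n) t")
      case True
      note b = cell_index_bounds[OF T N(1), of s n] cell_index_bounds[OF T N(1), of t n]
      have "\<bar>t - s\<bar> \<le> T / real (N n)"
        using b node_bounds(4)[OF T N(1) b(1)] True by auto
      then have "\<bar>G t - G s\<bar> < e'" using TN True by (intro d(2)) auto
      then have "\<bar>F t - F s\<bar> \<le> \<bar>F t - G t\<bar> + e' + \<bar>F s - G s\<bar>" by linarith
      then have "ennreal \<bar>F t - F s\<bar> \<le> ennreal \<bar>F t - G t\<bar> + ennreal e' + ennreal \<bar>F s - G s\<bar>"
        using e' by (simp flip: ennreal_plus)
      then have "K s t * ennreal \<bar>F t - F s\<bar> \<le> K s t * (ennreal \<bar>F t - G t\<bar> + ennreal e' + ennreal \<bar>F s - G s\<bar>)"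
        by (intro mult_left_mono) auto
      then show ?thesis by (simp add: distrib_left)
    next
      case False
      then have "K s t = 0" by (auto simp: K_def cell_kernel_def)
      then show ?thesis by simp
    qed
    define I where "I f = (\<integral>\<^sup>+ s. \<integral>\<^sup>+ t. K s t * f s t \<partial>lborel \<partial>lborel)" for f :: "real \<Rightarrow> real \<Rightarrow> ennreal"
    have I_fst: "I (\<lambda>s _. f s) = (\<integral>\<^sup>+ s\<in>{0..T}. f s \<partial>lborel)" if "f \<in> borel_measurable borel" for f
      unfolding I_def by (intro nn_integral_cong, subst nn_integral_multc) (simp_all add: K1 mult.commute)
    have rhs: "I (\<lambda>s t. ennreal \<bar>F s - G s\<bar>) \<le> ennreal e'"
      using FG by (simp add: I_fst)
    have lhs: "I (\<lambda>s t. ennreal \<bar>F t - G t\<bar>) \<le> ennreal e'"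
    proof -
      have "I (\<lambda>s t. ennreal \<bar>F t - G t\<bar>) = (\<integral>\<^sup>+ t. \<integral>\<^sup>+ s. K s t * ennreal \<bar>F t - G t\<bar> \<partial>lborel \<partial>lborel)"
        unfolding I_def by (rule lborel_pair.Fubini'[symmetric]) (simp add: case_prod_unfold)
      also have "\<dots> = I (\<lambda>s t. ennreal \<bar>F s - G s\<bar>)"
        unfolding I_def by (intro nn_integral_cong) (simp add: K_sym)
      finally show ?thesis using rhs by simp
    qed
    have mid: "I (\<lambda>_ _. ennreal e') = ennreal (T * e')"
    proof -
      have "I (\<lambda>_ _. ennreal e') = ennreal e' * ennreal T"
        using T by (simp add: I_fst nn_integral_cmult_indicator)
      then show ?thesis using T e' by (simp add: ennreal_mult mult.commute)
    qed
    have m: "(\<lambda>s. \<integral>\<^sup>+ t. K s t * ennreal \<bar>F t - G t\<bar> \<partial>lborel) \<in> borel_measurable lborel"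
      "(\<lambda>s. \<integral>\<^sup>+ t. K s t * ennreal e' \<partial>lborel) \<in> borel_measurable lborel"
      "(\<lambda>s. \<integral>\<^sup>+ t. K s t * ennreal \<bar>F s - G s\<bar> \<partial>lborel) \<in> borel_measurable lborel"
      by (intro lborel.borel_measurable_nn_integral; simp add: case_prod_unfold)+
    have "I (\<lambda>s t. ennreal \<bar>F t - F s\<bar>)
      \<le> (\<integral>\<^sup>+ s. \<integral>\<^sup>+ t. K s t * ennreal \<bar>F t - G t\<bar> + K s t * ennreal e' + K s t * ennreal \<bar>F s - G s\<bar> \<partial>lborel \<partial>lborel)"
      unfolding I_def by (intro nn_integral_mono pt)
    also have "\<dots> = I (\<lambda>s t. ennreal \<bar>F t - G t\<bar>) + I (\<lambda>_ _. ennreal e') + I (\<lambda>s t. ennreal \<bar>F s - G s\<bar>)"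
      unfolding I_def using m by (simp add: nn_integral_add)
    also have "\<dots> \<le> ennreal e' + ennreal (T * e') + ennreal e'"
      unfolding mid by (intro add_mono lhs rhs) simp
    also have "\<dots> = ennreal e"
    proof -
      have "e' + T * e' + e' = e' * (T + 2)" by (simp add: algebra_simps)
      also have "\<dots> = e" using T by (simp add: e'_def)
      finally show ?thesis using e' T by (simp flip: ennreal_plus)
    qed
    finally show ?case by (simp only: I_def K_def)
  qed
qed

text \<open>
  A diagonal choice: if the first \<open>k + 1\<close> integrals are below \<open>2\<^sup>-\<^sup>k\<close> at \<open>r k\<close>, then for every \<open>i\<close> the sum of
  the tail of \<open>X (r k) i\<close> has finite integral, so it converges almost everywhere.
\<close>

lemma AE_subsequence_countable:
  fixes X :: "nat \<Rightarrow> nat \<Rightarrow> 'a \<Rightarrow> real"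
  assumes [measurable]: "\<And>n i. X n i \<in> borel_measurable M" and nonneg: "\<And>n i s. 0 \<le> X n i s"
    and lim: "\<And>i. (\<lambda>n. \<integral>\<^sup>+ s. ennreal (X n i s) \<partial>M) \<longlonglongrightarrow> 0"
  shows "\<exists>r :: nat \<Rightarrow> nat. strict_mono r \<and> (AE s in M. \<forall>i. (\<lambda>k. X (r k) i s) \<longlonglongrightarrow> 0)"
proof -
  have ev: "\<forall>\<^sub>F n in sequentially. \<forall>i\<in>{..k}. (\<integral>\<^sup>+ s. ennreal (X n i s) \<partial>M) < ennreal ((1/2) ^ k)" for k
    using lim by (intro eventually_ball_finite ballI order_tendstoD(2)) auto
  have "\<exists>r. \<forall>k. (\<forall>i\<in>{..k}. (\<integral>\<^sup>+ s. ennreal (X (r k) i s) \<partial>M) < ennreal ((1/2) ^ k)) \<and> r k < r (Suc k)"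
  proof (rule dependent_nat_choice)
    show "\<exists>n. \<forall>i\<in>{..0}. (\<integral>\<^sup>+ s. ennreal (X n i s) \<partial>M) < ennreal ((1/2) ^ 0)"
      using ev[of 0] by (auto simp: eventually_sequentially)
    fix n k
    show "\<exists>n'. (\<forall>i\<in>{..Suc k}. (\<integral>\<^sup>+ s. ennreal (X n' i s) \<partial>M) < ennreal ((1/2) ^ Suc k)) \<and> n < n'"
      using eventually_conj[OF ev[of "Suc k"] eventually_gt_at_top[of n]]
      unfolding eventually_sequentially by blast
  qed
  then obtain r where r: "\<And>k i. i \<le> k \<Longrightarrow> (\<integral>\<^sup>+ s. ennreal (X (r k) i s) \<partial>M) < ennreal ((1/2) ^ k)"
    and mono: "\<And>k. r k < r (Suc k)" by auto
  have "AE s in M. (\<lambda>k. X (r k) i s) \<longlonglongrightarrow> 0" for i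
  proof -
    have "(\<integral>\<^sup>+ s. (\<Sum>k. ennreal (X (r (k + i)) i s)) \<partial>M) = (\<Sum>k. \<integral>\<^sup>+ s. ennreal (X (r (k + i)) i s) \<partial>M)"
      by (rule nn_integral_suminf) measurable
    also have "\<dots> \<le> (\<Sum>k. ennreal ((1/2) ^ k))"
    proof (intro suminf_le summableI)
      fix k
      have "(\<integral>\<^sup>+ s. ennreal (X (r (k + i)) i s) \<partial>M) \<le> ennreal ((1/2) ^ (k + i))"
        using r[of i "k + i"] by simp
      also have "\<dots> \<le> ennreal ((1/2) ^ k)"
        by (intro ennreal_leI power_decreasing) auto
      finally show "(\<integral>\<^sup>+ s. ennreal (X (r (k + i)) i s) \<partial>M) \<le> ennreal ((1/2) ^ k)" .
    qed
    also have "\<dots> < \<infinity>"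
      by (subst suminf_ennreal2) (auto intro!: summable_geometric)
    finally have "AE s in M. (\<Sum>k. ennreal (X (r (k + i)) i s)) \<noteq> \<infinity>"
      by (intro nn_integral_PInf_AE) auto
    then show ?thesis
    proof eventually_elim
      case (elim s)
      then have "summable (\<lambda>k. X (r (k + i)) i s)"
        using nonneg by (intro summable_suminf_not_top) auto
      then have "(\<lambda>k. X (r (k + i)) i s) \<longlonglongrightarrow> 0" by (rule summable_LIMSEQ_zero)
      then show ?case by (rule LIMSEQ_offset)
    qed
  qed
  then have "AE s in M. \<forall>i. (\<lambda>k. X (r k) i s) \<longlonglongrightarrow> 0" by (simp add: AE_all_countable)
  moreover have "strict_mono r" using mono by (simp add: strict_mono_Suc_iff)
  ultimately show ?thesis by blast
qed

lemma compact_small_partition: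
  fixes D :: "'a::metric_space set"
  assumes D: "compact D" and e: "0 < e"
  shows "\<exists>(M :: nat) (Q :: nat \<Rightarrow> 'a set). (\<forall>i<M. Q i \<in> sets borel) \<and> disjoint_family_on Q {..<M} \<and> (\<Union>i<M. Q i) = D
    \<and> (\<forall>i<M. \<forall>x\<in>Q i. \<forall>y\<in>Q i. dist x y \<le> e)"
proof -
  have "\<forall>\<epsilon>>0. \<exists>k. finite k \<and> k \<subseteq> D \<and> D \<subseteq> (\<Union>x\<in>k. ball x \<epsilon>)"
    by (rule seq_compact_imp_totally_bounded[OF compact_imp_seq_compact[OF D]])
  then obtain K where K: "finite K" "D \<subseteq> (\<Union>x\<in>K. ball x (e / 2))"
    using half_gt_zero[OF e] by blast
  obtain c and M :: nat where c: "K = c ` {i. i < M}"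
    using finite_imp_nat_seg_image_inj_on[OF K(1)] by blast
  define Q where "Q = disjointed (\<lambda>i. D \<inter> ball (c i) (e / 2))"
  have sub: "Q i \<subseteq> D \<inter> ball (c i) (e / 2)" for i
    unfolding Q_def by (rule disjointed_subset)
  have cell: "D \<inter> ball (c i) (e / 2) \<in> sets borel" for i
    using borel_closed[OF compact_imp_closed[OF D]] borel_open[OF open_ball] by (rule sets.Int)
  have "Q i \<in> sets borel" for i
    unfolding Q_def disjointed_def using cell by (intro sets.Diff sets.finite_UN) simp_all
  moreover have "disjoint_family_on Q {..<M}"
    unfolding Q_def by (rule disjoint_family_on_mono[OF _ disjoint_family_disjointed]) simp
  moreover have "(\<Union>i<M. Q i) = D"
  proof -
    have "(\<Union>i<M. Q i) = (\<Union>i<M. D \<inter> ball (c i) (e / 2))"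
      unfolding Q_def using finite_UN_disjointed_eq[of "\<lambda>i. D \<inter> ball (c i) (e / 2)" M] by (simp add: atLeast0LessThan)
    also have "\<dots> = D" using K(2) unfolding c by blast
    finally show ?thesis .
  qed
  moreover have "dist x y \<le> e" if "x \<in> Q i" "y \<in> Q i" for i x y
  proof -
    have "x \<in> ball (c i) (e / 2)" "y \<in> ball (c i) (e / 2)" using that sub[of i] by blast+
    then have "dist (c i) x < e / 2" "dist (c i) y < e / 2" by simp_all
    then show ?thesis using dist_triangle3[of x y "c i"] by linarith
  qed
  ultimately show ?thesis by (intro exI[of _ M] exI[of _ Q] conjI allI impI ballI) simp_all
qed

lemma deviation_le_oscillation:
  assumes T: "0 < T" and N: "0 < N" and s: "s \<in> {0..T}"
    and dis: "disintegrates T D \<rho> \<rho>t" and fin: "finite_measure \<rho>" and B: "B \<in> sets borel"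
    and F [measurable]: "F \<in> borel_measurable borel" and bd: "\<And>t. \<bar>F t\<bar> \<le> C"
    and eq: "AE t in lborel. t \<in> {0..T} \<longrightarrow> F t = measure (\<rho>t t) B"
  shows "ennreal \<bar>cell_mean T N \<rho> B s - F s\<bar>
    \<le> (\<integral>\<^sup>+ t. ennreal (cell_kernel T N s t) * ennreal \<bar>F t - F s\<bar> \<partial>lborel)"
proof -
  define A where "A = {t \<in> {0..T}. cell_index T N t = cell_index T N s}"
  have A: "A \<in> sets borel" unfolding A_def by measurable
  have Am: "emeasure lborel A = ennreal (T / real N)"
    unfolding A_def by (rule emeasure_cell[OF T N cell_index_bounds(1)[OF T N s]])
  have TA: "{0..T} \<inter> A = A" by (auto simp: A_def)
  have K: "cell_kernel T N s t = real N / T * indicator A t" for t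
    using s by (auto simp: cell_kernel_def A_def)
  have KF: "cell_kernel T N s t * (F t - F s) = real N / T * (indicator A t * F t) - real N / T * (indicator A t * F s)" for t
    by (simp only: K right_diff_distrib mult.assoc)
  have indA: "integrable lborel (indicator A :: real \<Rightarrow> real)"
    using A Am by (intro integrable_real_indicator) auto
  have FA: "integrable lborel (\<lambda>t. indicator A t * F t)"
  proof (rule Bochner_Integration.integrable_bound)
    show "integrable lborel (\<lambda>t. indicator A t * C)" using indA by simp
    show "AE t in lborel. norm (indicator A t * F t) \<le> norm (indicator A t * C)"
      using bd by (intro AE_I2) (auto simp: indicator_def intro: order_trans[OF _ abs_ge_self])
  qed (use A in measurable)
  have "measure \<rho> (A \<times> B) = (LINT t:A|lborel. measure (\<rho>t t) B)"
    using disintegrates_LINT(2)[OF dis fin B A] by (simp add: TA)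
  also have "\<dots> = (LINT t|lborel. indicator A t * F t)"
  proof -
    have "integrable lborel (\<lambda>t. indicator A t *\<^sub>R measure (\<rho>t t) B)"
      using disintegrates_LINT(1)[OF dis fin B A] by (simp add: TA set_integrable_def)
    then have "(\<lambda>t. indicator A t *\<^sub>R measure (\<rho>t t) B) \<in> borel_measurable lborel" by auto
    then show ?thesis
      unfolding set_lebesgue_integral_def
      using eq FA
      by (intro integral_cong_AE) (auto simp: A_def indicator_def elim!: eventually_mono)
  qed
  finally have "real N / T * measure \<rho> (A \<times> B) = (LINT t|lborel. real N / T * (indicator A t * F t))" by simp
  moreover have "F s = (LINT t|lborel. real N / T * (indicator A t * F s))"
    using T N A Am by (simp add: measure_def)
  ultimately have "real N / T * measure \<rho> (A \<times> B) - F s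
      = (LINT t|lborel. real N / T * (indicator A t * F t) - real N / T * (indicator A t * F s))"
    using FA indA by (subst Bochner_Integration.integral_diff) auto
  also have "\<dots> = (LINT t|lborel. cell_kernel T N s t * (F t - F s))"
    by (simp only: KF)
  finally have "ennreal \<bar>real N / T * measure \<rho> (A \<times> B) - F s\<bar> = ennreal \<bar>LINT t|lborel. cell_kernel T N s t * (F t - F s)\<bar>"
    by simp
  also have "\<dots> \<le> (\<integral>\<^sup>+ t. ennreal (norm (cell_kernel T N s t * (F t - F s))) \<partial>lborel)"
  proof -
    have "integrable lborel (\<lambda>t. cell_kernel T N s t * (F t - F s))"
    proof -
      have "integrable lborel (\<lambda>t. real N / T * (indicator A t * F t) - real N / T * (indicator A t * F s))"
        using FA indA by (intro Bochner_Integration.integrable_diff integrable_mult_right integrable_mult_left) auto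
      then show ?thesis by (simp only: KF)
    qed
    from integral_norm_bound_ennreal[OF this] show ?thesis by simp
  qed
  also have "\<dots> = (\<integral>\<^sup>+ t. ennreal (cell_kernel T N s t) * ennreal \<bar>F t - F s\<bar> \<partial>lborel)"
  proof (rule nn_integral_cong)
    fix t
    have "0 \<le> cell_kernel T N s t" using T by (simp add: K)
    then show "ennreal (norm (cell_kernel T N s t * (F t - F s))) = ennreal (cell_kernel T N s t) * ennreal \<bar>F t - F s\<bar>"
      by (simp only: real_norm_def abs_mult abs_of_nonneg ennreal_mult abs_ge_zero)
  qed
  finally show ?thesis unfolding cell_mean_def A_def .
qed

text \<open>
  The times near the nodes are treated on the same footing as the deviations of the averages: the
  indicator function of these times is one more sequence that tends to 0 in \<open>L\<^sup>1\<close>.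
\<close>

lemma averages_converge_along_subsequence:
  fixes B :: "nat \<Rightarrow> (real^3) set"
  assumes T: "0 < T" and N: "\<And>n. 0 < N n" "filterlim N at_top sequentially"
    and dis: "disintegrates T D \<rho> \<rho>t" and fin: "finite_measure \<rho>"
    and mass: "AE t in lborel. t \<in> {0..T} \<longrightarrow> measure (\<rho>t t) UNIV = m"
    and B: "\<And>i. B i \<in> sets borel"
    and \<epsilon>: "\<And>n. 0 \<le> \<epsilon> n" "(\<lambda>n. 2 * (real (N n) + 1) * \<epsilon> n) \<longlonglongrightarrow> 0"
  shows "\<exists>r :: nat \<Rightarrow> nat. strict_mono r \<and> (AE t in lborel. t \<in> {0..T} \<longrightarrow>
     (\<forall>\<^sub>F k in sequentially. t \<notin> near_nodes T (N (r k)) (\<epsilon> (r k))) \<and>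
     (\<forall>i. (\<lambda>k. cell_mean T (N (r k)) \<rho> (B i) t) \<longlonglongrightarrow> measure (\<rho>t t) (B i)))"
proof -
  \<comment> \<open>The truncation at \<open>m\<close> changes nothing almost everywhere and makes the functions bounded.\<close>
  define F where "F i t = min \<bar>m\<bar> (indicator {0..T} t *\<^sub>R measure (\<rho>t t) (B i))" for i t
  define avg where "avg n i = cell_mean T (N n) \<rho> (B i)" for n i
  define X where "X n i s = (case i of 0 \<Rightarrow> indicator (near_nodes T (N n) (\<epsilon> n)) s
    | Suc i \<Rightarrow> indicator {0..T} s * \<bar>avg n i s - F i s\<bar>)" for n i and s :: real
  have Fm [measurable]: "F i \<in> borel_measurable borel" for i
  proof -
    have "(\<lambda>t. indicator {0..T} t *\<^sub>R measure (\<rho>t t) (B i)) \<in> borel_measurable borel"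
      using disintegrates_LINT(1)[OF dis fin B[of i], of UNIV] by (auto simp: set_integrable_def)
    then show ?thesis unfolding F_def[abs_def] by measurable
  qed
  have F_bd: "\<bar>F i t\<bar> \<le> \<bar>m\<bar>" for i t
    unfolding F_def by (auto simp: indicator_def min_def)
  have F_eq: "AE t in lborel. t \<in> {0..T} \<longrightarrow> F i t = measure (\<rho>t t) (B i)" for i
    using mass
  proof eventually_elim
    case (elim t)
    show ?case
    proof
      assume t: "t \<in> {0..T}"
      then have "finite_measure (\<rho>t t)" "sets (\<rho>t t) = sets borel"
        using dis by (auto simp: disintegrates_def radon_nonneg_def)
      then have "measure (\<rho>t t) (B i) \<le> measure (\<rho>t t) UNIV"
        by (intro finite_measure.finite_measure_mono) auto
      then show "F i t = measure (\<rho>t t) (B i)" using elim t by (simp add: F_def)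
    qed
  qed
  have avg_m [measurable]: "avg n i \<in> borel_measurable borel" for n i
    unfolding avg_def cell_mean_def[abs_def] by (rule measurable_compose[OF measurable_cell_index]) simp
  have X_m: "X n i \<in> borel_measurable lborel" for n i
    unfolding X_def by (cases i) simp_all
  have X_nonneg: "0 \<le> X n i s" for n i s
    unfolding X_def by (cases i) simp_all
  have X_lim: "(\<lambda>n. \<integral>\<^sup>+ s. ennreal (X n i s) \<partial>lborel) \<longlonglongrightarrow> 0" for i
  proof (cases i)
    case 0
    have le: "(\<integral>\<^sup>+ s. ennreal (X n i s) \<partial>lborel) \<le> ennreal (2 * (real (N n) + 1) * \<epsilon> n)" for n
    proof -
      have "(\<integral>\<^sup>+ s. ennreal (X n i s) \<partial>lborel) = (\<integral>\<^sup>+ s. indicator (near_nodes T (N n) (\<epsilon> n)) s \<partial>lborel)"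
        by (intro nn_integral_cong) (simp add: X_def 0 indicator_def)
      also have "\<dots> = emeasure lborel (near_nodes T (N n) (\<epsilon> n))"
        by (rule nn_integral_indicator) simp
      finally show ?thesis using emeasure_near_nodes_le[OF \<epsilon>(1), of T "N n" n] by simp
    qed
    have "(\<lambda>n. ennreal (2 * (real (N n) + 1) * \<epsilon> n)) \<longlonglongrightarrow> 0"
      using tendsto_ennrealI[OF \<epsilon>(2)] by simp
    then show ?thesis
      by (rule tendsto_sandwich[OF _ _ tendsto_const, rotated 2]) (use le in auto)
  next
    case (Suc j)
    have le: "(\<integral>\<^sup>+ s. ennreal (X n i s) \<partial>lborel)
      \<le> (\<integral>\<^sup>+ s. \<integral>\<^sup>+ t. ennreal (cell_kernel T (N n) s t) * ennreal \<bar>F j t - F j s\<bar> \<partial>lborel \<partial>lborel)" for n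
    proof (rule nn_integral_mono)
      fix s
      show "ennreal (X n i s) \<le> (\<integral>\<^sup>+ t. ennreal (cell_kernel T (N n) s t) * ennreal \<bar>F j t - F j s\<bar> \<partial>lborel)"
      proof (cases "s \<in> {0..T}")
        case True
        then show ?thesis
          using deviation_le_oscillation[OF T N(1) True dis fin B Fm F_bd F_eq, of n j] by (simp add: X_def Suc avg_def)
      next
        case False
        then show ?thesis by (simp add: X_def Suc)
      qed
    qed
    show ?thesis
      by (rule tendsto_sandwich[OF _ _ tendsto_const cell_oscillation_tendsto_0[OF T N Fm[of j] F_bd]])
        (use le in auto)
  qed
  from AE_subsequence_countable[of X lborel, OF X_m X_nonneg X_lim]
  obtain r where r: "strict_mono r" and lim: "AE s in lborel. \<forall>i. (\<lambda>k. X (r k) i s) \<longlonglongrightarrow> 0"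
    by (elim exE conjE)
  have "AE t in lborel. \<forall>i. t \<in> {0..T} \<longrightarrow> F i t = measure (\<rho>t t) (B i)"
    unfolding AE_all_countable using F_eq by blast
  with lim have "AE t in lborel. t \<in> {0..T} \<longrightarrow>
     (\<forall>\<^sub>F k in sequentially. t \<notin> near_nodes T (N (r k)) (\<epsilon> (r k))) \<and>
     (\<forall>i. (\<lambda>k. avg (r k) i t) \<longlonglongrightarrow> measure (\<rho>t t) (B i))"
  proof eventually_elim
    case (elim t)
    show ?case
    proof (intro impI conjI allI)
      have "(\<lambda>k. indicator (near_nodes T (N (r k)) (\<epsilon> (r k))) t :: real) \<longlonglongrightarrow> 0"
        using elim(1)[rule_format, of 0] by (simp add: X_def)
      then have "\<forall>\<^sub>F k in sequentially. indicator (near_nodes T (N (r k)) (\<epsilon> (r k))) t < (1 :: real)"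
        by (rule order_tendstoD) simp
      then show "\<forall>\<^sub>F k in sequentially. t \<notin> near_nodes T (N (r k)) (\<epsilon> (r k))"
        by eventually_elim (auto simp: indicator_def split: if_splits)
      fix i assume t: "t \<in> {0..T}"
      have "(\<lambda>k. \<bar>avg (r k) i t - F i t\<bar>) \<longlonglongrightarrow> 0"
        using elim(1)[rule_format, of "Suc i"] t by (simp add: X_def)
      then have "(\<lambda>k. avg (r k) i t) \<longlonglongrightarrow> F i t"
        by (simp add: tendsto_rabs_zero_iff LIM_zero_iff)
      then show "(\<lambda>k. avg (r k) i t) \<longlonglongrightarrow> measure (\<rho>t t) (B i)"
        using elim(2) t by simp
    qed
  qed
  with r show ?thesis by (intro exI[of _ r] conjI) (simp_all only: avg_def)
qed

text \<open>
  For a fixed partition, the bound of \<open>wasserstein2_le_partition\<close> tends to the root of \<open>\<epsilon>\<^sub>j\<^sup>2 m\<close>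
  as \<open>k\<close> grows, and this is small for a fine partition.
\<close>

lemma wasserstein2_tendsto_0_of_partitions:
  fixes \<mu> :: "nat \<Rightarrow> 'a::{metric_space, second_countable_topology} measure"
    and M :: "nat \<Rightarrow> nat" and Q :: "nat \<Rightarrow> nat \<Rightarrow> 'a set"
  assumes D: "compact D" and diam: "\<And>x y. x \<in> D \<Longrightarrow> y \<in> D \<Longrightarrow> dist x y \<le> r"
    and \<mu>: "\<forall>\<^sub>F k in sequentially. \<mu> k \<in> radon_nonneg D \<and> measure (\<mu> k) UNIV = m"
    and \<nu>: "\<nu> \<in> radon_nonneg D" "measure \<nu> UNIV = m"
    and Q: "\<And>j i. i < M j \<Longrightarrow> Q j i \<in> sets borel" "\<And>j. disjoint_family_on (Q j) {..<M j}" "\<And>j. (\<Union>i<M j. Q j i) = D"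
      "\<And>j i x y. i < M j \<Longrightarrow> x \<in> Q j i \<Longrightarrow> y \<in> Q j i \<Longrightarrow> dist x y \<le> \<epsilon> j"
    and \<epsilon>: "\<epsilon> \<longlonglongrightarrow> 0"
    and lim: "\<And>j i. i < M j \<Longrightarrow> (\<lambda>k. measure (\<mu> k) (Q j i)) \<longlonglongrightarrow> measure \<nu> (Q j i)"
  shows "(\<lambda>k. wasserstein2 (\<mu> k) \<nu>) \<longlonglongrightarrow> 0"
proof (rule ennreal_tendsto_0I)
  fix e :: real assume e: "0 < e"
  have "(\<lambda>j. sqrt ((\<epsilon> j)\<^sup>2 * m)) \<longlonglongrightarrow> sqrt (0\<^sup>2 * m)" by (intro tendsto_intros \<epsilon>)
  then have "\<forall>\<^sub>F j in sequentially. sqrt ((\<epsilon> j)\<^sup>2 * m) < e" using e by (intro order_tendstoD(2)) auto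
  then obtain j where j: "sqrt ((\<epsilon> j)\<^sup>2 * m) < e" by (auto simp: eventually_sequentially)
  define \<kappa> where "\<kappa> k = (\<Sum>i<M j. \<bar>measure (\<mu> k) (Q j i) - measure \<nu> (Q j i)\<bar>)" for k
  have "\<kappa> \<longlonglongrightarrow> (\<Sum>i<M j. \<bar>measure \<nu> (Q j i) - measure \<nu> (Q j i)\<bar>)"
    unfolding \<kappa>_def[abs_def] by (intro tendsto_intros lim) simp
  then have \<kappa>: "\<kappa> \<longlonglongrightarrow> 0" by simp
  have "(\<lambda>k. sqrt ((\<epsilon> j)\<^sup>2 * m + r\<^sup>2 * (real (M j) * \<kappa> k))) \<longlonglongrightarrow> sqrt ((\<epsilon> j)\<^sup>2 * m + r\<^sup>2 * (real (M j) * 0))"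
    by (intro tendsto_intros \<kappa>)
  then have "\<forall>\<^sub>F k in sequentially. sqrt ((\<epsilon> j)\<^sup>2 * m + r\<^sup>2 * (real (M j) * \<kappa> k)) < e"
    using j by (intro order_tendstoD(2)) auto
  with \<mu> show "\<forall>\<^sub>F k in sequentially. wasserstein2 (\<mu> k) \<nu> \<le> ennreal e"
  proof eventually_elim
    case (elim k)
    have "wasserstein2 (\<mu> k) \<nu> \<le> ennreal (sqrt ((\<epsilon> j)\<^sup>2 * m + r\<^sup>2 * (real (M j) * \<kappa> k)))"
    proof (rule wasserstein2_le_partition[where Q = "Q j"])
      fix i assume i: "i < M j"
      show "\<bar>measure (\<mu> k) (Q j i) - measure \<nu> (Q j i)\<bar> \<le> \<kappa> k"
        unfolding \<kappa>_def using i by (intro member_le_sum[of i "{..<M j}" "\<lambda>i. \<bar>measure (\<mu> k) (Q j i) - measure \<nu> (Q j i)\<bar>"]) auto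
    next
      fix x y assume "x \<in> (\<Union>i<M j. Q j i)" "y \<in> (\<Union>i<M j. Q j i)"
      then show "dist x y \<le> r" unfolding Q(3) by (rule diam)
    next
      show "emeasure (\<mu> k) (- (\<Union>i<M j. Q j i)) = 0" "emeasure \<nu> (- (\<Union>i<M j. Q j i)) = 0"
        unfolding Q(3) using elim(1) \<nu> by (auto simp: radon_nonneg_def)
    qed (use elim(1) \<nu> Q(1,2,4) in \<open>auto simp: radon_nonneg_def\<close>)
    also have "\<dots> \<le> ennreal e" using elim(2) by (intro ennreal_leI) simp
    finally show ?case .
  qed
qed

section \<open>Choice of the parameters\<close>

lemma nat_ceiling_inverse_bounds:
  fixes x :: real
  assumes "0 < x"
  shows "0 < nat \<lceil>1 / x\<rceil>" "1 / x \<le> real (nat \<lceil>1 / x\<rceil>)" "real (nat \<lceil>1 / x\<rceil>) \<le> 1 / x + 1"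
proof -
  have "0 < 1 / x" using assms by simp
  then show "0 < nat \<lceil>1 / x\<rceil>" "1 / x \<le> real (nat \<lceil>1 / x\<rceil>)" "real (nat \<lceil>1 / x\<rceil>) \<le> 1 / x + 1"
    by linarith+
qed

locale constant_mass_curve =
  fixes T m r :: real and D :: "(real^3) set" and \<rho> :: "(real \<times> (real^3)) measure"
    and \<rho>t :: "real \<Rightarrow> (real^3) measure"
  assumes T: "0 < T" and D: "compact D" "convex D" "0 \<in> D"
    and r: "\<And>x. x \<in> D \<Longrightarrow> norm x \<le> r"
    and \<rho>: "\<rho> \<in> radon_nonneg ({0..T} \<times> D)" and dis: "disintegrates T D \<rho> \<rho>t"
    and mass_D: "AE t in lborel. t \<in> {0..T} \<longrightarrow> measure (\<rho>t t) D = m"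
begin

lemma finite_rho: "finite_measure \<rho>" and sets_rho: "sets \<rho> = sets borel"
  using \<rho> by (auto simp: radon_nonneg_def)

lemma mass: "AE t in lborel. t \<in> {0..T} \<longrightarrow> measure (\<rho>t t) UNIV = m"
  using mass_D
proof eventually_elim
  case (elim t)
  show ?case
  proof
    assume t: "t \<in> {0..T}"
    then have \<rho>t: "finite_measure (\<rho>t t)" "sets (\<rho>t t) = sets borel" "emeasure (\<rho>t t) (- D) = 0"
      using dis by (auto simp: disintegrates_def radon_nonneg_def)
    have D_borel: "D \<in> sets borel" using D(1) by (simp add: compact_imp_closed)
    have "measure (\<rho>t t) UNIV = measure (\<rho>t t) D"
    proof (rule measure_eq_AE)
      show "AE x in \<rho>t t. (x \<in> UNIV) = (x \<in> D)"
        using AE_mem_of_null_Compl[OF \<rho>t(2) D_borel \<rho>t(3)] by eventually_elim simp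
      show "UNIV \<in> sets (\<rho>t t)" "D \<in> sets (\<rho>t t)"
        unfolding \<rho>t(2) using D_borel by simp_all
    qed
    then show "measure (\<rho>t t) UNIV = m" using elim t by simp
  qed
qed

lemma time_marginal:
  assumes C: "C \<in> sets borel"
  shows "emeasure \<rho> (C \<times> UNIV) = ennreal m * emeasure lborel ({0..T} \<inter> C)"
proof -
  have CU: "C \<times> UNIV \<in> sets borel" using C by (intro borel_Times) auto
  have "emeasure \<rho> (C \<times> UNIV) = (\<integral>\<^sup>+ t\<in>{0..T}. emeasure (\<rho>t t) {x. (t, x) \<in> C \<times> UNIV} \<partial>lborel)"
    using dis CU by (auto simp: disintegrates_def)
  also have "\<dots> = (\<integral>\<^sup>+ t. ennreal m * indicator ({0..T} \<inter> C) t \<partial>lborel)"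
  proof (rule nn_integral_cong_AE)
    show "AE t in lborel. emeasure (\<rho>t t) {x. (t, x) \<in> C \<times> UNIV} * indicator {0..T} t
        = ennreal m * indicator ({0..T} \<inter> C) t"
      using mass
    proof eventually_elim
      case (elim t)
      have "finite_measure (\<rho>t t)" if "t \<in> {0..T}"
        using dis that by (auto simp: disintegrates_def radon_nonneg_def)
      then show ?case
        using elim by (cases "t \<in> {0..T}"; cases "t \<in> C") (auto simp: finite_measure.emeasure_eq_measure)
    qed
  qed
  also have "\<dots> = ennreal m * emeasure lborel ({0..T} \<inter> C)"
    using C by (intro nn_integral_cmult_indicator) auto
  finally show ?thesis .
qed

lemma m_nonneg: "0 \<le> m"
proof (rule ccontr)
  assume "\<not> 0 \<le> m"
  then have "AE t in lborel. t \<notin> {0..T}"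
    using mass by (auto elim!: eventually_mono dest: order_trans[OF measure_nonneg eq_refl])
  then have "emeasure lborel {t \<in> space lborel. t \<in> {0..T}} = 0"
    by (rule emeasure_eq_0_AE)
  moreover have "{t \<in> space lborel. t \<in> {0..T}} = {0..T}" by auto
  ultimately show False using T by (simp only: emeasure_lborel_Icc_eq) simp
qed

lemma cell_average: "0 < N \<Longrightarrow> 0 \<le> L \<Longrightarrow> cell_average T L m r N D \<rho>"
  using T D r \<rho> m_nonneg time_marginal by unfold_locales auto

abbreviation mu where "mu L N \<equiv> cell_average.mu T L N \<rho>"
abbreviation R where "R L N \<equiv> cell_average.R T L N \<rho>"
abbreviation momentum where "momentum L N \<equiv> cell_average.momentum T L r N \<rho>"

text \<open>
  The largest slope, up to the summand 1, for which the energy bound \<open>(L r)\<^sup>2 m T\<close> is at most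
  \<open>1 / \<delta>\<close>. The summand keeps the slope finite when \<open>m\<close> or \<open>r\<close> is 0.
\<close>

definition slope :: "real \<Rightarrow> real" where
  "slope \<delta> = 1 / sqrt ((r\<^sup>2 * (m * T) + 1) * \<delta>)"

lemma slope_pos: "0 < \<delta> \<Longrightarrow> 0 < slope \<delta>"
proof -
  have "0 < r\<^sup>2 * (m * T) + 1" using m_nonneg T by (simp add: add_nonneg_pos)
  then show "0 < \<delta> \<Longrightarrow> 0 < slope \<delta>" by (simp add: slope_def)
qed

lemma energy_slope_le:
  assumes "0 < \<delta>"
  shows "(slope \<delta> * r)\<^sup>2 * (m * T) \<le> 1 / \<delta>"
proof -
  define A where "A = r\<^sup>2 * (m * T) + 1"
  have A: "0 < A" "r\<^sup>2 * (m * T) \<le> A" using m_nonneg T by (simp_all add: A_def add_nonneg_pos)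
  have "(slope \<delta> * r)\<^sup>2 * (m * T) = r\<^sup>2 * (m * T) / (A * \<delta>)"
    using A(1) assms by (simp add: slope_def A_def[symmetric] power_mult_distrib power_divide)
  also have "\<dots> \<le> A / (A * \<delta>)" using A assms by (intro divide_right_mono) auto
  also have "\<dots> = 1 / \<delta>" using A(1) by simp
  finally show ?thesis .
qed

definition cost_bound :: "real \<Rightarrow> nat \<Rightarrow> real" where
  "cost_bound \<delta> N = (T / real N)\<^sup>2 * (m * T) + r\<^sup>2 * (m * (2 * (real N + 1) / slope \<delta>))"

lemma approximating_of_cost_bound:
  assumes \<delta>: "\<And>n. 0 < \<delta> n" and N: "\<And>n. 0 < N n"
    and B: "\<And>n. cost_bound (\<delta> n) (N n) \<le> B n" "B \<longlonglongrightarrow> 0"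
  shows "approximating T D \<rho> \<delta> (\<lambda>n. mu (slope (\<delta> n)) (N n)) (\<lambda>n. momentum (slope (\<delta> n)) (N n))"
    and "wasserstein2 (mu (slope (\<delta> n)) (N n)) \<rho> \<le> ennreal (sqrt (B n))"
proof -
  let ?L = "\<lambda>n. slope (\<delta> n)"
  have ca: "cell_average T (?L n) m r (N n) D \<rho>" for n
    using N slope_pos[OF \<delta>] by (intro cell_average) (auto intro: less_imp_le)
  have B0: "0 \<le> B n" for n
  proof -
    have "0 \<le> cost_bound (\<delta> n) (N n)"
      using m_nonneg T slope_pos[OF \<delta>, of n] by (simp add: cost_bound_def)
    then show ?thesis using B(1)[of n] by linarith
  qed
  have cost: "transport_cost (cell_average.coupling T (?L n) (N n) \<rho>) \<le> ennreal (B n)" for n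
    using cell_average.coupling_cost_le_nodes[OF ca slope_pos[OF \<delta>]] B(1)[of n]
    unfolding cost_bound_def by (meson ennreal_leI order_trans)
  have coup: "cell_average.coupling T (?L n) (N n) \<rho> \<in> couplings (mu (?L n) (N n)) \<rho>" for n
    by (rule cell_average.coupling_in_couplings[OF ca])
  show "wasserstein2 (mu (?L n) (N n)) \<rho> \<le> ennreal (sqrt (B n))"
    by (rule wasserstein2_le_sqrt_cost[OF coup cost B0])
  show "approximating T D \<rho> \<delta> (\<lambda>n. mu (?L n) (N n)) (\<lambda>n. momentum (?L n) (N n))"
    unfolding approximating_def
  proof (intro conjI allI)
    show "weak_star_conv ({0..T} \<times> D) (\<lambda>n. mu (?L n) (N n)) \<rho>"
      by (rule weak_star_conv_of_coupling_cost[OF _ cell_average.mu_radon[OF ca] \<rho> coup cost B0 B(2)])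
        (intro compact_Times D compact_Icc)
    fix n
    show "mu (?L n) (N n) \<in> radon_nonneg ({0..T} \<times> D)" by (rule cell_average.mu_radon[OF ca])
    show "momentum (?L n) (N n) \<in> radon_vec ({0..T} \<times> UNIV)"
      by (rule cell_average.momentum_radon_vec[OF ca])
    show "benamou_brenier T D (mu (?L n) (N n)) (momentum (?L n) (N n)) \<le> ennreal (1 / \<delta> n)"
      using cell_average.energy_le[OF ca, of n] energy_slope_le[OF \<delta>, of n]
      by (meson ennreal_leI order_trans)
  qed
qed

text \<open>
  In terms of \<open>x = \<delta>\<^sup>1\<^sup>/\<^sup>6\<close>, the cell length is about \<open>T x\<close> and the slope is a multiple of \<open>x\<^sup>-\<^sup>3\<close>. The two parts of
  the cost are then of order \<open>x\<^sup>2\<close> and \<open>x\<^sup>-\<^sup>1 x\<^sup>3\<close>.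
\<close>

lemma approximation_with_rate:
  assumes \<delta>: "\<And>n. 0 < \<delta> n" "\<delta> \<longlonglongrightarrow> 0"
  shows "\<exists>\<rho>n \<eta>n. approximating T D \<rho> \<delta> \<rho>n \<eta>n \<and>
    (\<exists>c>0. \<forall>n. wasserstein2 (\<rho>n n) \<rho> \<le> ennreal (c * \<delta> n powr (1/6)))"
proof -
  define x where "x n = \<delta> n powr (1/6)" for n
  have x: "0 < x n" for n using \<delta>(1)[of n] by (simp add: x_def)
  have x6: "\<delta> n = x n ^ 6" for n
    using \<delta>(1)[of n] by (simp add: x_def powr_power)
  have x_lim: "x \<longlonglongrightarrow> 0"
    unfolding x_def using \<delta> by (intro tendsto_zero_powrI[of _ _ _ "1/6"]) (auto intro!: always_eventually less_imp_le)
  obtain X where X: "\<And>n. x n \<le> X"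
    using convergent_imp_bounded[OF x_lim] x by (metis Bseq_def abs_le_iff bounded_iff range_eqI real_norm_def)
  define A where "A = sqrt (r\<^sup>2 * (m * T) + 1)"
  have A: "0 < A" using m_nonneg T by (simp add: A_def add_nonneg_pos)
  have slope: "1 / slope (\<delta> n) = A * x n ^ 3" for n
  proof -
    have "sqrt (x n ^ 6) = x n ^ 3"
      using x[of n] by (intro real_sqrt_unique) (auto simp: power_mult[symmetric])
    then show ?thesis by (simp add: slope_def real_sqrt_mult A_def x6)
  qed
  define N where "N n = nat \<lceil>1 / x n\<rceil>" for n
  have N: "0 < N n" and N1: "1 / x n \<le> real (N n)" and N2: "real (N n) \<le> 1 / x n + 1" for n
    unfolding N_def using nat_ceiling_inverse_bounds[OF x] by auto
  define c where "c = sqrt (T\<^sup>2 * (m * T) + r\<^sup>2 * (m * (2 * (A * (1 + 2 * X)))) + 1)"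
  have X0: "0 \<le> X" using X[of 0] x[of 0] by linarith
  have c_pos: "0 < T\<^sup>2 * (m * T) + r\<^sup>2 * (m * (2 * (A * (1 + 2 * X)))) + 1"
    using m_nonneg T A X0 by (intro add_nonneg_pos add_nonneg_nonneg mult_nonneg_nonneg) auto
  then have c: "0 < c" "c\<^sup>2 = T\<^sup>2 * (m * T) + r\<^sup>2 * (m * (2 * (A * (1 + 2 * X)))) + 1"
    by (simp_all add: c_def)
  have bound: "cost_bound (\<delta> n) (N n) \<le> (c * x n)\<^sup>2" for n
  proof -
    have "T / real (N n) \<le> T * x n"
      using N1[of n] N[of n] x[of n] T by (simp add: field_simps)
    then have 1: "(T / real (N n))\<^sup>2 * (m * T) \<le> (T * x n)\<^sup>2 * (m * T)"
      using T m_nonneg by (intro mult_right_mono power_mono) auto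
    have "2 * (real (N n) + 1) / slope (\<delta> n) = 2 * (real (N n) + 1) * (A * x n ^ 3)"
      using slope[of n] by (simp add: divide_inverse)
    also have "\<dots> \<le> 2 * (1 / x n + 2) * (A * x n ^ 3)"
      using N2[of n] A x[of n] by (intro mult_right_mono) auto
    also have "\<dots> = 2 * (A * (1 + 2 * x n)) * (x n)\<^sup>2"
      using x[of n] by (simp add: field_simps power2_eq_square power3_eq_cube)
    also have "\<dots> \<le> 2 * (A * (1 + 2 * X)) * (x n)\<^sup>2"
      using X[of n] A by (intro mult_right_mono mult_left_mono) auto
    finally have 2: "r\<^sup>2 * (m * (2 * (real (N n) + 1) / slope (\<delta> n))) \<le> r\<^sup>2 * (m * (2 * (A * (1 + 2 * X)) * (x n)\<^sup>2))"
      using m_nonneg by (intro mult_left_mono) auto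
    have "cost_bound (\<delta> n) (N n) \<le> (T * x n)\<^sup>2 * (m * T) + r\<^sup>2 * (m * (2 * (A * (1 + 2 * X)) * (x n)\<^sup>2))"
      unfolding cost_bound_def using 1 2 by (rule add_mono)
    also have "\<dots> = (c\<^sup>2 - 1) * (x n)\<^sup>2" unfolding c by (simp add: power_mult_distrib algebra_simps)
    also have "\<dots> \<le> c\<^sup>2 * (x n)\<^sup>2" by (intro mult_right_mono) auto
    finally show ?thesis by (simp add: power_mult_distrib)
  qed
  have "(\<lambda>n. (c * x n)\<^sup>2) \<longlonglongrightarrow> (c * 0)\<^sup>2" by (intro tendsto_intros x_lim)
  then have B: "(\<lambda>n. (c * x n)\<^sup>2) \<longlonglongrightarrow> 0" by simp
  note approx = approximating_of_cost_bound[OF \<delta>(1) N bound B]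
  have "wasserstein2 (mu (slope (\<delta> n)) (N n)) \<rho> \<le> ennreal (c * \<delta> n powr (1/6))" for n
    using approx(2)[of n] c x[of n] by (simp add: x_def[symmetric] real_sqrt_unique)
  then show ?thesis using approx(1) c(1) by blast
qed

text \<open>
  With \<open>e = 1 / L + \<Delta>\<close>, cells of length about \<open>\<surd>e\<close> are short and yet leave only times of measure of order \<open>\<surd>e\<close>
  within distance \<open>e\<close> of the nodes.
\<close>

lemma approximation_at_shifted_times:
  assumes \<delta>: "\<And>n. 0 < \<delta> n" "\<delta> \<longlonglongrightarrow> 0" and \<Delta>: "\<And>n. 0 \<le> \<Delta> n" "\<Delta> \<longlonglongrightarrow> 0"
  shows "\<exists>\<rho>n \<eta>n. approximating T D \<rho> \<delta> \<rho>n \<eta>n \<and>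
    (\<exists>R. (\<forall>n. disintegrates T D (\<rho>n n) (R n) \<and> weak_star_continuous T D (R n)) \<and>
      (\<exists>r :: nat \<Rightarrow> nat. strict_mono r \<and>
        (AE t in lborel. t \<in> {0..T} \<longrightarrow>
          (\<forall>\<tau>. (\<forall>n. \<tau> n \<in> {0..T} \<and> \<bar>\<tau> n - t\<bar> \<le> \<Delta> n) \<longrightarrow>
            (\<lambda>k. wasserstein2 (R (r k) (\<tau> (r k))) (\<rho>t t)) \<longlonglongrightarrow> 0))))"
proof -
  define e where "e n = 1 / slope (\<delta> n) + \<Delta> n" for n
  have sl: "0 < 1 / slope (\<delta> n)" for n using slope_pos[OF \<delta>(1)] by simp
  have e: "0 < e n" for n unfolding e_def using sl \<Delta>(1) by (rule add_pos_nonneg)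
  have "(\<lambda>n. sqrt ((r\<^sup>2 * (m * T) + 1) * \<delta> n) + \<Delta> n) \<longlonglongrightarrow> sqrt ((r\<^sup>2 * (m * T) + 1) * 0) + 0"
    by (intro tendsto_intros \<delta> \<Delta>)
  then have e_lim: "e \<longlonglongrightarrow> 0" by (simp add: e_def[abs_def] slope_def)
  have se: "0 < sqrt (e n)" for n using e by simp
  have "(\<lambda>n. sqrt (e n)) \<longlonglongrightarrow> sqrt 0" by (intro tendsto_intros e_lim)
  then have se_lim: "(\<lambda>n. sqrt (e n)) \<longlonglongrightarrow> 0" by simp
  define N where "N n = nat \<lceil>1 / sqrt (e n)\<rceil>" for n
  have N: "0 < N n" and N1: "1 / sqrt (e n) \<le> real (N n)" and N2: "real (N n) \<le> 1 / sqrt (e n) + 1" for n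
    unfolding N_def using nat_ceiling_inverse_bounds[OF se] by auto
  have N_top: "filterlim N at_top sequentially"
  proof -
    have "filterlim (\<lambda>n. inverse (sqrt (e n))) at_top sequentially"
      by (rule filterlim_inverse_at_top[OF se_lim]) (use se in simp)
    then have "filterlim (\<lambda>n. real (N n)) at_top sequentially"
      by (rule filterlim_at_top_mono) (use N1 in \<open>auto simp: inverse_eq_divide\<close>)
    then show ?thesis by (simp add: filterlim_sequentially_iff_filterlim_real)
  qed
  have Ne: "(real (N n) + 1) * e n \<le> sqrt (e n) + 2 * e n" for n
  proof -
    have "(real (N n) + 1) * e n \<le> (1 / sqrt (e n) + 2) * e n"
      using N2[of n] e[of n] by (intro mult_right_mono) auto
    also have "\<dots> = sqrt (e n) + 2 * e n"
      using e[of n] real_div_sqrt[of "e n"] by (simp add: distrib_right)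
    finally show ?thesis .
  qed
  have Ne_lim: "(\<lambda>n. 2 * (real (N n) + 1) * e n) \<longlonglongrightarrow> 0"
  proof (rule tendsto_sandwich[OF _ _ tendsto_const])
    have "(\<lambda>n. 2 * (sqrt (e n) + 2 * e n)) \<longlonglongrightarrow> 2 * (0 + 2 * 0)"
      by (intro tendsto_intros se_lim e_lim)
    then show "(\<lambda>n. 2 * (sqrt (e n) + 2 * e n)) \<longlonglongrightarrow> 0" by simp
    show "\<forall>\<^sub>F n in sequentially. 0 \<le> 2 * (real (N n) + 1) * e n"
      using e by (auto intro!: always_eventually mult_nonneg_nonneg less_imp_le)
    show "\<forall>\<^sub>F n in sequentially. 2 * (real (N n) + 1) * e n \<le> 2 * (sqrt (e n) + 2 * e n)"
    proof (intro always_eventually allI)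
      fix n
      show "2 * (real (N n) + 1) * e n \<le> 2 * (sqrt (e n) + 2 * e n)"
        unfolding mult.assoc by (rule mult_left_mono[OF Ne]) simp
    qed
  qed
  define B where "B n = (T * sqrt (e n))\<^sup>2 * (m * T) + r\<^sup>2 * (m * (2 * (real (N n) + 1) * e n))" for n
  have bound: "cost_bound (\<delta> n) (N n) \<le> B n" for n
    unfolding cost_bound_def B_def
  proof (intro add_mono mult_right_mono mult_left_mono power_mono)
    show "T / real (N n) \<le> T * sqrt (e n)"
      using N1[of n] N[of n] se[of n] T by (simp add: field_simps)
    have "2 * (real (N n) + 1) * (1 / slope (\<delta> n)) \<le> 2 * (real (N n) + 1) * e n"
      using \<Delta>(1)[of n] by (intro mult_left_mono) (auto simp: e_def)
    then show "2 * (real (N n) + 1) / slope (\<delta> n) \<le> 2 * (real (N n) + 1) * e n" by simp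
  qed (use T m_nonneg in auto)
  have "(\<lambda>n. (T * sqrt (e n))\<^sup>2 * (m * T) + r\<^sup>2 * (m * (2 * (real (N n) + 1) * e n)))
      \<longlonglongrightarrow> (T * 0)\<^sup>2 * (m * T) + r\<^sup>2 * (m * 0)"
    by (intro tendsto_intros se_lim Ne_lim)
  then have B: "B \<longlonglongrightarrow> 0" by (simp add: B_def[abs_def])
  have ca: "cell_average T (slope (\<delta> n)) m r (N n) D \<rho>" for n
    using N slope_pos[OF \<delta>(1)] by (intro cell_average) (auto intro: less_imp_le)
  define Rn where "Rn n = R (slope (\<delta> n)) (N n)" for n
  have "\<forall>j. \<exists>(M :: nat) (Q :: nat \<Rightarrow> (real^3) set). (\<forall>i<M. Q i \<in> sets borel) \<and> disjoint_family_on Q {..<M}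
      \<and> (\<Union>i<M. Q i) = D \<and> (\<forall>i<M. \<forall>x\<in>Q i. \<forall>y\<in>Q i. dist x y \<le> inverse (real (Suc j)))"
    using compact_small_partition[OF D(1)] by simp
  then obtain M :: "nat \<Rightarrow> nat" and Q :: "nat \<Rightarrow> nat \<Rightarrow> (real^3) set"
    where Q: "\<And>j i. i < M j \<Longrightarrow> Q j i \<in> sets borel" "\<And>j. disjoint_family_on (Q j) {..<M j}"
      "\<And>j. (\<Union>i<M j. Q j i) = D"
      "\<And>j i x y. i < M j \<Longrightarrow> x \<in> Q j i \<Longrightarrow> y \<in> Q j i \<Longrightarrow> dist x y \<le> inverse (real (Suc j))"
    by metis
  (* one enumeration of the cells of all the partitions *)
  define C where "C l = (case prod_decode l of (j, i) \<Rightarrow> if i < M j then Q j i else {})" for l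
  have C_borel: "C l \<in> sets borel" for l
    unfolding C_def using Q(1) by (auto split: prod.split)
  from averages_converge_along_subsequence[where B = C and \<epsilon> = e, OF T N N_top dis finite_rho mass C_borel less_imp_le[OF e] Ne_lim]
  obtain q :: "nat \<Rightarrow> nat" where q: "strict_mono q"
    and good: "AE t in lborel. t \<in> {0..T} \<longrightarrow>
     (\<forall>\<^sub>F k in sequentially. t \<notin> near_nodes T (N (q k)) (e (q k))) \<and>
     (\<forall>l. (\<lambda>k. cell_mean T (N (q k)) \<rho> (C l) t) \<longlonglongrightarrow> measure (\<rho>t t) (C l))"
    by (elim exE conjE)
  have "AE t in lborel. t \<in> {0..T} \<longrightarrow>
          (\<forall>\<tau>. (\<forall>n. \<tau> n \<in> {0..T} \<and> \<bar>\<tau> n - t\<bar> \<le> \<Delta> n) \<longrightarrow>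
            (\<lambda>k. wasserstein2 (Rn (q k) (\<tau> (q k))) (\<rho>t t)) \<longlonglongrightarrow> 0)"
    using good mass
  proof eventually_elim
    case (elim t)
    show ?case
    proof (intro impI allI)
      fix \<tau> assume t: "t \<in> {0..T}" and \<tau>: "\<forall>n. \<tau> n \<in> {0..T} \<and> \<bar>\<tau> n - t\<bar> \<le> \<Delta> n"
      have far: "\<forall>\<^sub>F k in sequentially. t \<notin> near_nodes T (N (q k)) (e (q k))"
        and avg: "\<And>l. (\<lambda>k. cell_mean T (N (q k)) \<rho> (C l) t) \<longlonglongrightarrow> measure (\<rho>t t) (C l)"
        using elim(1) t by auto
      have R_avg: "measure (Rn n (\<tau> n)) A = cell_mean T (N n) \<rho> A t"
        if far_n: "t \<notin> near_nodes T (N n) (e n)" and A: "A \<in> sets borel" for n A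
      proof -
        have \<tau>n: "\<tau> n \<in> {0..T}" "\<bar>\<tau> n - t\<bar> \<le> \<Delta> n" using \<tau> by auto
        have "\<tau> n \<notin> near_nodes T (N n) (1 / slope (\<delta> n))"
        proof
          assume "\<tau> n \<in> near_nodes T (N n) (1 / slope (\<delta> n))"
          then obtain j where j: "j \<le> N n" "\<bar>\<tau> n - node T (N n) j\<bar> \<le> 1 / slope (\<delta> n)"
            unfolding near_nodes_def by auto
          then have "\<bar>t - node T (N n) j\<bar> \<le> e n" using \<tau>n(2) by (simp add: e_def)
          then show False using not_near_nodesD[OF t far_n j(1)] by simp
        qed
        then have lam: "cell_average.lam T (slope (\<delta> n)) (N n) (\<tau> n) = 1"
          by (rule cell_average.lam_eq_1[OF ca slope_pos[OF \<delta>(1)] \<tau>n(1)])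
        have "\<bar>\<tau> n - t\<bar> \<le> e n" using \<tau>n(2) sl[of n] unfolding e_def by linarith
        then have "cell_index T (N n) (\<tau> n) = cell_index T (N n) t"
          by (rule cell_index_stable[OF T N t far_n])
        then show ?thesis
          unfolding Rn_def using cell_average.measure_R_eq_cell_mean[OF ca lam A] by (simp add: cell_mean_def)
      qed
      show "(\<lambda>k. wasserstein2 (Rn (q k) (\<tau> (q k))) (\<rho>t t)) \<longlonglongrightarrow> 0"
      proof (rule wasserstein2_tendsto_0_of_partitions[OF D(1), where r = "2 * r" and m = m and M = M and Q = Q
            and \<epsilon> = "\<lambda>j. inverse (real (Suc j))"])
        show "dist x y \<le> 2 * r" if "x \<in> D" "y \<in> D" for x y
          using r[OF that(1)] r[OF that(2)] norm_triangle_ineq4[of x y] by (simp add: dist_norm)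
        show "\<forall>\<^sub>F k in sequentially. Rn (q k) (\<tau> (q k)) \<in> radon_nonneg D \<and> measure (Rn (q k) (\<tau> (q k))) UNIV = m"
          unfolding Rn_def using \<tau> m_nonneg
          by (intro always_eventually allI conjI cell_average.R_radon[OF ca])
            (auto simp: measure_def cell_average.emeasure_R_UNIV[OF ca])
        show "\<rho>t t \<in> radon_nonneg D" using dis t by (simp add: disintegrates_def)
        show "measure (\<rho>t t) UNIV = m" using elim(2) t by simp
        show "(\<lambda>j. inverse (real (Suc j))) \<longlonglongrightarrow> 0" by (rule LIMSEQ_inverse_real_of_nat)
        fix j i assume i: "i < M j"
        have Cl: "C (prod_encode (j, i)) = Q j i" using i by (simp add: C_def)
        show "(\<lambda>k. measure (Rn (q k) (\<tau> (q k))) (Q j i)) \<longlonglongrightarrow> measure (\<rho>t t) (Q j i)"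
        proof (rule Lim_transform_eventually)
          show "(\<lambda>k. cell_mean T (N (q k)) \<rho> (Q j i) t) \<longlonglongrightarrow> measure (\<rho>t t) (Q j i)"
            using avg[of "prod_encode (j, i)"] by (simp only: Cl)
          show "\<forall>\<^sub>F k in sequentially. cell_mean T (N (q k)) \<rho> (Q j i) t
            = measure (Rn (q k) (\<tau> (q k))) (Q j i)"
            using far by eventually_elim (simp add: R_avg Q(1)[OF i])
        qed
      qed (use Q in auto)
    qed
  qed
  moreover have "disintegrates T D (mu (slope (\<delta> n)) (N n)) (Rn n) \<and> weak_star_continuous T D (Rn n)" for n
    unfolding Rn_def using cell_average.mu_disintegrates[OF ca] cell_average.R_weak_star_continuous[OF ca] by blast
  ultimately show ?thesis
    using approximating_of_cost_bound(1)[OF \<delta>(1) N bound B] q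
    by (intro exI[of _ "\<lambda>n. mu (slope (\<delta> n)) (N n)"] exI[of _ "\<lambda>n. momentum (slope (\<delta> n)) (N n)"]
        exI[of _ Rn] exI[of _ q] conjI allI) simp_all
qed

end

theorem lemma3p4:
  fixes T :: real and U D :: "(real^3) set"
    and \<rho> :: "(real \<times> (real^3)) measure" and \<rho>t :: "real \<Rightarrow> (real^3) measure"
    and \<delta> :: "nat \<Rightarrow> real"
  assumes "T > 0"
    and "bounded U" and "open U" and "convex U" and "D = closure U" and "0 \<in> interior D"
    and "\<rho> \<in> radon_nonneg ({0..T} \<times> D)"
    and "disintegrates T D \<rho> \<rho>t"
    and "\<exists>m. AE t in lborel. t \<in> {0..T} \<longrightarrow> measure (\<rho>t t) D = m"
    and "\<And>n. \<delta> n > 0" and "\<delta> \<longlonglongrightarrow> 0"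
  shows
    "(\<exists>\<rho>n \<eta>n. approximating T D \<rho> \<delta> \<rho>n \<eta>n \<and>
        (\<exists>c>0. \<forall>n. wasserstein2 (\<rho>n n) \<rho> \<le> ennreal (c * \<delta> n powr (1/6))))
     \<and>
     (\<forall>\<Delta>T :: nat \<Rightarrow> real. (\<forall>n. \<Delta>T n \<ge> 0) \<longrightarrow> \<Delta>T \<longlonglongrightarrow> 0 \<longrightarrow>
        (\<exists>\<rho>n \<eta>n. approximating T D \<rho> \<delta> \<rho>n \<eta>n \<and>
          (\<exists>R. (\<forall>n. disintegrates T D (\<rho>n n) (R n) \<and> weak_star_continuous T D (R n)) \<and>
            (\<exists>r :: nat \<Rightarrow> nat. strict_mono r \<and>
              (AE t in lborel. t \<in> {0..T} \<longrightarrow>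
                (\<forall>\<tau>. (\<forall>n. \<tau> n \<in> {0..T} \<and> \<bar>\<tau> n - t\<bar> \<le> \<Delta>T n) \<longrightarrow>
                  (\<lambda>k. wasserstein2 (R (r k) (\<tau> (r k))) (\<rho>t t)) \<longlonglongrightarrow> 0))))))"
proof -
  obtain m where m: "AE t in lborel. t \<in> {0..T} \<longrightarrow> measure (\<rho>t t) D = m"
    using assms(9) by blast
  have D: "compact D" "convex D" "0 \<in> D"
    using assms(2,4,5,6) interior_subset by (auto simp: compact_closure convex_closure)
  obtain r where r: "\<And>x. x \<in> D \<Longrightarrow> norm x \<le> r"
    using compact_imp_bounded[OF D(1)] by (auto simp: bounded_iff)
  interpret constant_mass_curve T m r D \<rho> \<rho>t
    by unfold_locales (use assms D r m in auto)
  show ?thesis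
    using approximation_with_rate[OF assms(10,11)] approximation_at_shifted_times[OF assms(10,11)] by blast
qed

end
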